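(* Consider the sequence of linear models $\mathbf y=\mathbf X\boldsymbol\beta+\boldsymbol\epsilon$ and test designs $\widetilde{\mathbf X}$ described in the context, with ridge estimator $\hat{\boldsymbol\beta}_\lambda=(\mathbf X^\top\mathbf X+\lambda\mathbf I)^{-1}\mathbf X^\top\mathbf y$ and conditional out-of-sample risk $R_{\mathbf X,\mathbf y}$. Fix a grid $0<\ell_1<\dots<\ell_L$ with $L\ge2$, and for each $n$ and $i=1,\dots,L$ set, with $\gamma_n=p/n$, $$a_i=\frac{\ell_i^2}{\gamma_n}\left(v_{\mathbf D}(-\ell_i)-\ell_iv'_{\mathbf D}(-\ell_i)\right),\qquad b_i=\ell_i^2v'_{\mathbf D}(-\ell_i),\qquad t_i=\frac1n\|\mathbf y-\mathbf X\hat{\boldsymbol\beta}_{\ell_i}\|_2^2,$$ $$\hat\sigma^2=\frac{\sum_{i=1}^L\left(\frac{t_i}{a_i}-\frac{t_1}{a_1}\right)\left(\frac{b_i}{a_i}-\frac{b_1}{a_1}\right)}{\sum_{i=1}^L\left(\frac{b_i}{a_i}-\frac{b_1}{a_1}\right)^2},\qquad \hat r^2=\frac{\sum_{i=1}^L\left(\frac{t_i}{b_i}-\frac{t_1}{b_1}\right)\left(\frac{a_i}{b_i}-\frac{a_1}{b_1}\right)}{\sum_{i=1}^L\left(\frac{a_i}{b_i}-\frac{a_1}{b_1}\right)^2},$$ and define $$\mathsf{ROTI\text{-}GCV}(\lambda)=\hat r^2\left(\frac{\lambda^2}{\gamma_n}v'_{\mathbf D}(-\lambda)+\frac{\gamma_n-1}{\gamma_n}\right)+\hat\sigma^2\left(v_{\mathbf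 D}(-\lambda)-\lambda v'_{\mathbf D}(-\lambda)\right).$$ Then for any fixed $0<\lambda_1<\lambda_2<\infty$, as $n\to\infty$, $$\sup_{\lambda\in[\lambda_1,\lambda_2]}\left|\mathsf{ROTI\text{-}GCV}(\lambda)-R_{\mathbf X,\mathbf y}(\hat{\boldsymbol\beta}_\lambda,\boldsymbol\beta)\right|\xrightarrow{a.s.}0 .$$
   Context: Right-rotationally invariant design: a random matrix $\mathbf X\in\mathbb R^{n\times p}$ with $\mathbf X\mathbf O_0\stackrel d=\mathbf X$ for every $p\times p$ orthogonal matrix $\mathbf O_0$; equivalently, it has a singular value decomposition $\mathbf X=\mathbf Q^\top\mathbf D\mathbf O$ ($\mathbf Q$ an $n\times n$ orthogonal matrix, $\mathbf D\in\mathbb R^{n\times p}$ diagonal with the singular values on the diagonal, $\mathbf O$ a $p\times p$ orthogonal matrix) with $\mathbf O$ Haar distributed on the orthogonal group and independent of $(\mathbf Q,\mathbf D)$. Setting (all objects are indexed by $n$; the index is suppressed): - $\mathbf X=\mathbf Q^\top\mathbf D\mathbf O\in\mathbb R^{n\times p}$ is right-rotationally invariant, $p=p(n)$, $n\to\infty$, $p(n)/n\to\gamma\in(0,\infty)$. - There is a constant $C$ such that almost surely the limsup as $n\to\infty$ of the largest diagonal entry (largest singular value) of $\mathbf D$ is $<C$. - $\mathbf y=\mathbf X\boldsymbol\beta+\boldsymbol\epsilon$, with $\boldsymbol\beta\in\mathbb R^p$, $\|\boldsymbol\beta\|=r\sqrt n$ for a constant $r\ge 0$, and $\boldsymbol\beta$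 either fixed or random and independent of $(\mathbf X,\boldsymbol\epsilon)$. - $\boldsymbol\epsilon\in\mathbb R^n$ is independent of $\mathbf X$ and has independent entries with $\mathbb E[\epsilon_i]=0$, $\mathbb E[\epsilon_i^2]=\sigma^2$, and $\mathbb E[|\epsilon_i|^{4+\eta}]<\infty$ for some $\eta>0$. - The test design $\widetilde{\mathbf X}=\widetilde{\mathbf Q}^\top\widetilde{\mathbf D}\widetilde{\mathbf O}\in\mathbb R^{n'\times p}$ is drawn independently of the training data and of $\boldsymbol\beta$ from a possibly different right-rotationally invariant ensemble, normalized so that $\frac{n\,\mathbb E[\mathrm{Tr}(\widetilde{\mathbf D}^\top\widetilde{\mathbf D})]}{n'p}=1$. Risk: $R_{\mathbf X,\mathbf y}(\hat{\boldsymbol\beta},\boldsymbol\beta)=\frac1{n'}\mathbb E\left[\|\widetilde{\mathbf X}\hat{\boldsymbol\beta}-\widetilde{\mathbf X}\boldsymbol\beta\|^2\mid\mathbf X,\mathbf y\right]$, where the expectation is over $\widetilde{\mathbf X}$ only, with $\boldsymbol\beta$ and the training data held fixed. Notation: with $D_{ii}:=0$ for $i>\min(n,p)$, $v_{\mathbf D}(z)=\frac1n\sum_{i=1}^n\frac{1}{D_{ii}^2-z}$, and $v'_{\mathbf D}$ is its derivative in $z$, so $v'_{\mathbf D}(-\lambda)=\frac1n\sum_{i=1}^n\frac1{(D_{ii}^2+\lambda)^2}$.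
   Formalization: Adds that a.s. the liminf of the variance of D_11^2,...,D_nn^2 is positive (for D = I both estimators are 0/0) and that E|eps_i|^(4+eta) is bounded uniformly in n and i with one eta (otherwise the noise averages need not converge). *)

theory Defs
  imports
    "HOL-Probability.Probability"
    "Jordan_Normal_Form.Gauss_Jordan_Elimination"
begin

no_notation inner (infix "\<bullet>" 70)
no_notation vec_nth (infixl "$" 90)

text \<open>The Borel \<open>\<sigma>\<close>-algebras on \<open>\<real>\<^sup>n\<^sup>\<times>\<^sup>p\<close> and \<open>\<real>\<^sup>n\<close>, transported along the bijection that maps
  a matrix (vector) to the family of its entries.\<close>

definition mat_borel :: "nat \<Rightarrow> nat \<Rightarrow> real mat measure" where
  "mat_borel n p = vimage_algebra (carrier_mat n p)
     (\<lambda>A. \<lambda>ij\<in>{..<n} \<times> {..<p}. A $$ ij) (\<Pi>\<^sub>M ij\<in>{..<n} \<times> {..<p}. borel)"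

definition vec_borel :: "nat \<Rightarrow> real Matrix.vec measure" where
  "vec_borel n = vimage_algebra (carrier_vec n)
     (\<lambda>v. \<lambda>i\<in>{..<n}. v $ i) (\<Pi>\<^sub>M i\<in>{..<n}. borel)"

text \<open>\<^const>\<open>prob_space.indep_var\<close> requires both variables to have the same type; this is the
  same notion for variables of different types.\<close>

definition indep_rv ::
  "'w measure \<Rightarrow> 'a measure \<Rightarrow> ('w \<Rightarrow> 'a) \<Rightarrow> 'b measure \<Rightarrow> ('w \<Rightarrow> 'b) \<Rightarrow> bool" where
  "indep_rv M S U T V \<longleftrightarrow> U \<in> M \<rightarrow>\<^sub>M S \<and> V \<in> M \<rightarrow>\<^sub>M T \<and>
     prob_space.indep_set M {U -` A \<inter> space M | A. A \<in> sets S} {V -` B \<inter> space M | B. B \<in> sets T}"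

definition orth_mat :: "nat \<Rightarrow> real mat \<Rightarrow> bool" where
  "orth_mat k W \<longleftrightarrow> W \<in> carrier_mat k k \<and> transpose_mat W * W = 1\<^sub>m k"

definition right_rot_invariant ::
  "'w measure \<Rightarrow> nat \<Rightarrow> nat \<Rightarrow> ('w \<Rightarrow> real mat) \<Rightarrow> bool" where
  "right_rot_invariant M n p X \<longleftrightarrow> X \<in> M \<rightarrow>\<^sub>M mat_borel n p \<and>
     (\<forall>W. orth_mat p W \<longrightarrow>
        distr M (mat_borel n p) (\<lambda>\<omega>. X \<omega> * W) = distr M (mat_borel n p) X)"

definition is_svd ::
  "nat \<Rightarrow> nat \<Rightarrow> real mat \<Rightarrow> real mat \<Rightarrow> real mat \<Rightarrow> real mat \<Rightarrow> bool" where
  "is_svd n p X Q D W \<longleftrightarrow> orth_mat n Q \<and> orth_mat p W \<and>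
     D \<in> carrier_mat n p \<and> diagonal_mat D \<and> (\<forall>i<min n p. 0 \<le> D $$ (i, i)) \<and>
     X = transpose_mat Q * D * W"

definition mat_trace :: "real mat \<Rightarrow> real" where
  "mat_trace A = (\<Sum>i<dim_row A. A $$ (i, i))"

definition vnorm :: "real Matrix.vec \<Rightarrow> real" where
  "vnorm v = sqrt (v \<bullet> v)"

definition ridge :: "real mat \<Rightarrow> real Matrix.vec \<Rightarrow> real \<Rightarrow> real Matrix.vec" where
  "ridge X y l =
     the (mat_inverse (transpose_mat X * X + l \<cdot>\<^sub>m 1\<^sub>m (dim_col X))) *\<^sub>v (transpose_mat X *\<^sub>v y)"

text \<open>The expectation runs over the test design \<open>Xt\<close> (with \<open>m\<close> rows) only; the estimate \<open>b\<close> and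
  the signal \<open>\<beta>\<close> are held fixed.\<close>

definition oos_risk ::
  "'w measure \<Rightarrow> nat \<Rightarrow> ('w \<Rightarrow> real mat) \<Rightarrow> real Matrix.vec \<Rightarrow> real Matrix.vec \<Rightarrow> real" where
  "oos_risk M m Xt b \<beta> = (\<integral>\<omega>. (vnorm (Xt \<omega> *\<^sub>v b - Xt \<omega> *\<^sub>v \<beta>))\<^sup>2 \<partial>M) / real m"

text \<open>Below, \<open>D\<close> is an \<open>n \<times> p\<close> diagonal matrix, so \<open>n\<close> is \<^term>\<open>dim_row D\<close> and \<open>p\<close> is
  \<^term>\<open>dim_col D\<close>.\<close>

definition diag_entry :: "real mat \<Rightarrow> nat \<Rightarrow> real" where
  "diag_entry D i = (if i < min (dim_row D) (dim_col D) then D $$ (i, i) else 0)"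

definition aspect :: "real mat \<Rightarrow> real" where
  "aspect D = real (dim_col D) / real (dim_row D)"

definition v_D :: "real mat \<Rightarrow> real \<Rightarrow> real" where
  "v_D D z = (\<Sum>i<dim_row D. 1 / ((diag_entry D i)\<^sup>2 - z)) / real (dim_row D)"

definition v_D' :: "real mat \<Rightarrow> real \<Rightarrow> real" where
  "v_D' D z = deriv (v_D D) z"

definition coef_a :: "real mat \<Rightarrow> real \<Rightarrow> real" where
  "coef_a D l = l\<^sup>2 / aspect D * (v_D D (- l) - l * v_D' D (- l))"

definition coef_b :: "real mat \<Rightarrow> real \<Rightarrow> real" where
  "coef_b D l = l\<^sup>2 * v_D' D (- l)"

definition train_err :: "real mat \<Rightarrow> real Matrix.vec \<Rightarrow> real \<Rightarrow> real" where
  "train_err X y l = (vnorm (y - X *\<^sub>v ridge X y l))\<^sup>2 / real (dim_row X)"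

definition sigma2_hat ::
  "nat \<Rightarrow> (nat \<Rightarrow> real) \<Rightarrow> real mat \<Rightarrow> real Matrix.vec \<Rightarrow> real mat \<Rightarrow> real" where
  "sigma2_hat L ell X y D =
     (let a = (\<lambda>i. coef_a D (ell i)); b = (\<lambda>i. coef_b D (ell i)); t = (\<lambda>i. train_err X y (ell i))
      in (\<Sum>i=1..L. (t i / a i - t 1 / a 1) * (b i / a i - b 1 / a 1))
         / (\<Sum>i=1..L. (b i / a i - b 1 / a 1)\<^sup>2))"

definition r2_hat ::
  "nat \<Rightarrow> (nat \<Rightarrow> real) \<Rightarrow> real mat \<Rightarrow> real Matrix.vec \<Rightarrow> real mat \<Rightarrow> real" where
  "r2_hat L ell X y D =
     (let a = (\<lambda>i. coef_a D (ell i)); b = (\<lambda>i. coef_b D (ell i)); t = (\<lambda>i. train_err X y (ell i))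
      in (\<Sum>i=1..L. (t i / b i - t 1 / b 1) * (a i / b i - a 1 / b 1))
         / (\<Sum>i=1..L. (a i / b i - a 1 / b 1)\<^sup>2))"

definition roti_gcv ::
  "nat \<Rightarrow> (nat \<Rightarrow> real) \<Rightarrow> real mat \<Rightarrow> real Matrix.vec \<Rightarrow> real mat \<Rightarrow> real \<Rightarrow> real" where
  "roti_gcv L ell X y D lam =
     r2_hat L ell X y D * (lam\<^sup>2 / aspect D * v_D' D (- lam) + (aspect D - 1) / aspect D)
     + sigma2_hat L ell X y D * (v_D D (- lam) - lam * v_D' D (- lam))"

text \<open>The variance of the uniform distribution on \<open>D\<^sub>1\<^sub>1\<^sup>2, \<dots>, D\<^sub>n\<^sub>n\<^sup>2\<close>. The ratios \<open>a\<^sub>i / b\<^sub>i\<close> at distinct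
  grid points are all equal exactly if it vanishes, and then \<^const>\<open>sigma2_hat\<close> and \<^const>\<open>r2_hat\<close>
  are quotients with denominator 0.\<close>

definition spectral_var :: "real mat \<Rightarrow> real" where
  "spectral_var D =
     (let n = dim_row D; m = (\<Sum>i<n. (diag_entry D i)\<^sup>2) / real n
      in (\<Sum>i<n. ((diag_entry D i)\<^sup>2 - m)\<^sup>2) / real n)"

end

theory Submission
  imports Defs "Jordan_Normal_Form.Determinant"
begin

text \<open>The test design enters the risk only through \<open>E (Xt^T Xt)\<close>, which commutes with all
rotations and is therefore a multiple of the identity; so the risk of an estimate of \<open>\<beta>\<close> is its
squared distance from \<open>\<beta>\<close>, divided by \<open>n\<close> (\<open>oos_risk_eq\<close>). In the singular bases of \<open>X\<close> both
this error and the training error \<open>t\<close> at penalty \<open>l\<close> are exact combinations, with coefficients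
depending on \<open>l\<close> only, of signal forms \<open>\<beta>^T G^k \<beta>\<close> with \<open>G = (X^T X + l)^-1\<close>, of noise forms
\<open>\<epsilon>^T H^k \<epsilon>\<close> with \<open>H = (X X^T + l)^-1\<close>, and of one cross form \<open>\<epsilon>^T X G\<^sup>2 \<beta>\<close> (\<open>ridge_train_err\<close>,
\<open>ridge_risk\<close>). Replacing each form by its centre, a multiple of a normalized trace, turns \<open>t\<close>
into \<open>r\<^sup>2 a + \<sigma>\<^sup>2 b\<close>, with the coefficients \<open>a, b\<close> of the grid evaluated at \<open>l\<close>, and the risk into
the ROTI-GCV expression with the true \<open>r\<^sup>2, \<sigma>\<^sup>2\<close> in place of the estimates (\<open>train_err_dev\<close>,
\<open>risk_dev\<close>). It remains to show that the centred forms vanish, uniformly in the penalty, and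
that the two estimators are consistent.

For concentration a single tail bound suffices: a centred quadratic form in \<open>n\<close> independent
variables with \<open>4 + 2 \<kappa>\<close> moments exceeds \<open>\<delta> n\<close> with probability \<open>O(n^-(1 + \<kappa>/2))\<close>
(\<open>quad_dev_tail\<close>). This is summable, so the Borel--Cantelli lemma applies to the variables as
they are, without truncation. Noise forms are of this kind once the design is fixed by
conditioning. For signal forms, right-rotational invariance makes the tail probability a
function of \<open>|\<beta>|\<close> alone, and hence equal to its average over the vectors \<open>\<beta>\<close> with entries
\<open>\<plusminus> r sqrt(n/p)\<close>, whose norm is exactly right; that average is a tail probability for a quadratic
form in independent signs (\<open>signal_tail_fixed\<close>). The cross form is linear in the noise and
yields to fourth moments.

Almost sure convergence is obtained at the countably many penalties that are rational or on the
grid. All forms are Lipschitz in \<open>l\<close> on compact intervals with constants that stay bounded along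
the sequence, so convergence at the rational penalties is uniform
(\<open>uniform_limit_of_equi_Lipschitz\<close>). At the grid points \<open>t_i = r\<^sup>2 a_i + \<sigma>\<^sup>2 b_i + o(1)\<close>, and
dividing by \<open>a_i\<close> or by \<open>b_i\<close> makes the estimators least-squares slopes
(\<open>ratio_regression_consistent\<close>). They are stable because \<open>a_1 b_2 - a_2 b_1\<close> stays away from
zero, which follows from the spectrum of \<open>X X^T\<close> having variance bounded below
(\<open>resolvent_moment_determinant\<close>).\<close>

section \<open>Quadratic forms in independent variables\<close>

text \<open>The linear term is kept exact because it disappears on integrating a centred \<open>d\<close>. The
second derivative at an intermediate point \<open>z\<close> is of order \<open>(1 + z\<^sup>2) powr (\<kappa> / 2)\<close>, and since
\<open>\<kappa> / 2 \<le> 1\<close> this splits into a contribution of \<open>x\<close> and one of \<open>d\<close>.\<close>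

lemma powr_one_plus_square_Taylor:
  fixes x d \<kappa> :: real
  assumes \<kappa>: "0 < \<kappa>" "\<kappa> \<le> 1"
  shows "(1 + (x + d)\<^sup>2) powr (1 + \<kappa> / 2) \<le>
    (1 + x\<^sup>2) powr (1 + \<kappa> / 2) + (2 + \<kappa>) * x * (1 + x\<^sup>2) powr (\<kappa> / 2) * d
    + 12 * d\<^sup>2 * ((1 + x\<^sup>2) powr (\<kappa> / 2) + \<bar>d\<bar> powr \<kappa>)"
proof -
  define g1 where "g1 = (\<lambda>z::real. (2 + \<kappa>) * z * (1 + z\<^sup>2) powr (\<kappa> / 2))"
  define g2 where "g2 = (\<lambda>z::real. (2 + \<kappa>) * (1 + z\<^sup>2) powr (\<kappa> / 2)
    + (2 + \<kappa>) * z * (\<kappa> * z * (1 + z\<^sup>2) powr (\<kappa> / 2 - 1)))"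
  have pos: "0 < 1 + z\<^sup>2" for z :: real by (simp add: add_pos_nonneg)
  have D0: "((\<lambda>z. (1 + z\<^sup>2) powr (1 + \<kappa> / 2)) has_real_derivative g1 z) (at z)" for z
    using pos[of z] unfolding g1_def
    by (auto intro!: derivative_eq_intros simp: field_simps)
  have D1: "(g1 has_real_derivative g2 z) (at z)" for z
  proof -
    have "1 + z\<^sup>2 \<noteq> 0" "2 + 2 * z\<^sup>2 \<noteq> 0" using pos[of z] by linarith+
    then show ?thesis
      using pos[of z] unfolding g1_def g2_def
      by (auto intro!: derivative_eq_intros simp: powr_diff field_simps power2_eq_square)
  qed
  have g2_le: "g2 z \<le> 6 * (1 + z\<^sup>2) powr (\<kappa> / 2)" for z
  proof -
    have "z\<^sup>2 * (1 + z\<^sup>2) powr (\<kappa> / 2 - 1) \<le> (1 + z\<^sup>2) powr (\<kappa> / 2)"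
      using pos[of z] by (simp add: powr_diff divide_le_eq mult.commute mult_left_mono)
    then have "(2 + \<kappa>) * \<kappa> * (z\<^sup>2 * (1 + z\<^sup>2) powr (\<kappa> / 2 - 1)) \<le> 3 * (1 + z\<^sup>2) powr (\<kappa> / 2)"
      using \<kappa> mult_mono[of "2 + \<kappa>" 3 \<kappa> 1] by (intro mult_mono) auto
    moreover have "(2 + \<kappa>) * (1 + z\<^sup>2) powr (\<kappa> / 2) \<le> 3 * (1 + z\<^sup>2) powr (\<kappa> / 2)"
      using \<kappa> by (intro mult_right_mono) auto
    ultimately show ?thesis by (simp add: g2_def power2_eq_square algebra_simps)
  qed
  \<comment> \<open>Maclaurin expansion in the position \<open>t\<close> on the segment from \<open>x\<close> to \<open>x + d\<close>.\<close>
  define dif where "dif = (\<lambda>(m::nat) t. if m = 0 then (1 + (x + t * d)\<^sup>2) powr (1 + \<kappa> / 2)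
     else if m = 1 then d * g1 (x + t * d) else d\<^sup>2 * g2 (x + t * d) :: real)"
  have "\<exists>t. 0 < t \<and> t < 1 \<and> dif 0 1 =
      (\<Sum>m<2. dif m 0 / fact m * 1 ^ m) + dif 2 t / fact 2 * 1 ^ 2"
  proof (rule Maclaurin)
    show "\<forall>m t. m < 2 \<and> 0 \<le> t \<and> t \<le> 1 \<longrightarrow> ((dif m) has_real_derivative dif (Suc m) t) (at t)"
    proof (intro allI impI)
      fix m :: nat and t :: real assume "m < 2 \<and> 0 \<le> t \<and> t \<le> 1"
      then consider "m = 0" | "m = 1" by linarith
      then show "((dif m) has_real_derivative dif (Suc m) t) (at t)"
      proof cases
        case 1
        show ?thesis unfolding 1 dif_def
          by (simp, rule DERIV_cong[OF DERIV_chain2[where f="\<lambda>z. (1 + z\<^sup>2) powr (1 + \<kappa> / 2)", OF D0]])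
             (auto intro!: derivative_eq_intros)
      next
        case 2
        show ?thesis unfolding 2 dif_def
          by (simp, rule DERIV_cong[OF DERIV_cmult[OF DERIV_chain2[where f=g1, OF D1]]])
             (auto intro!: derivative_eq_intros simp: power2_eq_square)
      qed
    qed
  qed auto
  then obtain t where t: "0 < t" "t < 1"
    and eq: "(1 + (x + d)\<^sup>2) powr (1 + \<kappa> / 2) =
      (1 + x\<^sup>2) powr (1 + \<kappa> / 2) + d * g1 x + d\<^sup>2 * g2 (x + t * d) / 2"
    by (auto simp: dif_def numeral_2_eq_2 lessThan_Suc)
  have "(1 + (x + t * d)\<^sup>2) powr (\<kappa> / 2) \<le> (4 * max (1 + x\<^sup>2) (d\<^sup>2)) powr (\<kappa> / 2)"
  proof (rule powr_mono2)
    have "(t * d)\<^sup>2 \<le> d\<^sup>2"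
      using t by (simp add: power_mult_distrib mult_left_le_one_le power_le_one)
    moreover have "(x + t * d)\<^sup>2 \<le> 2 * x\<^sup>2 + 2 * (t * d)\<^sup>2"
      using sum_squares_bound[of x "t * d"] by (simp add: power2_sum)
    ultimately show "1 + (x + t * d)\<^sup>2 \<le> 4 * max (1 + x\<^sup>2) (d\<^sup>2)"
      by (cases "1 + x\<^sup>2 \<le> d\<^sup>2") (auto simp: max_def)
  qed (use \<kappa> in auto)
  also have "\<dots> = 4 powr (\<kappa> / 2) * max (1 + x\<^sup>2) (d\<^sup>2) powr (\<kappa> / 2)"
    by (simp add: powr_mult pos[THEN less_imp_le] le_max_iff_disj)
  also have "\<dots> \<le> 4 * ((1 + x\<^sup>2) powr (\<kappa> / 2) + (d\<^sup>2) powr (\<kappa> / 2))"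
    using \<kappa> powr_mono[of "\<kappa> / 2" 1 4] by (intro mult_mono) (auto simp: max_def)
  also have "(d\<^sup>2) powr (\<kappa> / 2) = \<bar>d\<bar> powr \<kappa>"
    using powr_powr[of "\<bar>d\<bar>" 2 "\<kappa> / 2"] by simp
  finally have "g2 (x + t * d) \<le> 24 * ((1 + x\<^sup>2) powr (\<kappa> / 2) + \<bar>d\<bar> powr \<kappa>)"
    using g2_le[of "x + t * d"] by linarith
  then have "d\<^sup>2 * g2 (x + t * d) \<le> d\<^sup>2 * (24 * ((1 + x\<^sup>2) powr (\<kappa> / 2) + \<bar>d\<bar> powr \<kappa>))"
    by (rule mult_left_mono) simp
  then show ?thesis unfolding eq g1_def by (simp add: algebra_simps)
qed

lemma power2_add_le: "(u + v)\<^sup>2 \<le> 2 * u\<^sup>2 + 2 * v\<^sup>2" for u v :: real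
  using sum_squares_bound[of u v] by (simp add: power2_sum)

definition lin :: "(nat \<Rightarrow> real) \<Rightarrow> nat \<Rightarrow> (nat \<Rightarrow> real) \<Rightarrow> real" where
  "lin c k x = (\<Sum>j<k. c j * x j)"

definition quad :: "(nat \<Rightarrow> nat \<Rightarrow> real) \<Rightarrow> nat \<Rightarrow> (nat \<Rightarrow> real) \<Rightarrow> real" where
  "quad A k x = (\<Sum>i<k. \<Sum>j<k. A i j * x i * x j)"

text \<open>The subtracted term is the mean of the quadratic form in independent centred variables of
variance \<open>s\<close>.\<close>

definition quad_dev :: "real \<Rightarrow> (nat \<Rightarrow> nat \<Rightarrow> real) \<Rightarrow> nat \<Rightarrow> (nat \<Rightarrow> real) \<Rightarrow> real" where
  "quad_dev s A k x = quad A k x - s * (\<Sum>i<k. A i i)"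

text \<open>The numerical values carry no meaning. Both constants are free of the dimension, so that
tails are a fixed multiple of a power of the dimension.\<close>

definition quad_step_const :: "real \<Rightarrow> real \<Rightarrow> real" where
  "quad_step_const B a = 96 * (1 + a)\<^sup>2 * (1 + B) ^ 5"

definition quad_tail_const :: "real \<Rightarrow> real \<Rightarrow> real \<Rightarrow> real \<Rightarrow> real" where
  "quad_tail_const B \<kappa> a \<delta> =
     (1 + quad_step_const B a * (3 + 12 * a * B\<^sup>2 + 8 * B\<^sup>2 * a\<^sup>2)) * \<delta> powr (- (2 + \<kappa>))"

text \<open>The weight \<open>1 + y\<^sup>2\<close> makes the one moment dominate all lower ones as well as constants, so
that a single number \<open>B\<close> controls every expectation below. The order \<open>2 + \<kappa>\<close> in \<open>y\<^sup>2\<close> exceeds the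
fourth moment by what is needed for a summable tail.\<close>

locale moment_bounded =
  fixes \<mu> :: "nat \<Rightarrow> real measure" and s B \<kappa> :: real
  assumes prob: "\<And>i. prob_space (\<mu> i)"
    and sets_\<mu> [measurable_cong, simp]: "\<And>i. sets (\<mu> i) = sets borel"
    and \<kappa>: "0 < \<kappa>" "\<kappa> \<le> 1"
    and integrable_moment: "\<And>i. integrable (\<mu> i) (\<lambda>y. (1 + y\<^sup>2) powr (2 + \<kappa>))"
    and moment_le: "\<And>i. (\<integral>y. (1 + y\<^sup>2) powr (2 + \<kappa>) \<partial>\<mu> i) \<le> B"
    and mean: "\<And>i. (\<integral>y. y \<partial>\<mu> i) = 0"
    and variance: "\<And>i. (\<integral>y. y\<^sup>2 \<partial>\<mu> i) = s"
begin

sublocale product_sigma_finite \<mu>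
  by (rule product_sigma_finite.intro) (rule prob_space_imp_sigma_finite[OF prob])

lemma fourth_power_le: "(1 + y\<^sup>2)\<^sup>2 \<le> (1 + y\<^sup>2 :: real) powr (2 + \<kappa>)"
  using powr_mono[of 2 "2 + \<kappa>" "1 + y\<^sup>2"] \<kappa> powr_realpow[of "1 + y\<^sup>2" 2]
  by (simp add: add_pos_nonneg)

lemma integrable_square: "integrable (\<mu> i) (\<lambda>y. y\<^sup>2)"
  by (rule Bochner_Integration.integrable_bound[OF integrable_moment[of i]])
     (auto intro!: AE_I2 order_trans[OF _ fourth_power_le] simp: power2_sum)

lemma integrable_id: "integrable (\<mu> i) (\<lambda>y. y)"
proof (rule Bochner_Integration.integrable_bound[OF integrable_moment[of i]])
  have "\<bar>y\<bar> \<le> (1 + y\<^sup>2)\<^sup>2" for y :: real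
  proof -
    have "2 * \<bar>y\<bar> \<le> 1 + y\<^sup>2" using sum_squares_bound[of 1 "\<bar>y\<bar>"] by simp
    moreover have "1 + y\<^sup>2 \<le> (1 + y\<^sup>2)\<^sup>2" using self_le_power[of "1 + y\<^sup>2" 2] by simp
    ultimately show ?thesis by linarith
  qed
  then show "AE y in \<mu> i. norm y \<le> norm ((1 + y\<^sup>2) powr (2 + \<kappa>))"
    by (auto intro!: AE_I2 order_trans[OF _ fourth_power_le])
qed auto

lemma s_nonneg: "0 \<le> s" and s_le: "s \<le> B" and B_ge_1: "1 \<le> B"
proof -
  interpret p0: prob_space "\<mu> 0" by (rule prob)
  show "0 \<le> s" unfolding variance[of 0, symmetric] by simp
  have sq: "1 + y\<^sup>2 \<le> (1 + y\<^sup>2) powr (2 + \<kappa>)" for y :: real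
    using self_le_power[of "1 + y\<^sup>2" 2] fourth_power_le[of y] by simp
  have "s \<le> (\<integral>y. (1 + y\<^sup>2) powr (2 + \<kappa>) \<partial>\<mu> 0)"
    unfolding variance[of 0, symmetric]
    by (intro integral_mono integrable_square integrable_moment) (use sq in \<open>smt (verit)\<close>)
  then show "s \<le> B" using moment_le[of 0] by linarith
  have "(\<integral>y. (1::real) \<partial>\<mu> 0) \<le> (\<integral>y. (1 + y\<^sup>2) powr (2 + \<kappa>) \<partial>\<mu> 0)"
    by (intro integral_mono integrable_moment) (auto intro: order_trans[OF _ sq])
  moreover have "(\<integral>y. (1::real) \<partial>\<mu> 0) = 1" by (simp add: p0.prob_space)
  ultimately show "1 \<le> B" using moment_le[of 0] by linarith
qed

text \<open>Every estimate in a single coordinate has this form: the linear term integrates to zero,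
the quadratic one to \<open>s\<close>, and all growth beyond that is charged to the one available moment.\<close>

lemma nn_integral_polynomial_le:
  assumes "\<And>y. f y \<le> c0 + c1 * y + c2 * y\<^sup>2 + c4 * (1 + y\<^sup>2) powr (2 + \<kappa>)"
    and "0 \<le> c4" "\<And>y. 0 \<le> f y" and v: "c0 + c2 * s + c4 * B \<le> v"
  shows "(\<integral>\<^sup>+y. ennreal (f y) \<partial>\<mu> i) \<le> ennreal v"
proof -
  let ?h = "\<lambda>y. c0 + c1 * y + c2 * y\<^sup>2 + c4 * (1 + y\<^sup>2) powr (2 + \<kappa>)"
  interpret p: prob_space "\<mu> i" by (rule prob)
  have "(\<integral>\<^sup>+y. ennreal (f y) \<partial>\<mu> i) \<le> (\<integral>\<^sup>+y. ennreal (?h y) \<partial>\<mu> i)"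
    using assms by (intro nn_integral_mono ennreal_leI) auto
  also have "\<dots> = ennreal (\<integral>y. ?h y \<partial>\<mu> i)"
    using integrable_id[of i] integrable_square[of i] integrable_moment[of i]
    by (intro nn_integral_eq_integral) (auto intro!: AE_I2 order_trans[OF assms(3) assms(1)])
  also have "(\<integral>y. ?h y \<partial>\<mu> i) = c0 + c1 * 0 + c2 * s + c4 * (\<integral>y. (1 + y\<^sup>2) powr (2 + \<kappa>) \<partial>\<mu> i)"
    using integrable_id[of i] integrable_square[of i] integrable_moment[of i]
    by (simp add: mean variance p.prob_space)
  also have "\<dots> \<le> v" using mult_left_mono[OF moment_le[of i] assms(2)] v by simp
  finally show ?thesis by (simp add: ennreal_leI)
qed

text \<open>Integrating the last coordinate first turns a bound that is conditional on the preceding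
coordinates into an induction step on their number.\<close>

lemma nn_integral_lessThan_Suc_le:
  assumes [measurable]: "f \<in> borel_measurable (Pi\<^sub>M {..<Suc k} \<mu>)"
    and "\<And>x. (\<integral>\<^sup>+y. f (x(k := y)) \<partial>\<mu> k) \<le> g x"
  shows "(\<integral>\<^sup>+x. f x \<partial>Pi\<^sub>M {..<Suc k} \<mu>) \<le> (\<integral>\<^sup>+x. g x \<partial>Pi\<^sub>M {..<k} \<mu>)"
  using assms unfolding lessThan_Suc
  by (subst product_nn_integral_insert) (auto intro!: nn_integral_mono)

lemma lin_upd: "lin c k (x(k := y)) = lin c k x"
  unfolding lin_def by (intro sum.cong) auto

lemma lin_Suc: "lin c (Suc k) x = lin c k x + c k * x k"
  by (simp add: lin_def)

lemma lin_measurable [measurable]: "k \<le> n \<Longrightarrow> lin c k \<in> borel_measurable (Pi\<^sub>M {..<n} \<mu>)"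
  unfolding lin_def by measurable

text \<open>Expectations are nonnegative integrals, so that moments can be bounded by induction
without first showing that they are finite.\<close>

abbreviation expect :: "nat \<Rightarrow> ((nat \<Rightarrow> real) \<Rightarrow> real) \<Rightarrow> ennreal" where
  "expect k f \<equiv> \<integral>\<^sup>+x. ennreal (f x) \<partial>Pi\<^sub>M {..<k} \<mu>"

lemma emeasure_space_PiM: "emeasure (Pi\<^sub>M I \<mu>) (space (Pi\<^sub>M I \<mu>)) = 1"
  by (intro prob_space.emeasure_space_1 prob_space_PiM prob)

lemma emeasure_le_of_expect_le:
  assumes [measurable]: "f \<in> borel_measurable (Pi\<^sub>M {..<n} \<mu>)"
    and v: "0 < v" and le: "\<And>x. P x \<Longrightarrow> v \<le> f x" and f: "expect n f \<le> ennreal c"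
  shows "emeasure (Pi\<^sub>M {..<n} \<mu>) {x \<in> space (Pi\<^sub>M {..<n} \<mu>). P x} \<le> ennreal (c / v)"
proof -
  let ?P = "Pi\<^sub>M {..<n} \<mu>"
  have "emeasure ?P {x \<in> space ?P. P x} \<le> emeasure ?P {x \<in> space ?P. 1 \<le> ennreal (1 / v) * ennreal (f x)}"
  proof (rule emeasure_mono)
    show "{x \<in> space ?P. P x} \<subseteq> {x \<in> space ?P. 1 \<le> ennreal (1 / v) * ennreal (f x)}"
    proof safe
      fix x assume "P x"
      then have "1 \<le> 1 / v * f x" using le v by simp
      then show "1 \<le> ennreal (1 / v) * ennreal (f x)" using v by (subst ennreal_mult'[symmetric]) auto
    qed
  qed measurable
  also have "\<dots> \<le> ennreal (1 / v) * (\<integral>\<^sup>+x. ennreal (f x) * indicator (space ?P) x \<partial>?P)"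
    using nn_integral_Markov_inequality[of "\<lambda>x. ennreal (f x)" "space ?P" ?P "ennreal (1 / v)"]
    by (auto simp: Int_def conj_commute cong: conj_cong)
  also have "(\<integral>\<^sup>+x. ennreal (f x) * indicator (space ?P) x \<partial>?P) = expect n f"
    by (intro nn_integral_cong) auto
  also have "ennreal (1 / v) * \<dots> \<le> ennreal (1 / v) * ennreal c" by (intro mult_left_mono f) simp
  also have "\<dots> = ennreal (c / v)" using v by (subst ennreal_mult'[symmetric]) auto
  finally show ?thesis .
qed

lemma lin_second_moment:
  "expect k (\<lambda>x. (lin c k x)\<^sup>2) \<le> ennreal (B * (\<Sum>j<k. (c j)\<^sup>2))"
proof (induction k)
  case 0
  then show ?case by (simp add: lin_def)
next
  case (Suc k)
  have "expect (Suc k) (\<lambda>x. (lin c (Suc k) x)\<^sup>2)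
    \<le> expect k (\<lambda>x. (lin c k x)\<^sup>2 + B * (c k)\<^sup>2)"
  proof (rule nn_integral_lessThan_Suc_le)
    fix x
    show "(\<integral>\<^sup>+y. ennreal ((lin c (Suc k) (x(k := y)))\<^sup>2) \<partial>\<mu> k) \<le> ennreal ((lin c k x)\<^sup>2 + B * (c k)\<^sup>2)"
    proof (rule nn_integral_polynomial_le[of _ "(lin c k x)\<^sup>2" "2 * lin c k x * c k" "(c k)\<^sup>2" 0])
      show "(lin c k x)\<^sup>2 + (c k)\<^sup>2 * s + 0 * B \<le> (lin c k x)\<^sup>2 + B * (c k)\<^sup>2"
        using mult_right_mono[OF s_le, of "(c k)\<^sup>2"] by (simp add: mult.commute)
      show "(lin c (Suc k) (x(k := y)))\<^sup>2 \<le> (lin c k x)\<^sup>2 + 2 * lin c k x * c k * y + (c k)\<^sup>2 * y\<^sup>2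
          + 0 * (1 + y\<^sup>2) powr (2 + \<kappa>)" for y
        by (simp add: lin_Suc lin_upd power2_sum power_mult_distrib)
    qed auto
  qed measurable
  also have "\<dots> = expect k (\<lambda>x. (lin c k x)\<^sup>2) + ennreal (B * (c k)\<^sup>2)"
    using B_ge_1 by (simp add: ennreal_plus nn_integral_add emeasure_space_PiM)
  also have "\<dots> \<le> ennreal (B * (\<Sum>j<k. (c j)\<^sup>2)) + ennreal (B * (c k)\<^sup>2)"
    by (intro add_mono Suc order_refl)
  also have "\<dots> = ennreal (B * (\<Sum>j<Suc k. (c j)\<^sup>2))"
    using B_ge_1 by (simp add: ennreal_plus[symmetric] sum_nonneg algebra_simps del: ennreal_plus)
  finally show ?case .
qed

text \<open>In \<open>(T + c y)^4\<close> the term cubic in \<open>T\<close> vanishes in the mean, and the term cubic in \<open>y\<close>,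
which has no sign, is absorbed into its two neighbours.\<close>

lemma lin_fourth_moment:
  "expect k (\<lambda>x. (lin c k x) ^ 4) \<le> ennreal (4 * B\<^sup>2 * (\<Sum>j<k. (c j)\<^sup>2)\<^sup>2)"
proof (induction k)
  case 0
  then show ?case by (simp add: lin_def)
next
  case (Suc k)
  define T where "T = (\<Sum>j<k. (c j)\<^sup>2)"
  have T: "0 \<le> T" by (simp add: T_def sum_nonneg)
  have B: "0 \<le> B" using B_ge_1 by simp
  have "expect (Suc k) (\<lambda>x. (lin c (Suc k) x) ^ 4)
    \<le> expect k (\<lambda>x. lin c k x ^ 4 + (8 * B * (c k)\<^sup>2) * (lin c k x)\<^sup>2 + 3 * B * (c k) ^ 4)"
  proof (rule nn_integral_lessThan_Suc_le)
    fix x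
    let ?T = "lin c k x" and ?c = "c k"
    show "(\<integral>\<^sup>+y. ennreal ((lin c (Suc k) (x(k := y))) ^ 4) \<partial>\<mu> k)
        \<le> ennreal (?T ^ 4 + (8 * B * ?c\<^sup>2) * ?T\<^sup>2 + 3 * B * ?c ^ 4)"
    proof (rule nn_integral_polynomial_le[of _ "?T ^ 4" "4 * ?T ^ 3 * ?c" "8 * ?T\<^sup>2 * ?c\<^sup>2" "3 * ?c ^ 4"])
      fix y
      \<comment> \<open>Twice this square is what raises the binomial coefficients 6 and 1 to 8 and 3.\<close>
      have "0 \<le> (?T * (?c * y) - (?c * y)\<^sup>2)\<^sup>2" by simp
      then have "(?T + ?c * y) ^ 4 \<le> ?T ^ 4 + 4 * ?T ^ 3 * ?c * y + 8 * ?T\<^sup>2 * ?c\<^sup>2 * y\<^sup>2 + 3 * ?c ^ 4 * y ^ 4"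
        by (simp add: power4_eq_xxxx power3_eq_cube power2_eq_square algebra_simps)
      also have "y ^ 4 \<le> (1 + y\<^sup>2)\<^sup>2" by (simp add: power2_sum)
      then have "y ^ 4 \<le> (1 + y\<^sup>2) powr (2 + \<kappa>)" using fourth_power_le[of y] by linarith
      then have "3 * ?c ^ 4 * y ^ 4 \<le> 3 * ?c ^ 4 * (1 + y\<^sup>2) powr (2 + \<kappa>)"
        by (intro mult_left_mono) auto
      finally show "(lin c (Suc k) (x(k := y))) ^ 4 \<le> ?T ^ 4 + 4 * ?T ^ 3 * ?c * y + 8 * ?T\<^sup>2 * ?c\<^sup>2 * y\<^sup>2
          + 3 * ?c ^ 4 * (1 + y\<^sup>2) powr (2 + \<kappa>)"
        by (simp add: lin_Suc lin_upd)
      show "?T ^ 4 + 8 * ?T\<^sup>2 * ?c\<^sup>2 * s + 3 * ?c ^ 4 * B \<le> ?T ^ 4 + (8 * B * ?c\<^sup>2) * ?T\<^sup>2 + 3 * B * ?c ^ 4"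
        using mult_left_mono[OF s_le, of "8 * ?T\<^sup>2 * ?c\<^sup>2"] by (simp add: algebra_simps)
    qed auto
  qed measurable
  also have "\<dots> = expect k (\<lambda>x. lin c k x ^ 4)
      + ennreal (8 * B * (c k)\<^sup>2) * expect k (\<lambda>x. (lin c k x)\<^sup>2) + ennreal (3 * B * (c k) ^ 4)"
    using B by (simp add: ennreal_plus nn_integral_add emeasure_space_PiM ennreal_mult'
        nn_integral_cmult)
  also have "\<dots> \<le> ennreal (4 * B\<^sup>2 * T\<^sup>2) + ennreal (8 * B * (c k)\<^sup>2) * ennreal (B * T) + ennreal (3 * B * (c k) ^ 4)"
    using Suc lin_second_moment[of k c] unfolding T_def by (intro add_mono mult_left_mono) auto
  also have "\<dots> = ennreal (4 * B\<^sup>2 * T\<^sup>2 + 8 * B\<^sup>2 * (c k)\<^sup>2 * T + 3 * B * (c k) ^ 4)"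
    using B T by (simp add: ennreal_plus[symmetric] ennreal_mult'[symmetric] power2_eq_square mult_ac del: ennreal_plus)
  also have "\<dots> \<le> ennreal (4 * B\<^sup>2 * (\<Sum>j<Suc k. (c j)\<^sup>2)\<^sup>2)"
  proof (rule ennreal_leI)
    have "B * (c k) ^ 4 \<le> B\<^sup>2 * (c k) ^ 4"
      using B_ge_1 by (intro mult_right_mono self_le_power) auto
    moreover have "0 \<le> B\<^sup>2 * (c k) ^ 4" by simp
    ultimately have "3 * B * (c k) ^ 4 \<le> 4 * (B\<^sup>2 * (c k) ^ 4)" by linarith
    moreover have "(\<Sum>j<Suc k. (c j)\<^sup>2) = T + (c k)\<^sup>2" by (simp add: T_def)
    moreover have "4 * B\<^sup>2 * (T + (c k)\<^sup>2)\<^sup>2 = 4 * B\<^sup>2 * T\<^sup>2 + 8 * B\<^sup>2 * (c k)\<^sup>2 * T + 4 * (B\<^sup>2 * (c k) ^ 4)"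
      by (simp add: power2_sum algebra_simps)
    ultimately show "4 * B\<^sup>2 * T\<^sup>2 + 8 * B\<^sup>2 * (c k)\<^sup>2 * T + 3 * B * (c k) ^ 4 \<le> 4 * B\<^sup>2 * (\<Sum>j<Suc k. (c j)\<^sup>2)\<^sup>2"
      by simp
  qed
  finally show ?case .
qed

lemma quad_dev_measurable [measurable]: "k \<le> n \<Longrightarrow> quad_dev t A k \<in> borel_measurable (Pi\<^sub>M {..<n} \<mu>)"
  unfolding quad_dev_def quad_def by measurable

text \<open>For symmetric \<open>A\<close> the new coordinate enters through its own square and through a linear
form in the old ones; with \<open>t\<close> the variance, the increment is centred given the old
coordinates.\<close>

lemma quad_dev_Suc:
  assumes "\<And>j. j < k \<Longrightarrow> A j k = A k j"
  shows "quad_dev t A (Suc k) (x(k := y)) =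
    quad_dev t A k x + (A k k * (y\<^sup>2 - t) + 2 * y * lin (A k) k x)"
proof -
  have "quad A (Suc k) (x(k := y)) = quad A k x + (\<Sum>i<k. A i k * x i * y) + (\<Sum>j<k. A k j * y * x j) + A k k * y\<^sup>2"
    by (simp add: quad_def sum.distrib power2_eq_square mult.assoc)
  also have "(\<Sum>i<k. A i k * x i * y) = y * lin (A k) k x"
    using assms by (simp add: lin_def sum_distrib_left mult_ac)
  also have "(\<Sum>j<k. A k j * y * x j) = y * lin (A k) k x"
    by (simp add: lin_def sum_distrib_left mult_ac)
  finally have "quad A (Suc k) (x(k := y)) =
    quad A k x + y * lin (A k) k x + y * lin (A k) k x + A k k * y\<^sup>2" .
  then show ?thesis unfolding quad_dev_def by (simp only:) (simp add: algebra_simps)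
qed

lemma increment_square_le:
  "(t * (y\<^sup>2 - s) + 2 * y * l)\<^sup>2 \<le> 2 * t\<^sup>2 * (1 + y\<^sup>2) powr (2 + \<kappa>) + 2 * t\<^sup>2 * s\<^sup>2 + 8 * l\<^sup>2 * y\<^sup>2"
proof -
  have "0 \<le> y\<^sup>2 * s" using s_nonneg by simp
  then have "(y\<^sup>2 - s)\<^sup>2 \<le> (1 + y\<^sup>2) powr (2 + \<kappa>) + s\<^sup>2"
  proof -
    assume "0 \<le> y\<^sup>2 * s"
    moreover have "(y\<^sup>2 - s)\<^sup>2 = y ^ 4 - 2 * (y\<^sup>2 * s) + s\<^sup>2" by (simp add: power2_diff)
    moreover have "(1 + y\<^sup>2)\<^sup>2 = 1 + 2 * y\<^sup>2 + y ^ 4" by (simp add: power2_sum)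
    ultimately show ?thesis using fourth_power_le[of y] zero_le_power2[of y] by linarith
  qed
  then have "t\<^sup>2 * (y\<^sup>2 - s)\<^sup>2 \<le> t\<^sup>2 * ((1 + y\<^sup>2) powr (2 + \<kappa>) + s\<^sup>2)"
    by (intro mult_left_mono) auto
  then have "2 * (t * (y\<^sup>2 - s))\<^sup>2 \<le> 2 * t\<^sup>2 * (1 + y\<^sup>2) powr (2 + \<kappa>) + 2 * t\<^sup>2 * s\<^sup>2"
    by (simp add: power_mult_distrib distrib_left mult.assoc)
  moreover have "2 * (2 * y * l)\<^sup>2 = 8 * l\<^sup>2 * y\<^sup>2" by (simp add: power_mult_distrib)
  ultimately show ?thesis using power2_add_le[of "t * (y\<^sup>2 - s)" "2 * y * l"] by linarith
qed

context
  fixes A :: "nat \<Rightarrow> nat \<Rightarrow> real" and n :: nat and a :: real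
  assumes sym: "\<And>i j. i < n \<Longrightarrow> j < n \<Longrightarrow> A i j = A j i"
    and rows: "\<And>i. i < n \<Longrightarrow> (\<Sum>j<n. (A i j)\<^sup>2) \<le> a"
begin

lemma row_prefix_le: "k < n \<Longrightarrow> (\<Sum>j<k. (A k j)\<^sup>2) \<le> a"
  by (rule order_trans[OF sum_mono2 rows]) auto

lemma diagonal_le: "k < n \<Longrightarrow> (A k k)\<^sup>2 \<le> a"
  by (rule order_trans[OF member_le_sum[of k "{..<n}" "\<lambda>j. (A k j)\<^sup>2"] rows]) auto

lemma row_bound_nonneg: "k < n \<Longrightarrow> 0 \<le> a"
  using diagonal_le[of k] zero_le_power2[of "A k k"] by linarith

text \<open>The increments are orthogonal, and each has bounded second moment because the rows of \<open>A\<close>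
are bounded in norm; hence growth linear in \<open>k\<close>.\<close>

lemma quad_dev_second_moment:
  "k \<le> n \<Longrightarrow> expect k (\<lambda>x. (quad_dev s A k x)\<^sup>2) \<le> ennreal (real k * (12 * a * B\<^sup>2))"
proof (induction k)
  case 0
  then show ?case by (simp add: quad_dev_def quad_def)
next
  case (Suc k)
  then have k: "k < n" by simp
  have a: "0 \<le> a" by (rule row_bound_nonneg[OF k])
  have B: "0 \<le> B" using B_ge_1 by simp
  let ?a = "A k k"
  have "expect (Suc k) (\<lambda>x. (quad_dev s A (Suc k) x)\<^sup>2)
    \<le> expect k (\<lambda>x. (quad_dev s A k x)\<^sup>2 + (8 * B) * (lin (A k) k x)\<^sup>2 + 4 * a * B\<^sup>2)"
  proof (rule nn_integral_lessThan_Suc_le)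
    fix x
    let ?F = "quad_dev s A k x" and ?L = "lin (A k) k x"
    show "(\<integral>\<^sup>+y. ennreal ((quad_dev s A (Suc k) (x(k := y)))\<^sup>2) \<partial>\<mu> k)
        \<le> ennreal (?F\<^sup>2 + (8 * B) * ?L\<^sup>2 + 4 * a * B\<^sup>2)"
    proof (rule nn_integral_polynomial_le[of _ "?F\<^sup>2 - 2 * ?F * ?a * s + 2 * ?a\<^sup>2 * s\<^sup>2" "4 * ?F * ?L"
          "2 * ?F * ?a + 8 * ?L\<^sup>2" "2 * ?a\<^sup>2"])
      fix y
      let ?d = "?a * (y\<^sup>2 - s) + 2 * y * ?L"
      have "?d\<^sup>2 \<le> 2 * ?a\<^sup>2 * (1 + y\<^sup>2) powr (2 + \<kappa>) + 2 * ?a\<^sup>2 * s\<^sup>2 + 8 * ?L\<^sup>2 * y\<^sup>2"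
        by (rule increment_square_le)
      moreover have "quad_dev s A (Suc k) (x(k := y)) = ?F + ?d"
        using sym k by (intro quad_dev_Suc) auto
      moreover have "(?F + ?d)\<^sup>2 = ?F\<^sup>2 + 2 * ?F * ?d + ?d\<^sup>2" by (simp add: power2_sum)
      moreover have "2 * ?F * ?d = 2 * ?F * ?a * y\<^sup>2 - 2 * ?F * ?a * s + 4 * ?F * ?L * y"
        by (simp add: algebra_simps)
      ultimately show "(quad_dev s A (Suc k) (x(k := y)))\<^sup>2 \<le> ?F\<^sup>2 - 2 * ?F * ?a * s + 2 * ?a\<^sup>2 * s\<^sup>2 + 4 * ?F * ?L * y
          + (2 * ?F * ?a + 8 * ?L\<^sup>2) * y\<^sup>2 + 2 * ?a\<^sup>2 * (1 + y\<^sup>2) powr (2 + \<kappa>)"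
        by (simp add: distrib_right)
      have "?a\<^sup>2 * s\<^sup>2 \<le> a * B\<^sup>2"
        using diagonal_le[OF k] a s_nonneg s_le by (intro mult_mono power_mono) auto
      moreover have "?a\<^sup>2 * B \<le> a * B\<^sup>2"
        using diagonal_le[OF k] a B_ge_1 by (intro mult_mono self_le_power) auto
      moreover have "?L\<^sup>2 * s \<le> ?L\<^sup>2 * B" by (intro mult_left_mono s_le) auto
      ultimately show "?F\<^sup>2 - 2 * ?F * ?a * s + 2 * ?a\<^sup>2 * s\<^sup>2 + (2 * ?F * ?a + 8 * ?L\<^sup>2) * s + 2 * ?a\<^sup>2 * B
          \<le> ?F\<^sup>2 + (8 * B) * ?L\<^sup>2 + 4 * a * B\<^sup>2"
        by (simp add: algebra_simps)
    qed auto
  qed measurable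
  also have "\<dots> = expect k (\<lambda>x. (quad_dev s A k x)\<^sup>2)
      + ennreal (8 * B) * expect k (\<lambda>x. (lin (A k) k x)\<^sup>2) + ennreal (4 * a * B\<^sup>2)"
    using B a by (simp add: ennreal_plus nn_integral_add emeasure_space_PiM ennreal_mult'
        nn_integral_cmult)
  also have "\<dots> \<le> ennreal (real k * (12 * a * B\<^sup>2)) + ennreal (8 * B) * ennreal (B * a) + ennreal (4 * a * B\<^sup>2)"
    using Suc k a B row_prefix_le[OF k]
    by (intro add_mono mult_left_mono order_trans[OF lin_second_moment[of k "A k"]] ennreal_leI) auto
  also have "\<dots> = ennreal (real (Suc k) * (12 * a * B\<^sup>2))"
    using B a by (simp add: ennreal_plus[symmetric] ennreal_mult'[symmetric] power2_eq_square algebra_simps del: ennreal_plus)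
  finally show ?case .
qed

text \<open>The linear Taylor term drops out, but the quadratic one carries the weight
\<open>w = (1 + F\<^sup>2) powr (\<kappa> / 2)\<close> with \<open>F\<close> the current value. Since \<open>F\<^sup>2\<close> is of order \<open>N\<close> in the mean,
\<open>w\<close> is compared with \<open>N powr (\<kappa> / 2)\<close>; the price is an additional \<open>F\<^sup>2 / N\<close>, whose expectation is
bounded by the second-moment estimate.\<close>

lemma quad_dev_conditional_step:
  assumes k: "k < n" and N: "1 \<le> N"
  shows "(\<integral>\<^sup>+y. ennreal ((1 + (quad_dev s A (Suc k) (x(k := y)))\<^sup>2) powr (1 + \<kappa> / 2)) \<partial>\<mu> k)
    \<le> ennreal ((1 + (quad_dev s A k x)\<^sup>2) powr (1 + \<kappa> / 2)
        + quad_step_const B a * N powr (\<kappa> / 2) * (3 + (quad_dev s A k x)\<^sup>2 / N + 2 * (lin (A k) k x) ^ 4))"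
proof -
  define F where "F = quad_dev s A k x"
  define L where "L = lin (A k) k x"
  define w where "w = (1 + F\<^sup>2) powr (\<kappa> / 2)"
  define P where "P = (2 + \<kappa>) * F * w"
  let ?a = "A k k"
  define R where "R = \<bar>?a\<bar> * (1 + s) + \<bar>L\<bar>"
  have a: "0 \<le> a" by (rule row_bound_nonneg[OF k])
  have w0: "0 \<le> w" and R0: "0 \<le> R" using s_nonneg by (simp_all add: w_def R_def)
  \<comment> \<open>The four coefficients collect the powers of \<open>y\<close> in the Taylor bound for the increment.\<close>
  have step: "(\<integral>\<^sup>+y. ennreal ((1 + (quad_dev s A (Suc k) (x(k := y)))\<^sup>2) powr (1 + \<kappa> / 2)) \<partial>\<mu> k)
    \<le> ennreal ((1 + F\<^sup>2) powr (1 + \<kappa> / 2) + quad_step_const B a * (w * (1 + L\<^sup>2) + (1 + L ^ 4)))"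
  proof (rule nn_integral_polynomial_le[of _ "(1 + F\<^sup>2) powr (1 + \<kappa> / 2) - P * ?a * s + 24 * w * ?a\<^sup>2 * s\<^sup>2"
        "2 * P * L" "P * ?a + 96 * w * L\<^sup>2" "24 * w * ?a\<^sup>2 + 12 * (1 + R ^ 4)"])
    fix y
    let ?d = "?a * (y\<^sup>2 - s) + 2 * y * L" and ?E = "(1 + y\<^sup>2) powr (2 + \<kappa>)"
    have "?d\<^sup>2 \<le> 2 * ?a\<^sup>2 * ?E + 2 * ?a\<^sup>2 * s\<^sup>2 + 8 * L\<^sup>2 * y\<^sup>2"
      by (rule increment_square_le)
    then have d2: "w * ?d\<^sup>2 \<le> w * (2 * ?a\<^sup>2 * ?E + 2 * ?a\<^sup>2 * s\<^sup>2 + 8 * L\<^sup>2 * y\<^sup>2)"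
      using w0 by (rule mult_left_mono)
    have "\<bar>?d\<bar> \<le> \<bar>?a\<bar> * \<bar>y\<^sup>2 - s\<bar> + (2 * \<bar>y\<bar>) * \<bar>L\<bar>"
      by (rule order_trans[OF abs_triangle_ineq]) (simp add: abs_mult)
    also have "\<dots> \<le> \<bar>?a\<bar> * ((1 + s) * (1 + y\<^sup>2)) + (1 + y\<^sup>2) * \<bar>L\<bar>"
    proof (intro add_mono mult_left_mono mult_right_mono)
      show "\<bar>y\<^sup>2 - s\<bar> \<le> (1 + s) * (1 + y\<^sup>2)"
        using s_nonneg mult_nonneg_nonneg[OF s_nonneg zero_le_power2[of y]]
        by (simp add: algebra_simps abs_if)
      show "2 * \<bar>y\<bar> \<le> 1 + y\<^sup>2" using sum_squares_bound[of 1 "\<bar>y\<bar>"] by simp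
    qed auto
    also have "\<dots> = R * (1 + y\<^sup>2)" by (simp add: R_def algebra_simps)
    finally have "\<bar>?d\<bar> powr (2 + \<kappa>) \<le> (R * (1 + y\<^sup>2)) powr (2 + \<kappa>)"
      using \<kappa> by (intro powr_mono2) auto
    also have "\<dots> = R powr (2 + \<kappa>) * ?E" using R0 by (simp add: powr_mult)
    also have "\<dots> \<le> (1 + R ^ 4) * ?E"
    proof (intro mult_right_mono)
      show "R powr (2 + \<kappa>) \<le> 1 + R ^ 4"
      proof (cases "R \<le> 1")
        case True
        have "R powr (2 + \<kappa>) \<le> 1 powr (2 + \<kappa>)" using True R0 \<kappa> by (intro powr_mono2) auto
        then show ?thesis using R0 by (simp add: add_increasing2)
      next
        case False
        then have "R powr (2 + \<kappa>) \<le> R powr 4" using \<kappa> by (intro powr_mono) auto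
        then show ?thesis using False by (simp add: powr_realpow[of R 4, simplified])
      qed
    qed auto
    finally have dk: "\<bar>?d\<bar> powr (2 + \<kappa>) \<le> (1 + R ^ 4) * ?E" .
    have "?d\<^sup>2 * \<bar>?d\<bar> powr \<kappa> = \<bar>?d\<bar> powr (2 + \<kappa>)"
      by (cases "?d = 0") (simp_all only: powr_add, simp_all)
    then have dk': "?d\<^sup>2 * \<bar>?d\<bar> powr \<kappa> \<le> (1 + R ^ 4) * ?E" using dk by simp
    have "(1 + (quad_dev s A (Suc k) (x(k := y)))\<^sup>2) powr (1 + \<kappa> / 2) = (1 + (F + ?d)\<^sup>2) powr (1 + \<kappa> / 2)"
      using sym k by (subst quad_dev_Suc) (auto simp: F_def L_def)
    also have "\<dots> \<le> (1 + F\<^sup>2) powr (1 + \<kappa> / 2) + P * ?d + 12 * (w * ?d\<^sup>2) + 12 * (?d\<^sup>2 * \<bar>?d\<bar> powr \<kappa>)"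
      using powr_one_plus_square_Taylor[OF \<kappa>, of F ?d]
      unfolding w_def[symmetric] P_def by (simp add: algebra_simps)
    also have "\<dots> \<le> (1 + F\<^sup>2) powr (1 + \<kappa> / 2) + P * ?d + 12 * (w * (2 * ?a\<^sup>2 * ?E + 2 * ?a\<^sup>2 * s\<^sup>2 + 8 * L\<^sup>2 * y\<^sup>2))
        + 12 * ((1 + R ^ 4) * ?E)"
      using d2 dk' by linarith
    also have "\<dots> = (1 + F\<^sup>2) powr (1 + \<kappa> / 2) - P * ?a * s + 24 * w * ?a\<^sup>2 * s\<^sup>2 + 2 * P * L * y
        + (P * ?a + 96 * w * L\<^sup>2) * y\<^sup>2 + (24 * w * ?a\<^sup>2 + 12 * (1 + R ^ 4)) * ?E"
      by (simp add: algebra_simps)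
    finally show "(1 + (quad_dev s A (Suc k) (x(k := y)))\<^sup>2) powr (1 + \<kappa> / 2) \<le> \<dots>" .
  next
    define K where "K = quad_step_const B a"
    have B5: "B * (1 + B) ^ 4 \<le> (1 + B) ^ 5" and B2: "B\<^sup>2 \<le> (1 + B) ^ 5" and B1: "B \<le> (1 + B) ^ 5"
    proof -
      show "B * (1 + B) ^ 4 \<le> (1 + B) ^ 5" using B_ge_1 by (simp add: eval_nat_numeral)
      show "B\<^sup>2 \<le> (1 + B) ^ 5" using B_ge_1 power_mono[of B "1 + B" 2] power_increasing[of 2 5 "1 + B"] by linarith
      show "B \<le> (1 + B) ^ 5" using B_ge_1 self_le_power[of "1 + B" 5] by linarith
    qed
    have a1: "a \<le> (1 + a)\<^sup>2" "1 \<le> (1 + a)\<^sup>2" "1 + a\<^sup>2 \<le> (1 + a)\<^sup>2" using a by (simp_all add: power2_sum)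
    have K1: "96 * a * B\<^sup>2 \<le> K"
      unfolding K_def quad_step_const_def using a a1 B2 by (intro mult_mono) auto
    have K2: "96 * B \<le> K"
      using mult_mono[OF a1(2) B1] B_ge_1 unfolding K_def quad_step_const_def by simp
    have K3: "96 * (1 + a\<^sup>2) * (B * (1 + B) ^ 4) \<le> K"
      unfolding K_def quad_step_const_def using a1 B5 B_ge_1 by (intro mult_mono) auto
    have "w * (?a\<^sup>2 * s\<^sup>2) \<le> w * (a * B\<^sup>2)"
      using diagonal_le[OF k] a s_nonneg s_le w0 by (intro mult_left_mono mult_mono power_mono) auto
    moreover have "w * (?a\<^sup>2 * B) \<le> w * (a * B\<^sup>2)"
      using diagonal_le[OF k] a B_ge_1 w0 by (intro mult_left_mono mult_mono self_le_power) auto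
    moreover have "w * (48 * (a * B\<^sup>2)) \<le> w * K" using K1 w0 a
      by (intro mult_left_mono) (use zero_le_power2[of B] mult_nonneg_nonneg[OF a zero_le_power2[of B]] in linarith)+
    ultimately have 1: "24 * w * ?a\<^sup>2 * s\<^sup>2 + 24 * w * ?a\<^sup>2 * B \<le> K * w" by (simp add: algebra_simps)
    have "w * L\<^sup>2 * (96 * s) \<le> w * L\<^sup>2 * K" using K2 s_le w0 by (intro mult_left_mono) auto
    then have 2: "96 * w * L\<^sup>2 * s \<le> K * (w * L\<^sup>2)" by (simp add: algebra_simps)
    have R4: "R ^ 4 \<le> 8 * (a\<^sup>2 * (1 + B) ^ 4 + L ^ 4)"
    proof -
      have p2: "(u + v)\<^sup>2 \<le> 2 * (u\<^sup>2 + v\<^sup>2)" for u v :: real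
        using power2_add_le[of u v] by simp
      have "R ^ 4 = (R\<^sup>2)\<^sup>2" by simp
      also have "\<dots> \<le> (2 * ((\<bar>?a\<bar> * (1 + s))\<^sup>2 + \<bar>L\<bar>\<^sup>2))\<^sup>2"
        unfolding R_def by (intro power_mono p2) auto
      also have "\<dots> \<le> 8 * (((\<bar>?a\<bar> * (1 + s))\<^sup>2)\<^sup>2 + (\<bar>L\<bar>\<^sup>2)\<^sup>2)"
        using p2[of "(\<bar>?a\<bar> * (1 + s))\<^sup>2" "\<bar>L\<bar>\<^sup>2"] by (simp only: power_mult_distrib[of 2]) simp
      also have "\<dots> = 8 * ((?a\<^sup>2)\<^sup>2 * (1 + s) ^ 4 + L ^ 4)" by (simp add: power_mult_distrib)
      also have "(?a\<^sup>2)\<^sup>2 * (1 + s) ^ 4 \<le> a\<^sup>2 * (1 + B) ^ 4"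
        using diagonal_le[OF k] s_nonneg s_le by (intro mult_mono power_mono) auto
      finally show ?thesis by simp
    qed
    have "12 * (1 + R ^ 4) * B \<le> 12 * (1 + 8 * (a\<^sup>2 * (1 + B) ^ 4 + L ^ 4)) * B"
      using R4 B_ge_1 by (intro mult_right_mono) auto
    also have "\<dots> = 12 * B + 96 * a\<^sup>2 * (B * (1 + B) ^ 4) + 96 * B * L ^ 4"
      by (simp add: algebra_simps)
    also have "12 * B + 96 * a\<^sup>2 * (B * (1 + B) ^ 4) \<le> 96 * (1 + a\<^sup>2) * (B * (1 + B) ^ 4)"
    proof -
      have "B * 1 \<le> B * (1 + B) ^ 4" using B_ge_1 by (intro mult_left_mono one_le_power) auto
      moreover have "12 * B + 96 * a\<^sup>2 * z \<le> 96 * (1 + a\<^sup>2) * z" if "B * 1 \<le> z" for z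
        using that B_ge_1 by (simp add: algebra_simps)
      ultimately show ?thesis by blast
    qed
    also have "\<dots> \<le> K" by (rule K3)
    also have "96 * B * L ^ 4 \<le> K * L ^ 4" using K2 by (intro mult_right_mono) auto
    finally have 3: "12 * (1 + R ^ 4) * B \<le> K + K * L ^ 4" by simp
    show "(1 + F\<^sup>2) powr (1 + \<kappa> / 2) - P * ?a * s + 24 * w * ?a\<^sup>2 * s\<^sup>2 + (P * ?a + 96 * w * L\<^sup>2) * s
        + (24 * w * ?a\<^sup>2 + 12 * (1 + R ^ 4)) * B
      \<le> (1 + F\<^sup>2) powr (1 + \<kappa> / 2) + quad_step_const B a * (w * (1 + L\<^sup>2) + (1 + L ^ 4))"
      using 1 2 3 unfolding K_def[symmetric] by (simp add: algebra_simps)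
  qed (use w0 in auto)
  have K0: "0 \<le> quad_step_const B a" using B_ge_1 by (simp add: quad_step_const_def)
  \<comment> \<open>Rescaled by \<open>N\<close>, the fractional power is bounded by the first: \<open>u powr \<kappa> \<le> 1 + u\<close>.\<close>
  define u where "u = (1 + F\<^sup>2) / N"
  have u0: "0 \<le> u" using N by (simp add: u_def add_nonneg_nonneg)
  have N1: "1 \<le> N powr (\<kappa> / 2)" using N \<kappa> by (intro ge_one_powr_ge_zero) auto
  have "w = (N * u) powr (\<kappa> / 2)" using N by (simp add: w_def u_def)
  also have "\<dots> = N powr (\<kappa> / 2) * u powr (\<kappa> / 2)" using N u0 by (simp add: powr_mult)
  finally have w_eq: "w = N powr (\<kappa> / 2) * u powr (\<kappa> / 2)" .
  have "u powr (\<kappa> / 2) * (1 + L\<^sup>2) \<le> ((u powr (\<kappa> / 2))\<^sup>2 + (1 + L\<^sup>2)\<^sup>2) / 2"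
    using sum_squares_bound[of "u powr (\<kappa> / 2)" "1 + L\<^sup>2"] by simp
  also have "(u powr (\<kappa> / 2))\<^sup>2 = u powr \<kappa>"
    by (simp add: power2_eq_square powr_add[symmetric])
  also have "u powr \<kappa> \<le> 1 + u"
  proof (cases "u \<le> 1")
    case True
    have "u powr \<kappa> \<le> 1 powr \<kappa>" using True u0 \<kappa> by (intro powr_mono2) auto
    then show ?thesis using u0 by simp
  next
    case False
    then have "u powr \<kappa> \<le> u powr 1" using \<kappa> by (intro powr_mono) auto
    then show ?thesis using False by simp
  qed
  also have "(1 + L\<^sup>2)\<^sup>2 \<le> 2 + 2 * L ^ 4"
    using sum_squares_bound[of 1 "L\<^sup>2"] by (simp add: power2_sum)
  finally have "u powr (\<kappa> / 2) * (1 + L\<^sup>2) \<le> (3 + u) / 2 + L ^ 4" by (simp add: field_simps)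
  also have "u \<le> 1 + F\<^sup>2 / N" using N by (simp add: u_def add_divide_distrib)
  finally have "u powr (\<kappa> / 2) * (1 + L\<^sup>2) \<le> (3 + (1 + F\<^sup>2 / N)) / 2 + L ^ 4" by simp
  moreover have "0 \<le> F\<^sup>2 / N" using N by simp
  moreover have "z \<le> 2 + t + l" if "z \<le> (3 + (1 + t)) / 2 + l" "0 \<le> t" for z t l :: real
    using that by argo
  ultimately have "u powr (\<kappa> / 2) * (1 + L\<^sup>2) \<le> 2 + F\<^sup>2 / N + L ^ 4" by blast
  then have "N powr (\<kappa> / 2) * (u powr (\<kappa> / 2) * (1 + L\<^sup>2)) \<le> N powr (\<kappa> / 2) * (2 + F\<^sup>2 / N + L ^ 4)"
    by (rule mult_left_mono) simp
  moreover have "1 * (1 + L ^ 4) \<le> N powr (\<kappa> / 2) * (1 + L ^ 4)"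
    using N1 by (intro mult_right_mono) (auto simp: add_nonneg_nonneg)
  ultimately have "w * (1 + L\<^sup>2) + (1 + L ^ 4) \<le> N powr (\<kappa> / 2) * (3 + F\<^sup>2 / N + 2 * L ^ 4)"
    unfolding w_eq by (simp add: algebra_simps)
  then have "quad_step_const B a * (w * (1 + L\<^sup>2) + (1 + L ^ 4))
    \<le> quad_step_const B a * N powr (\<kappa> / 2) * (3 + F\<^sup>2 / N + 2 * L ^ 4)"
    using K0 by (simp add: mult.assoc mult_left_mono)
  then show ?thesis
    by (intro order_trans[OF step[unfolded F_def L_def]] ennreal_leI) (auto simp: F_def L_def)
qed

text \<open>Each of the \<open>n\<close> steps costs a multiple of \<open>n powr (\<kappa> / 2)\<close>, so the moment of order \<open>2 + \<kappa>\<close>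
is \<open>O(n powr (1 + \<kappa> / 2))\<close>, as for a variable of standard deviation \<open>sqrt n\<close>.\<close>

lemma quad_dev_moment:
  assumes N: "1 \<le> n"
  shows "k \<le> n \<Longrightarrow> expect k (\<lambda>x. (1 + (quad_dev s A k x)\<^sup>2) powr (1 + \<kappa> / 2))
    \<le> ennreal (1 + real k * (quad_step_const B a * real n powr (\<kappa> / 2) * (3 + 12 * a * B\<^sup>2 + 8 * B\<^sup>2 * a\<^sup>2)))"
proof (induction k)
  case 0
  then show ?case using emeasure_space_PiM[of "{}"] by (simp add: quad_dev_def quad_def)
next
  case (Suc k)
  then have k: "k < n" by simp
  have a: "0 \<le> a" by (rule row_bound_nonneg[OF k])
  have B: "0 \<le> B" using B_ge_1 by simp
  define K where "K = quad_step_const B a * real n powr (\<kappa> / 2)"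
  have K0: "0 \<le> K" using B_ge_1 by (simp add: K_def quad_step_const_def)
  have "expect (Suc k) (\<lambda>x. (1 + (quad_dev s A (Suc k) x)\<^sup>2) powr (1 + \<kappa> / 2))
    \<le> expect k (\<lambda>x. (1 + (quad_dev s A k x)\<^sup>2) powr (1 + \<kappa> / 2)
        + K * (3 + (quad_dev s A k x)\<^sup>2 / real n + 2 * (lin (A k) k x) ^ 4))"
    unfolding K_def using N k
    by (intro nn_integral_lessThan_Suc_le quad_dev_conditional_step) auto
  also have "\<dots> = expect k (\<lambda>x. (1 + (quad_dev s A k x)\<^sup>2) powr (1 + \<kappa> / 2))
      + ennreal K * (ennreal 3 + ennreal (1 / real n) * expect k (\<lambda>x. (quad_dev s A k x)\<^sup>2)
        + ennreal 2 * expect k (\<lambda>x. (lin (A k) k x) ^ 4))"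
  proof -
    let ?f = "\<lambda>x. (1 + (quad_dev s A k x)\<^sup>2) powr (1 + \<kappa> / 2)"
    have "ennreal (f + K * (3 + g / real n + 2 * h))
        = ennreal f + ennreal K * (ennreal 3 + ennreal (1 / real n) * ennreal g + ennreal 2 * ennreal h)"
      if "0 \<le> f" "0 \<le> g" "0 \<le> h" for f g h
      using that K0 by (simp add: ennreal_plus[symmetric] ennreal_mult'[symmetric] del: ennreal_plus ennreal_numeral)
    then have "expect k (\<lambda>x. ?f x + K * (3 + (quad_dev s A k x)\<^sup>2 / real n + 2 * (lin (A k) k x) ^ 4))
      = (\<integral>\<^sup>+x. ennreal (?f x) + ennreal K * (ennreal 3 + ennreal (1 / real n) * ennreal ((quad_dev s A k x)\<^sup>2)
          + ennreal 2 * ennreal ((lin (A k) k x) ^ 4)) \<partial>Pi\<^sub>M {..<k} \<mu>)"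
      by (intro nn_integral_cong) auto
    also have "\<dots> = expect k (\<lambda>x. ?f x)
      + ennreal K * (ennreal 3 + ennreal (1 / real n) * expect k (\<lambda>x. (quad_dev s A k x)\<^sup>2)
        + ennreal 2 * expect k (\<lambda>x. (lin (A k) k x) ^ 4))"
      by (subst nn_integral_add nn_integral_cmult, measurable)+ (simp add: emeasure_space_PiM)
    finally show ?thesis .
  qed
  also have "\<dots> \<le> ennreal (1 + real k * (K * (3 + 12 * a * B\<^sup>2 + 8 * B\<^sup>2 * a\<^sup>2)))
      + ennreal K * (ennreal 3 + ennreal (1 / real n) * ennreal (real n * (12 * a * B\<^sup>2)) + ennreal 2 * ennreal (4 * B\<^sup>2 * a\<^sup>2))"
  proof (intro add_mono mult_left_mono order_refl)
    show "expect k (\<lambda>x. (quad_dev s A k x)\<^sup>2) \<le> ennreal (real n * (12 * a * B\<^sup>2))"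
      using k a by (intro order_trans[OF quad_dev_second_moment] ennreal_leI mult_right_mono) auto
    show "expect k (\<lambda>x. (lin (A k) k x) ^ 4) \<le> ennreal (4 * B\<^sup>2 * a\<^sup>2)"
      using row_prefix_le[OF k]
      by (intro order_trans[OF lin_fourth_moment] ennreal_leI mult_left_mono power_mono sum_nonneg) auto
  qed (use Suc in \<open>auto simp: K_def\<close>)
  also have "\<dots> = ennreal (1 + real (Suc k) * (K * (3 + 12 * a * B\<^sup>2 + 8 * B\<^sup>2 * a\<^sup>2)))"
    using N a B K0
    by (simp add: ennreal_plus[symmetric] ennreal_mult'[symmetric] algebra_simps del: ennreal_plus ennreal_numeral)
  finally show ?case by (simp add: K_def)
qed

text \<open>Markov's inequality for the moment of order \<open>2 + \<kappa>\<close> divides \<open>n powr (1 + \<kappa> / 2)\<close> by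
\<open>n powr (2 + \<kappa>)\<close>. Chebyshev's inequality would only give \<open>1 / n\<close>, which is not summable.\<close>

lemma quad_dev_tail:
  assumes n: "1 \<le> n" and \<delta>: "0 < \<delta>"
  shows "emeasure (Pi\<^sub>M {..<n} \<mu>) {x \<in> space (Pi\<^sub>M {..<n} \<mu>). \<delta> * real n \<le> \<bar>quad_dev s A n x\<bar>}
    \<le> ennreal (quad_tail_const B \<kappa> a \<delta> * real n powr (- (1 + \<kappa> / 2)))"
proof -
  define K where "K = quad_step_const B a * (3 + 12 * a * B\<^sup>2 + 8 * B\<^sup>2 * a\<^sup>2)"
  define v where "v = (\<delta> * real n) powr (2 + \<kappa>)"
  have dn: "0 < \<delta> * real n" using n \<delta> by simp
  have v: "0 < v" unfolding v_def using n \<delta> by simp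
  have "emeasure (Pi\<^sub>M {..<n} \<mu>) {x \<in> space (Pi\<^sub>M {..<n} \<mu>). \<delta> * real n \<le> \<bar>quad_dev s A n x\<bar>}
    \<le> ennreal ((1 + real n * (K * real n powr (\<kappa> / 2))) / v)"
  proof (rule emeasure_le_of_expect_le[OF _ v])
    show "expect n (\<lambda>x. (1 + (quad_dev s A n x)\<^sup>2) powr (1 + \<kappa> / 2)) \<le> ennreal (1 + real n * (K * real n powr (\<kappa> / 2)))"
      using quad_dev_moment[OF n, of n] by (simp add: K_def mult_ac)
    fix x assume le: "\<delta> * real n \<le> \<bar>quad_dev s A n x\<bar>"
    let ?F = "quad_dev s A n x"
    have "v = ((\<delta> * real n)\<^sup>2) powr (1 + \<kappa> / 2)"
      using n \<delta> powr_powr[of "\<delta> * real n" 2 "1 + \<kappa> / 2"] by (simp add: v_def)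
    also have "\<dots> \<le> (1 + ?F\<^sup>2) powr (1 + \<kappa> / 2)"
      using \<kappa> n \<delta> le power_mono[of "\<delta> * real n" "\<bar>?F\<bar>" 2] by (intro powr_mono2) auto
    finally show "v \<le> (1 + ?F\<^sup>2) powr (1 + \<kappa> / 2)" .
  qed simp_all
  also have "\<dots> \<le> ennreal ((1 + K) * real n powr (1 + \<kappa> / 2) / v)"
  proof (intro ennreal_leI divide_right_mono)
    have "1 \<le> real n powr (1 + \<kappa> / 2)" using n \<kappa> by (intro ge_one_powr_ge_zero) auto
    moreover have "real n powr (1 + \<kappa> / 2) = real n * real n powr (\<kappa> / 2)" using n by (simp add: powr_add)
    ultimately show "1 + real n * (K * real n powr (\<kappa> / 2)) \<le> (1 + K) * real n powr (1 + \<kappa> / 2)"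
      by (simp add: algebra_simps)
  qed (use v in simp)
  also have "(1 + K) * real n powr (1 + \<kappa> / 2) / v = quad_tail_const B \<kappa> a \<delta> * real n powr (- (1 + \<kappa> / 2))"
  proof -
    have "1 / v = \<delta> powr (- (2 + \<kappa>)) * real n powr (- (2 + \<kappa>))"
      unfolding v_def powr_mult powr_minus by (simp add: inverse_eq_divide)
    moreover have "real n powr (- (2 + \<kappa>)) * real n powr (1 + \<kappa> / 2) = real n powr (- (1 + \<kappa> / 2))"
      by (simp add: powr_add[symmetric])
    ultimately have "(1 + K) * real n powr (1 + \<kappa> / 2) * (1 / v)
      = (1 + K) * \<delta> powr (- (2 + \<kappa>)) * real n powr (- (1 + \<kappa> / 2))"
      by (simp only: mult_ac)
    then show ?thesis by (simp add: quad_tail_const_def K_def)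
  qed
  finally show ?thesis .
qed

end

lemma lin_tail:
  assumes n: "1 \<le> n" and \<delta>: "0 < \<delta>" and c: "(\<Sum>j<n. (c j)\<^sup>2) \<le> a * real n"
  shows "emeasure (Pi\<^sub>M {..<n} \<mu>) {x \<in> space (Pi\<^sub>M {..<n} \<mu>). \<delta> * real n \<le> \<bar>lin c n x\<bar>}
    \<le> ennreal (4 * B\<^sup>2 * a\<^sup>2 / \<delta> ^ 4 * real n powr - 2)"
proof -
  have dn: "0 < \<delta> * real n" using n \<delta> by simp
  have "emeasure (Pi\<^sub>M {..<n} \<mu>) {x \<in> space (Pi\<^sub>M {..<n} \<mu>). \<delta> * real n \<le> \<bar>lin c n x\<bar>}
    \<le> ennreal (4 * B\<^sup>2 * (a * real n)\<^sup>2 / (\<delta> * real n) ^ 4)"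
  proof (rule emeasure_le_of_expect_le)
    show "expect n (\<lambda>x. (lin c n x) ^ 4) \<le> ennreal (4 * B\<^sup>2 * (a * real n)\<^sup>2)"
      using c by (intro order_trans[OF lin_fourth_moment] ennreal_leI mult_left_mono power_mono sum_nonneg) auto
    show "(\<delta> * real n) ^ 4 \<le> (lin c n x) ^ 4" if "\<delta> * real n \<le> \<bar>lin c n x\<bar>" for x
      using power_mono[OF that, of 4] dn by simp
  qed (use n \<delta> in simp_all)
  also have "4 * B\<^sup>2 * (a * real n)\<^sup>2 / (\<delta> * real n) ^ 4 = 4 * B\<^sup>2 * a\<^sup>2 / \<delta> ^ 4 * real n powr - 2"
    using n \<delta> powr_realpow[of "real n" 2]
    by (simp add: powr_minus field_simps power_mult_distrib eval_nat_numeral)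
  finally show ?thesis .
qed

end

section \<open>Measurability of matrix operations\<close>

lemma space_mat_borel [simp]: "space (mat_borel n p) = carrier_mat n p"
  by (simp add: mat_borel_def)

lemma space_vec_borel [simp]: "space (vec_borel n) = carrier_vec n"
  by (simp add: vec_borel_def)

lemma measurable_mat_borelI:
  assumes "\<And>w. w \<in> space N \<Longrightarrow> f w \<in> carrier_mat n p"
    and "\<And>i j. i < n \<Longrightarrow> j < p \<Longrightarrow> (\<lambda>w. f w $$ (i, j)) \<in> borel_measurable N"
  shows "f \<in> N \<rightarrow>\<^sub>M mat_borel n p"
  unfolding mat_borel_def
proof (rule measurable_vimage_algebra2)
  show "f \<in> space N \<rightarrow> carrier_mat n p" using assms(1) by auto
  show "(\<lambda>w. \<lambda>ij\<in>{..<n} \<times> {..<p}. f w $$ ij) \<in> N \<rightarrow>\<^sub>M (\<Pi>\<^sub>M ij\<in>{..<n} \<times> {..<p}. borel)"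
    using assms(2) by (intro measurable_restrict) auto
qed

lemma measurable_vec_borelI:
  assumes "\<And>w. w \<in> space N \<Longrightarrow> f w \<in> carrier_vec n"
    and "\<And>i. i < n \<Longrightarrow> (\<lambda>w. f w $ i) \<in> borel_measurable N"
  shows "f \<in> N \<rightarrow>\<^sub>M vec_borel n"
  unfolding vec_borel_def
proof (rule measurable_vimage_algebra2)
  show "f \<in> space N \<rightarrow> carrier_vec n" using assms(1) by auto
  show "(\<lambda>w. \<lambda>i\<in>{..<n}. f w $ i) \<in> N \<rightarrow>\<^sub>M (\<Pi>\<^sub>M i\<in>{..<n}. borel)"
    using assms(2) by (intro measurable_restrict) auto
qed

lemma measurable_mat_entry:
  assumes "f \<in> N \<rightarrow>\<^sub>M mat_borel n p" "i < n" "j < p"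
  shows "(\<lambda>w. f w $$ (i, j)) \<in> borel_measurable N"
proof (rule measurable_compose[OF assms(1)])
  have "(\<lambda>A. \<lambda>ij\<in>{..<n} \<times> {..<p}. A $$ ij) \<in> mat_borel n p \<rightarrow>\<^sub>M (\<Pi>\<^sub>M ij\<in>{..<n} \<times> {..<p}. borel)"
    unfolding mat_borel_def by (rule measurable_vimage_algebra1) (auto simp: space_PiM)
  from measurable_compose[OF this measurable_component_singleton[of "(i, j)"]]
  show "(\<lambda>A. A $$ (i, j)) \<in> borel_measurable (mat_borel n p)" using assms by simp
qed

lemma measurable_vec_entry:
  assumes "f \<in> N \<rightarrow>\<^sub>M vec_borel n" "i < n"
  shows "(\<lambda>w. f w $ i) \<in> borel_measurable N"
proof (rule measurable_compose[OF assms(1)])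
  have "(\<lambda>v. \<lambda>i\<in>{..<n}. v $ i) \<in> vec_borel n \<rightarrow>\<^sub>M (\<Pi>\<^sub>M i\<in>{..<n}. borel)"
    unfolding vec_borel_def by (rule measurable_vimage_algebra1) (auto simp: space_PiM)
  from measurable_compose[OF this measurable_component_singleton[of i]]
  show "(\<lambda>v. v $ i) \<in> borel_measurable (vec_borel n)" using assms by simp
qed

lemma carrier_of_measurable_mat: "f \<in> N \<rightarrow>\<^sub>M mat_borel n p \<Longrightarrow> w \<in> space N \<Longrightarrow> f w \<in> carrier_mat n p"
  by (drule (1) measurable_space) simp

lemma carrier_of_measurable_vec: "f \<in> N \<rightarrow>\<^sub>M vec_borel n \<Longrightarrow> w \<in> space N \<Longrightarrow> f w \<in> carrier_vec n"
  by (drule (1) measurable_space) simp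

lemma measurable_mult_mat:
  assumes A: "A \<in> N \<rightarrow>\<^sub>M mat_borel n k" and B: "B \<in> N \<rightarrow>\<^sub>M mat_borel k p"
  shows "(\<lambda>w. A w * B w) \<in> N \<rightarrow>\<^sub>M mat_borel n p"
proof (rule measurable_mat_borelI)
  note c = carrier_of_measurable_mat[OF A] carrier_of_measurable_mat[OF B]
  show "A w * B w \<in> carrier_mat n p" if "w \<in> space N" for w using c[OF that] by simp
  fix i j assume ij: "i < n" "j < p"
  have "(\<lambda>w. \<Sum>l<k. A w $$ (i, l) * B w $$ (l, j)) \<in> borel_measurable N"
    using ij by (intro borel_measurable_sum borel_measurable_times measurable_mat_entry[OF A] measurable_mat_entry[OF B]) auto
  moreover have "(A w * B w) $$ (i, j) = (\<Sum>l<k. A w $$ (i, l) * B w $$ (l, j))" if "w \<in> space N" for w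
    using c[OF that] ij by (auto simp: scalar_prod_def lessThan_atLeast0)
  ultimately show "(\<lambda>w. (A w * B w) $$ (i, j)) \<in> borel_measurable N" by (simp cong: measurable_cong)
qed

lemma measurable_mult_mat_vec:
  assumes A: "A \<in> N \<rightarrow>\<^sub>M mat_borel n k" and B: "B \<in> N \<rightarrow>\<^sub>M vec_borel k"
  shows "(\<lambda>w. A w *\<^sub>v B w) \<in> N \<rightarrow>\<^sub>M vec_borel n"
proof (rule measurable_vec_borelI)
  note c = carrier_of_measurable_mat[OF A] carrier_of_measurable_vec[OF B]
  show "A w *\<^sub>v B w \<in> carrier_vec n" if "w \<in> space N" for w using c[OF that] by simp
  fix i assume i: "i < n"
  have "(\<lambda>w. \<Sum>l<k. A w $$ (i, l) * B w $ l) \<in> borel_measurable N"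
    using i by (intro borel_measurable_sum borel_measurable_times measurable_mat_entry[OF A] measurable_vec_entry[OF B]) auto
  moreover have "(A w *\<^sub>v B w) $ i = (\<Sum>l<k. A w $$ (i, l) * B w $ l)" if "w \<in> space N" for w
    using c[OF that] i by (auto simp: scalar_prod_def lessThan_atLeast0)
  ultimately show "(\<lambda>w. (A w *\<^sub>v B w) $ i) \<in> borel_measurable N" by (simp cong: measurable_cong)
qed

lemma measurable_scalar_prod:
  assumes A: "A \<in> N \<rightarrow>\<^sub>M vec_borel k" and B: "B \<in> N \<rightarrow>\<^sub>M vec_borel k"
  shows "(\<lambda>w. A w \<bullet> B w) \<in> borel_measurable N"
proof -
  have "(\<lambda>w. \<Sum>l<k. A w $ l * B w $ l) \<in> borel_measurable N"
    by (intro borel_measurable_sum borel_measurable_times measurable_vec_entry[OF A] measurable_vec_entry[OF B]) auto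
  moreover have "A w \<bullet> B w = (\<Sum>l<k. A w $ l * B w $ l)" if "w \<in> space N" for w
    using carrier_of_measurable_vec[OF B that] by (auto simp: scalar_prod_def lessThan_atLeast0)
  ultimately show ?thesis by (simp cong: measurable_cong)
qed

lemma measurable_transpose_mat:
  assumes A: "A \<in> N \<rightarrow>\<^sub>M mat_borel n k"
  shows "(\<lambda>w. transpose_mat (A w)) \<in> N \<rightarrow>\<^sub>M mat_borel k n"
proof (rule measurable_mat_borelI)
  note c = carrier_of_measurable_mat[OF A]
  show "transpose_mat (A w) \<in> carrier_mat k n" if "w \<in> space N" for w using c[OF that] by simp
  fix i j assume ij: "i < k" "j < n"
  have "transpose_mat (A w) $$ (i, j) = A w $$ (j, i)" if "w \<in> space N" for w using c[OF that] ij by simp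
  then show "(\<lambda>w. transpose_mat (A w) $$ (i, j)) \<in> borel_measurable N"
    using measurable_mat_entry[OF A ij(2,1)] by (simp cong: measurable_cong)
qed

lemma measurable_det:
  assumes A: "A \<in> N \<rightarrow>\<^sub>M mat_borel n n"
  shows "(\<lambda>w. det (A w)) \<in> borel_measurable N"
proof -
  have "(\<lambda>w. \<Sum>\<pi> | \<pi> permutes {0..<n}. signof \<pi> * (\<Prod>i = 0..<n. A w $$ (i, \<pi> i))) \<in> borel_measurable N"
  proof (intro borel_measurable_sum borel_measurable_times borel_measurable_prod measurable_mat_entry[OF A])
    fix \<pi> i assume "\<pi> \<in> {\<pi>. \<pi> permutes {0..<n}}" "i \<in> {0..<n}"
    then show "\<pi> i < n" using permutes_in_image[of \<pi> "{0..<n}" i] by auto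
  qed auto
  moreover have "det (A w) = (\<Sum>\<pi> | \<pi> permutes {0..<n}. signof \<pi> * (\<Prod>i = 0..<n. A w $$ (i, \<pi> i)))"
    if "w \<in> space N" for w
    by (rule det_def'[OF carrier_of_measurable_mat[OF A that]])
  ultimately show ?thesis by (simp cong: measurable_cong)
qed

lemma measurable_mat_delete:
  assumes A: "A \<in> N \<rightarrow>\<^sub>M mat_borel n n" and kl: "k < n" "l < n"
  shows "(\<lambda>w. mat_delete (A w) k l) \<in> N \<rightarrow>\<^sub>M mat_borel (n - 1) (n - 1)"
proof (rule measurable_mat_borelI)
  note c = carrier_of_measurable_mat[OF A]
  show "mat_delete (A w) k l \<in> carrier_mat (n - 1) (n - 1)" if "w \<in> space N" for w
    using c[OF that] by (simp add: mat_delete_def)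
  fix i j assume ij: "i < n - 1" "j < n - 1"
  have "mat_delete (A w) k l $$ (i, j) = A w $$ (if i < k then i else Suc i, if j < l then j else Suc j)"
    if "w \<in> space N" for w using c[OF that] ij by (simp add: mat_delete_def)
  moreover have "(\<lambda>w. A w $$ (if i < k then i else Suc i, if j < l then j else Suc j)) \<in> borel_measurable N"
    using ij kl by (intro measurable_mat_entry[OF A]) auto
  ultimately show "(\<lambda>w. mat_delete (A w) k l $$ (i, j)) \<in> borel_measurable N"
    by (simp cong: measurable_cong)
qed

text \<open>Cramer's rule expresses the entries of the inverse of \<open>S + l\<close> as rational functions of
those of \<open>S\<close>, which makes them visibly measurable.\<close>

definition resolvent :: "real mat \<Rightarrow> real \<Rightarrow> real mat" where
  "resolvent S l = (1 / det (S + l \<cdot>\<^sub>m 1\<^sub>m (dim_row S))) \<cdot>\<^sub>m adj_mat (S + l \<cdot>\<^sub>m 1\<^sub>m (dim_row S))"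

lemma measurable_resolvent:
  assumes A: "A \<in> N \<rightarrow>\<^sub>M mat_borel n n"
  shows "(\<lambda>w. resolvent (A w) l) \<in> N \<rightarrow>\<^sub>M mat_borel n n"
proof -
  note c = carrier_of_measurable_mat[OF A]
  define B where "B = (\<lambda>w. A w + l \<cdot>\<^sub>m 1\<^sub>m n)"
  have B: "B \<in> N \<rightarrow>\<^sub>M mat_borel n n"
  proof (rule measurable_mat_borelI)
    show "B w \<in> carrier_mat n n" if "w \<in> space N" for w using c[OF that] by (simp add: B_def)
    fix i j assume ij: "i < n" "j < n"
    have "B w $$ (i, j) = A w $$ (i, j) + l * (if i = j then 1 else 0)" if "w \<in> space N" for w
      using c[OF that] ij by (simp add: B_def)
    moreover have "(\<lambda>w. A w $$ (i, j) + l * (if i = j then 1 else 0)) \<in> borel_measurable N"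
      by (intro borel_measurable_add measurable_mat_entry[OF A] ij) simp
    ultimately show "(\<lambda>w. B w $$ (i, j)) \<in> borel_measurable N" by (simp cong: measurable_cong)
  qed
  note cB = carrier_of_measurable_mat[OF B]
  have "(\<lambda>w. (1 / det (B w)) \<cdot>\<^sub>m adj_mat (B w)) \<in> N \<rightarrow>\<^sub>M mat_borel n n"
  proof (rule measurable_mat_borelI)
    show "(1 / det (B w)) \<cdot>\<^sub>m adj_mat (B w) \<in> carrier_mat n n" if "w \<in> space N" for w
      using adj_mat(1)[OF cB[OF that]] by simp
    fix i j assume ij: "i < n" "j < n"
    have "((1 / det (B w)) \<cdot>\<^sub>m adj_mat (B w)) $$ (i, j)
      = (1 / det (B w)) * ((- 1) ^ (j + i) * det (mat_delete (B w) j i))" if "w \<in> space N" for w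
      using cB[OF that] ij by (simp add: adj_mat_def cofactor_def)
    moreover have "(\<lambda>w. (1 / det (B w)) * ((- 1) ^ (j + i) * det (mat_delete (B w) j i))) \<in> borel_measurable N"
      by (intro borel_measurable_times borel_measurable_divide measurable_det[OF B] borel_measurable_const
          measurable_det[OF measurable_mat_delete[OF B]] ij)
    ultimately show "(\<lambda>w. ((1 / det (B w)) \<cdot>\<^sub>m adj_mat (B w)) $$ (i, j)) \<in> borel_measurable N"
      by (simp cong: measurable_cong)
  qed
  moreover have "resolvent (A w) l = (1 / det (B w)) \<cdot>\<^sub>m adj_mat (B w)" if "w \<in> space N" for w
    using c[OF that] by (simp add: resolvent_def B_def)
  ultimately show ?thesis by (simp cong: measurable_cong)
qed

lemma measurable_pow_mat:
  assumes A: "A \<in> N \<rightarrow>\<^sub>M mat_borel n n"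
  shows "(\<lambda>w. A w ^\<^sub>m k) \<in> N \<rightarrow>\<^sub>M mat_borel n n"
proof (induction k)
  case 0
  have "A w ^\<^sub>m 0 = 1\<^sub>m n" if "w \<in> space N" for w using carrier_of_measurable_mat[OF A that] by simp
  moreover have "(\<lambda>_. 1\<^sub>m n) \<in> N \<rightarrow>\<^sub>M mat_borel n n" by (rule measurable_const) simp
  ultimately show ?case by (simp cong: measurable_cong)
next
  case (Suc k)
  show ?case by (simp, rule measurable_mult_mat[OF Suc A])
qed

section \<open>Spectral calculus from a singular value decomposition\<close>

text \<open>The matrix \<open>W^T diag(f) W\<close>, that is, the function of \<open>X^T X\<close> that takes the value \<open>f i\<close> on
the \<open>i\<close>-th right singular vector when \<open>W\<close> comes from a singular value decomposition of \<open>X\<close>.\<close>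

definition spectral_mat :: "nat \<Rightarrow> real mat \<Rightarrow> (nat \<Rightarrow> real) \<Rightarrow> real mat" where
  "spectral_mat k W f = mat k k (\<lambda>(i, j). \<Sum>l<k. W $$ (l, i) * f l * W $$ (l, j))"

lemma spectral_mat_carrier [simp]: "spectral_mat k W f \<in> carrier_mat k k"
  by (simp add: spectral_mat_def)

lemma orth_mat_carrier: "orth_mat k W \<Longrightarrow> W \<in> carrier_mat k k"
  by (simp add: orth_mat_def)

lemma orth_mat_right_inverse: "orth_mat k W \<Longrightarrow> W * transpose_mat W = 1\<^sub>m k"
  unfolding orth_mat_def by (auto intro: mat_mult_left_right_inverse[of "transpose_mat W"])

lemma orth_mat_rows:
  assumes "orth_mat k W" "l < k" "m < k"
  shows "(\<Sum>i<k. W $$ (l, i) * W $$ (m, i)) = (if l = m then 1 else 0)"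
proof -
  have "(W * transpose_mat W) $$ (l, m) = (\<Sum>i<k. W $$ (l, i) * W $$ (m, i))"
    using orth_mat_carrier[OF assms(1)] assms(2,3) by (auto simp: scalar_prod_def lessThan_atLeast0)
  then show ?thesis using orth_mat_right_inverse[OF assms(1)] assms(2,3) by simp
qed

lemma orth_mat_cols:
  assumes "orth_mat k W" "l < k" "m < k"
  shows "(\<Sum>i<k. W $$ (i, l) * W $$ (i, m)) = (if l = m then 1 else 0)"
proof -
  have "(transpose_mat W * W) $$ (l, m) = (\<Sum>i<k. W $$ (i, l) * W $$ (i, m))"
    using orth_mat_carrier[OF assms(1)] assms(2,3) by (auto simp: scalar_prod_def lessThan_atLeast0)
  then show ?thesis using assms by (simp add: orth_mat_def)
qed

lemma orth_mat_mult: "orth_mat k V \<Longrightarrow> orth_mat k W \<Longrightarrow> orth_mat k (V * W)"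
proof -
  assume V: "orth_mat k V" and W: "orth_mat k W"
  note c = orth_mat_carrier[OF V] orth_mat_carrier[OF W]
  have "transpose_mat (V * W) * (V * W) = transpose_mat W * (transpose_mat V * V) * W"
    using c by (simp add: transpose_mult assoc_mult_mat[of _ k k _ k _ k])
  then show ?thesis using V W c by (simp add: orth_mat_def)
qed

lemma orth_mat_scalar_prod:
  assumes W: "orth_mat k W" and v: "v \<in> carrier_vec k" and w: "w \<in> carrier_vec k"
  shows "(W *\<^sub>v v) \<bullet> (W *\<^sub>v w) = v \<bullet> w"
proof -
  note c = orth_mat_carrier[OF W]
  have "(W *\<^sub>v v) \<bullet> (W *\<^sub>v w) = v \<bullet> (transpose_mat W *\<^sub>v (W *\<^sub>v w))"
    using c v w by (subst transpose_vec_mult_scalar[of "transpose_mat W" k k, symmetric]) auto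
  also have "transpose_mat W *\<^sub>v (W *\<^sub>v w) = w"
    using c w W by (simp add: assoc_mult_mat_vec[symmetric, of _ k k] orth_mat_def)
  finally show ?thesis .
qed

lemma spectral_mat_mult:
  assumes W: "orth_mat k W"
  shows "spectral_mat k W f * spectral_mat k W g = spectral_mat k W (\<lambda>l. f l * g l)"
proof (rule eq_matI)
  fix i j assume "i < dim_row (spectral_mat k W (\<lambda>l. f l * g l))" "j < dim_col (spectral_mat k W (\<lambda>l. f l * g l))"
  then have ij: "i < k" "j < k" by (auto simp: spectral_mat_def)
  have "(spectral_mat k W f * spectral_mat k W g) $$ (i, j) =
    (\<Sum>h<k. (\<Sum>l<k. W $$ (l, i) * f l * W $$ (l, h)) * (\<Sum>m<k. W $$ (m, h) * g m * W $$ (m, j)))"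
    using ij by (auto simp: spectral_mat_def scalar_prod_def lessThan_atLeast0)
  also have "\<dots> = (\<Sum>h<k. \<Sum>l<k. \<Sum>m<k. (W $$ (l, i) * f l * g m * W $$ (m, j)) * (W $$ (l, h) * W $$ (m, h)))"
    by (simp add: sum_product mult_ac)
  also have "\<dots> = (\<Sum>l<k. \<Sum>m<k. (W $$ (l, i) * f l * g m * W $$ (m, j)) * (\<Sum>h<k. W $$ (l, h) * W $$ (m, h)))"
    by (subst sum.swap, rule sum.cong[OF refl], subst sum.swap) (simp add: sum_distrib_left)
  also have "\<dots> = (\<Sum>l<k. \<Sum>m<k. if l = m then W $$ (l, i) * f l * g m * W $$ (m, j) else 0)"
    using orth_mat_rows[OF W] by (intro sum.cong refl) auto
  also have "\<dots> = (\<Sum>l<k. W $$ (l, i) * (f l * g l) * W $$ (l, j))"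
    by (simp add: mult.assoc)
  finally show "(spectral_mat k W f * spectral_mat k W g) $$ (i, j) = spectral_mat k W (\<lambda>l. f l * g l) $$ (i, j)"
    using ij by (simp add: spectral_mat_def)
qed (auto simp: spectral_mat_def)

lemma spectral_mat_one: "orth_mat k W \<Longrightarrow> spectral_mat k W (\<lambda>_. 1) = 1\<^sub>m k"
  by (rule eq_matI) (auto simp: spectral_mat_def orth_mat_cols)

lemma spectral_mat_shift:
  assumes "orth_mat k W"
  shows "spectral_mat k W f + l \<cdot>\<^sub>m 1\<^sub>m k = spectral_mat k W (\<lambda>i. f i + l)"
  unfolding spectral_mat_one[OF assms, symmetric]
  by (rule eq_matI) (auto simp: spectral_mat_def sum_distrib_left sum.distrib[symmetric] algebra_simps)

lemma spectral_mat_pow: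
  assumes W: "orth_mat k W"
  shows "spectral_mat k W f ^\<^sub>m j = spectral_mat k W (\<lambda>i. f i ^ j)"
proof (induction j)
  case 0
  show ?case by (simp add: spectral_mat_one[OF W]) (simp add: spectral_mat_def)
next
  case (Suc j)
  then show ?case by (simp add: spectral_mat_mult[OF W] mult.commute)
qed

lemma spectral_mat_apply:
  assumes W: "orth_mat k W" and b: "b \<in> carrier_vec k" and i: "i < k"
  shows "(W *\<^sub>v (spectral_mat k W f *\<^sub>v b)) $ i = f i * (W *\<^sub>v b) $ i"
proof -
  note c = orth_mat_carrier[OF W]
  have "(W *\<^sub>v (spectral_mat k W f *\<^sub>v b)) $ i
    = (\<Sum>h<k. W $$ (i, h) * (\<Sum>j<k. (\<Sum>l<k. W $$ (l, h) * f l * W $$ (l, j)) * b $ j))"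
    using c b i by (auto simp: spectral_mat_def scalar_prod_def lessThan_atLeast0)
  also have "\<dots> = (\<Sum>h<k. \<Sum>j<k. \<Sum>l<k. (W $$ (i, h) * W $$ (l, h)) * (f l * W $$ (l, j) * b $ j))"
    by (simp add: sum_distrib_left sum_distrib_right mult_ac)
  also have "\<dots> = (\<Sum>j<k. \<Sum>l<k. (\<Sum>h<k. W $$ (i, h) * W $$ (l, h)) * (f l * W $$ (l, j) * b $ j))"
    by (subst sum.swap, rule sum.cong[OF refl], subst sum.swap) (simp add: sum_distrib_right)
  also have "\<dots> = (\<Sum>j<k. \<Sum>l<k. if i = l then f l * W $$ (l, j) * b $ j else 0)"
    using orth_mat_rows[OF W i] by (intro sum.cong refl) auto
  also have "\<dots> = f i * (W *\<^sub>v b) $ i"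
    using c b i by (auto simp: scalar_prod_def lessThan_atLeast0 sum_distrib_left mult_ac)
  finally show ?thesis .
qed

lemma scalar_prod_spectral_mat:
  assumes W: "orth_mat k W" and b: "b \<in> carrier_vec k" and e: "e \<in> carrier_vec k"
  shows "e \<bullet> (spectral_mat k W f *\<^sub>v b) = (\<Sum>i<k. f i * ((W *\<^sub>v e) $ i * (W *\<^sub>v b) $ i))"
proof -
  note c = orth_mat_carrier[OF W]
  have "e \<bullet> (spectral_mat k W f *\<^sub>v b) = (W *\<^sub>v e) \<bullet> (W *\<^sub>v (spectral_mat k W f *\<^sub>v b))"
    using b e by (subst orth_mat_scalar_prod[OF W]) (auto intro!: mult_mat_vec_carrier)
  also have "\<dots> = (\<Sum>i<k. (W *\<^sub>v e) $ i * (W *\<^sub>v (spectral_mat k W f *\<^sub>v b)) $ i)"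
    using c by (simp add: scalar_prod_def lessThan_atLeast0)
  also have "\<dots> = (\<Sum>i<k. f i * ((W *\<^sub>v e) $ i * (W *\<^sub>v b) $ i))"
    using spectral_mat_apply[OF W b] by (intro sum.cong refl) (simp add: mult_ac)
  finally show ?thesis .
qed

lemma trace_spectral_mat:
  assumes W: "orth_mat k W"
  shows "(\<Sum>i<k. spectral_mat k W f $$ (i, i)) = (\<Sum>l<k. f l)"
proof -
  have "(\<Sum>i<k. spectral_mat k W f $$ (i, i)) = (\<Sum>i<k. \<Sum>l<k. f l * (W $$ (l, i) * W $$ (l, i)))"
    by (simp add: spectral_mat_def mult_ac)
  also have "\<dots> = (\<Sum>l<k. f l * (\<Sum>i<k. W $$ (l, i) * W $$ (l, i)))"
    by (subst sum.swap) (simp add: sum_distrib_left)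
  also have "\<dots> = (\<Sum>l<k. f l)" using orth_mat_rows[OF W] by simp
  finally show ?thesis .
qed

lemma spectral_mat_sym: "i < k \<Longrightarrow> j < k \<Longrightarrow> spectral_mat k W f $$ (i, j) = spectral_mat k W f $$ (j, i)"
  by (simp add: spectral_mat_def mult_ac)

text \<open>The squared norm of row \<open>i\<close> is the mean of \<open>f\<^sup>2\<close> for the weights \<open>(W $$ (l, i))\<^sup>2\<close>, which
sum to one.\<close>

lemma spectral_mat_row_le:
  assumes W: "orth_mat k W" and i: "i < k" and f: "\<And>l. l < k \<Longrightarrow> \<bar>f l\<bar> \<le> M"
  shows "(\<Sum>j<k. (spectral_mat k W f $$ (i, j))\<^sup>2) \<le> M\<^sup>2"
proof -
  have "(\<Sum>j<k. (spectral_mat k W f $$ (i, j))\<^sup>2) = (spectral_mat k W f * spectral_mat k W f) $$ (i, i)"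
    using i spectral_mat_sym[of _ k i W f]
    by (auto simp: spectral_mat_def scalar_prod_def lessThan_atLeast0 power2_eq_square intro!: sum.cong)
  also have "\<dots> = (\<Sum>l<k. (f l)\<^sup>2 * (W $$ (l, i) * W $$ (l, i)))"
    using i unfolding spectral_mat_mult[OF W] by (simp add: spectral_mat_def power2_eq_square mult_ac)
  also have "\<dots> \<le> (\<Sum>l<k. M\<^sup>2 * (W $$ (l, i) * W $$ (l, i)))"
  proof (intro sum_mono mult_right_mono)
    fix l assume "l \<in> {..<k}"
    then show "(f l)\<^sup>2 \<le> M\<^sup>2" using f[of l] power_mono[of "\<bar>f l\<bar>" M 2] by simp
  qed auto
  also have "\<dots> = M\<^sup>2" using orth_mat_cols[OF W i i] by (simp add: sum_distrib_left[symmetric])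
  finally show ?thesis .
qed

text \<open>Transposition exchanges the two orthogonal factors, so results on \<open>X^T X\<close> carry over to
\<open>X X^T\<close>.\<close>

lemma is_svd_transpose:
  assumes "is_svd n p x Q D W"
  shows "is_svd p n (transpose_mat x) W (transpose_mat D) Q"
proof -
  have c: "Q \<in> carrier_mat n n" "W \<in> carrier_mat p p" "D \<in> carrier_mat n p"
    using assms by (auto simp: is_svd_def orth_mat_def)
  then have "transpose_mat (transpose_mat Q * D * W) = transpose_mat W * transpose_mat D * Q"
    by (simp add: transpose_mult[of _ n p _ p] transpose_mult[of _ n n _ p] assoc_mult_mat[of _ p p _ n _ n])
  then show ?thesis using assms c by (auto simp: is_svd_def diagonal_mat_def)
qed

lemma is_svd_rotate:
  assumes "is_svd n p x Q D W" "orth_mat p V"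
  shows "is_svd n p (x * V) Q D (W * V)"
proof -
  have c: "Q \<in> carrier_mat n n" "W \<in> carrier_mat p p" "D \<in> carrier_mat n p" "V \<in> carrier_mat p p"
    using assms by (auto simp: is_svd_def orth_mat_def)
  then have "transpose_mat Q * D * W * V = transpose_mat Q * D * (W * V)"
    by (intro assoc_mult_mat[of _ n p _ p _ p]) auto
  moreover have "x = transpose_mat Q * D * W" using assms by (simp add: is_svd_def)
  ultimately have "x * V = transpose_mat Q * D * (W * V)" by simp
  then show ?thesis using assms orth_mat_mult[of p W V] unfolding is_svd_def by blast
qed

lemma diag_entry_transpose: "D \<in> carrier_mat n p \<Longrightarrow> diag_entry (transpose_mat D) = diag_entry D"
  by (auto simp: diag_entry_def min.commute fun_eq_iff)

lemma diagonal_mat_mult_vec: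
  assumes D: "D \<in> carrier_mat n p" "diagonal_mat D" and u: "u \<in> carrier_vec p" and i: "i < n"
  shows "(D *\<^sub>v u) $ i = (if i < p then diag_entry D i * u $ i else 0)"
proof -
  have "(D *\<^sub>v u) $ i = (\<Sum>j<p. D $$ (i, j) * u $ j)"
    using D u i by (auto simp: scalar_prod_def lessThan_atLeast0)
  also have "\<dots> = (\<Sum>j<p. if j = i then D $$ (i, i) * u $ i else 0)"
    using D i by (intro sum.cong) (auto simp: diagonal_mat_def)
  also have "\<dots> = (if i < p then diag_entry D i * u $ i else 0)"
    using D i by (simp add: diag_entry_def)
  finally show ?thesis .
qed

lemma is_svd_carrier:
  assumes "is_svd n p x Q D W"
  shows "x \<in> carrier_mat n p" "Q \<in> carrier_mat n n" "W \<in> carrier_mat p p" "D \<in> carrier_mat n p"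
    "orth_mat n Q" "orth_mat p W" "diagonal_mat D"
  using assms by (auto simp: is_svd_def orth_mat_def)

lemma is_svd_apply:
  assumes svd: "is_svd n p x Q D W" and b: "b \<in> carrier_vec p" and i: "i < n"
  shows "(Q *\<^sub>v (x *\<^sub>v b)) $ i = (if i < p then diag_entry D i * (W *\<^sub>v b) $ i else 0)"
proof -
  note c = is_svd_carrier[OF svd]
  have "Q *\<^sub>v (x *\<^sub>v b) = Q *\<^sub>v (transpose_mat Q *\<^sub>v (D *\<^sub>v (W *\<^sub>v b)))"
    using svd c b unfolding is_svd_def
    by (simp add: assoc_mult_mat_vec[of _ n p _ p] assoc_mult_mat_vec[of _ n n _ p])
  also have "\<dots> = D *\<^sub>v (W *\<^sub>v b)"
    using c b orth_mat_right_inverse[OF c(5)]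
    by (simp add: assoc_mult_mat_vec[symmetric, of _ n n _ n])
  finally show ?thesis using diagonal_mat_mult_vec[OF c(4,7) _ i, of "W *\<^sub>v b"] c b by simp
qed

lemma is_svd_gram:
  assumes svd: "is_svd n p x Q D W"
  shows "transpose_mat x * x = spectral_mat p W (\<lambda>i. (diag_entry D i)\<^sup>2)"
proof -
  note c = is_svd_carrier[OF svd]
  have "transpose_mat x * x = transpose_mat W * (transpose_mat D * D) * W"
  proof -
    have "transpose_mat x * x = (transpose_mat W * transpose_mat D * Q) * (transpose_mat Q * D * W)"
      using is_svd_transpose[OF svd] svd by (simp add: is_svd_def)
    also have "\<dots> = transpose_mat W * (transpose_mat D * ((Q * transpose_mat Q) * D)) * W"
      using c by (simp add: assoc_mult_mat[of _ p p _ n _ n] assoc_mult_mat[of _ p n _ n _ n] assoc_mult_mat[of _ p p _ n _ p]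
          assoc_mult_mat[of _ p n _ n _ p] assoc_mult_mat[of _ n n _ n _ p] assoc_mult_mat[of _ n n _ p _ p]
          assoc_mult_mat[of _ p n _ p _ p] assoc_mult_mat[of _ p p _ p _ p])
    finally show ?thesis using orth_mat_right_inverse[OF c(5)] c by simp
  qed
  also have "\<dots> = spectral_mat p W (\<lambda>i. (diag_entry D i)\<^sup>2)"
  proof (rule eq_matI)
    fix i j assume "i < dim_row (spectral_mat p W (\<lambda>i. (diag_entry D i)\<^sup>2))" "j < dim_col (spectral_mat p W (\<lambda>i. (diag_entry D i)\<^sup>2))"
    then have ij: "i < p" "j < p" by (auto simp: spectral_mat_def)
    have DD: "(transpose_mat D * D) $$ (l, m) = (if l = m then (diag_entry D l)\<^sup>2 else 0)" if "l < p" "m < p" for l m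
    proof -
      have "(transpose_mat D * D) $$ (l, m) = (\<Sum>h<n. D $$ (h, l) * D $$ (h, m))"
        using c that by (auto simp: scalar_prod_def lessThan_atLeast0)
      also have "\<dots> = (\<Sum>h<n. if h = l then (if l = m then (D $$ (l, l))\<^sup>2 else 0) else 0)"
        using c that by (intro sum.cong) (auto simp: diagonal_mat_def power2_eq_square)
      also have "\<dots> = (if l = m then (diag_entry D l)\<^sup>2 else 0)"
        using c that by (simp add: diag_entry_def)
      finally show ?thesis .
    qed
    have "(transpose_mat W * (transpose_mat D * D) * W) $$ (i, j)
      = (\<Sum>m<p. (\<Sum>l<p. W $$ (l, i) * (transpose_mat D * D) $$ (l, m)) * W $$ (m, j))"
      using c ij by (auto simp: scalar_prod_def lessThan_atLeast0)
    also have "\<dots> = (\<Sum>m<p. (\<Sum>l<p. if l = m then W $$ (l, i) * (diag_entry D l)\<^sup>2 else 0) * W $$ (m, j))"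
      by (intro sum.cong refl arg_cong2[where f="(*)"]) (simp add: DD)
    also have "\<dots> = spectral_mat p W (\<lambda>i. (diag_entry D i)\<^sup>2) $$ (i, j)"
      using ij by (simp add: spectral_mat_def)
    finally show "(transpose_mat W * (transpose_mat D * D) * W) $$ (i, j) = spectral_mat p W (\<lambda>i. (diag_entry D i)\<^sup>2) $$ (i, j)" .
  qed (use c in \<open>auto simp: spectral_mat_def\<close>)
  finally show ?thesis .
qed

lemma left_inverse_unique:
  fixes A B C :: "real mat"
  assumes "A \<in> carrier_mat k k" "B \<in> carrier_mat k k" "C \<in> carrier_mat k k" "B * A = 1\<^sub>m k" "A * C = 1\<^sub>m k"
  shows "B = C"
proof -
  have "B = B * (A * C)" using assms by simp
  also have "\<dots> = (B * A) * C" using assms(1-3) by (simp add: assoc_mult_mat[of _ k k _ k _ k])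
  finally show ?thesis using assms by simp
qed

text \<open>The adjugate formula, used for measurability, and Gauss--Jordan elimination, used in the
definition of the ridge estimate, are both identified with the spectral expression by uniqueness
of inverses.\<close>

lemma
  assumes svd: "is_svd n p x Q D W" and l: "0 < l"
  defines "G \<equiv> spectral_mat p W (\<lambda>i. 1 / ((diag_entry D i)\<^sup>2 + l))"
  shows resolvent_gram: "resolvent (transpose_mat x * x) l = G"
    and mat_inverse_gram: "the (mat_inverse (transpose_mat x * x + l \<cdot>\<^sub>m 1\<^sub>m p)) = G"
proof -
  note c = is_svd_carrier[OF svd]
  define S where "S = transpose_mat x * x + l \<cdot>\<^sub>m 1\<^sub>m p"
  have S_eq: "S = spectral_mat p W (\<lambda>i. (diag_entry D i)\<^sup>2 + l)"
    unfolding S_def is_svd_gram[OF svd] by (rule spectral_mat_shift[OF c(6)])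
  have S: "S \<in> carrier_mat p p" by (simp add: S_eq)
  have G: "G \<in> carrier_mat p p" by (simp add: G_def)
  have nz: "(diag_entry D i)\<^sup>2 + l \<noteq> 0" for i
    using l zero_le_power2[of "diag_entry D i"] by linarith
  have GS: "G * S = 1\<^sub>m p" and SG: "S * G = 1\<^sub>m p"
    unfolding G_def S_eq spectral_mat_mult[OF c(6)] by (simp_all add: nz spectral_mat_one[OF c(6)])
  have det: "det S \<noteq> 0"
    using det_mult[OF S G] SG by auto
  have "(1 / det S) \<cdot>\<^sub>m adj_mat S = G"
  proof (rule left_inverse_unique[OF S _ G _ SG])
    show "(1 / det S) \<cdot>\<^sub>m adj_mat S \<in> carrier_mat p p" using adj_mat(1)[OF S] by simp
    have "(1 / det S) \<cdot>\<^sub>m adj_mat S * S = (1 / det S) \<cdot>\<^sub>m (adj_mat S * S)"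
      using adj_mat(1)[OF S] S by (simp add: mult_smult_assoc_mat)
    also have "\<dots> = 1\<^sub>m p" using det by (simp add: adj_mat(3)[OF S] smult_smult_assoc) (auto intro: eq_matI)
    finally show "(1 / det S) \<cdot>\<^sub>m adj_mat S * S = 1\<^sub>m p" .
  qed
  moreover have "dim_row (transpose_mat x * x) = p" using c by simp
  ultimately show "resolvent (transpose_mat x * x) l = G" by (simp add: resolvent_def S_def)
  show "the (mat_inverse S) = G"
  proof (cases "mat_inverse S")
    case None
    have "S \<in> Units (ring_mat TYPE(real) p ())"
      using S G SG GS unfolding Units_def ring_mat_def by auto
    with mat_inverse(1)[OF S None, of "()"] show ?thesis by simp
  next
    case (Some B)
    from mat_inverse(2)[OF S this] have "B = G" using left_inverse_unique[OF S _ G _ SG] by auto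
    with Some show ?thesis by simp
  qed
qed

lemma resolvent_gram_pow:
  assumes "is_svd n p x Q D W" "0 < l"
  shows "resolvent (transpose_mat x * x) l ^\<^sub>m k = spectral_mat p W (\<lambda>i. 1 / ((diag_entry D i)\<^sup>2 + l) ^ k)"
  using is_svd_carrier(6)[OF assms(1)]
  by (simp add: resolvent_gram[OF assms] spectral_mat_pow power_divide)

lemma resolvent_cogram_pow:
  assumes svd: "is_svd n p x Q D W" and l: "0 < l"
  shows "resolvent (x * transpose_mat x) l ^\<^sub>m k = spectral_mat n Q (\<lambda>i. 1 / ((diag_entry D i)\<^sup>2 + l) ^ k)"
  using resolvent_gram_pow[OF is_svd_transpose[OF svd] l] diag_entry_transpose[OF is_svd_carrier(4)[OF svd]]
  by simp

section \<open>Independence, tails and almost sure convergence\<close>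

lemma indep_rv_distr_Pair:
  assumes "prob_space M" and ind: "indep_rv M S U T V"
  shows "distr M (S \<Otimes>\<^sub>M T) (\<lambda>\<omega>. (U \<omega>, V \<omega>)) = distr M S U \<Otimes>\<^sub>M distr M T V"
proof -
  interpret prob_space M by fact
  have U [measurable]: "U \<in> M \<rightarrow>\<^sub>M S" and V [measurable]: "V \<in> M \<rightarrow>\<^sub>M T"
    and set: "indep_set {U -` A \<inter> space M | A. A \<in> sets S} {V -` B \<inter> space M | B. B \<in> sets T}"
    using ind by (auto simp: indep_rv_def)
  interpret PU: prob_space "distr M S U" by (rule prob_space_distr) fact
  interpret PV: prob_space "distr M T V" by (rule prob_space_distr) fact
  show ?thesis
  proof (rule pair_measure_eqI[symmetric])
    show "sigma_finite_measure (distr M S U)" "sigma_finite_measure (distr M T V)" by unfold_locales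
    show "sets (distr M S U \<Otimes>\<^sub>M distr M T V) = sets (distr M (S \<Otimes>\<^sub>M T) (\<lambda>\<omega>. (U \<omega>, V \<omega>)))"
      by (simp cong: sets_pair_measure_cong)
    fix A B assume "A \<in> sets (distr M S U)" "B \<in> sets (distr M T V)"
    then have A [measurable]: "A \<in> sets S" and B [measurable]: "B \<in> sets T" by auto
    have "prob ((U -` A \<inter> space M) \<inter> (V -` B \<inter> space M)) = prob (U -` A \<inter> space M) * prob (V -` B \<inter> space M)"
      by (rule indep_setD[OF set]) (use A B in auto)
    moreover have "(U -` A \<inter> space M) \<inter> (V -` B \<inter> space M) = (\<lambda>\<omega>. (U \<omega>, V \<omega>)) -` (A \<times> B) \<inter> space M" by auto
    ultimately show "emeasure (distr M S U) A * emeasure (distr M T V) B =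
        emeasure (distr M (S \<Otimes>\<^sub>M T) (\<lambda>\<omega>. (U \<omega>, V \<omega>))) (A \<times> B)"
      by (simp add: emeasure_distr emeasure_eq_measure ennreal_mult'')
  qed
qed

text \<open>By Fubini's theorem for the product law it suffices to bound the probability with \<open>U\<close>
frozen at any of its values. This takes the place of conditional probabilities.\<close>

lemma emeasure_le_of_independent_sections:
  assumes M: "prob_space M" and ind: "indep_rv M S U T V"
    and P: "Measurable.pred (S \<Otimes>\<^sub>M T) (\<lambda>z. P (fst z) (snd z))"
    and le: "\<And>\<omega>'. \<omega>' \<in> space M \<Longrightarrow> emeasure M {\<omega> \<in> space M. P (U \<omega>') (V \<omega>)} \<le> c"
  shows "emeasure M {\<omega> \<in> space M. P (U \<omega>) (V \<omega>)} \<le> c"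
proof -
  interpret prob_space M by fact
  have U [measurable]: "U \<in> M \<rightarrow>\<^sub>M S" and V [measurable]: "V \<in> M \<rightarrow>\<^sub>M T"
    using ind by (auto simp: indep_rv_def)
  interpret PV: prob_space "distr M T V" by (rule prob_space_distr) fact
  define E where "E = {z \<in> space (S \<Otimes>\<^sub>M T). P (fst z) (snd z)}"
  have E [measurable]: "E \<in> sets (S \<Otimes>\<^sub>M T)" unfolding E_def using P by (rule predE)
  have "{\<omega> \<in> space M. P (U \<omega>) (V \<omega>)} = (\<lambda>\<omega>. (U \<omega>, V \<omega>)) -` E \<inter> space M"
    using measurable_space[OF U] measurable_space[OF V] by (auto simp: E_def space_pair_measure)
  then have "emeasure M {\<omega> \<in> space M. P (U \<omega>) (V \<omega>)} = emeasure (distr M (S \<Otimes>\<^sub>M T) (\<lambda>\<omega>. (U \<omega>, V \<omega>))) E"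
    by (simp add: emeasure_distr)
  also have "\<dots> = (\<integral>\<^sup>+u. emeasure (distr M T V) (Pair u -` E) \<partial>distr M S U)"
    unfolding indep_rv_distr_Pair[OF M ind] by (rule PV.emeasure_pair_measure_alt) simp
  also have "\<dots> = (\<integral>\<^sup>+\<omega>'. emeasure (distr M T V) (Pair (U \<omega>') -` E) \<partial>M)"
    by (rule nn_integral_distr) (use PV.measurable_emeasure_Pair[of E S] in simp_all)
  also have "\<dots> \<le> (\<integral>\<^sup>+\<omega>'. c \<partial>M)"
  proof (rule nn_integral_mono)
    fix \<omega>' assume w: "\<omega>' \<in> space M"
    have "emeasure (distr M T V) (Pair (U \<omega>') -` E) = emeasure M (V -` (Pair (U \<omega>') -` E) \<inter> space M)"
      by (rule emeasure_distr) simp_all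
    also have "V -` (Pair (U \<omega>') -` E) \<inter> space M = {\<omega> \<in> space M. P (U \<omega>') (V \<omega>)}"
      using measurable_space[OF U w] measurable_space[OF V] by (auto simp: E_def space_pair_measure)
    finally show "emeasure (distr M T V) (Pair (U \<omega>') -` E) \<le> c" using le[OF w] by simp
  qed
  finally show ?thesis by (simp add: emeasure_space_1)
qed

lemma indep_rv_compose_right:
  assumes "indep_rv M S U T V" "f \<in> T \<rightarrow>\<^sub>M T'" "prob_space M"
  shows "indep_rv M S U T' (\<lambda>\<omega>. f (V \<omega>))"
proof -
  interpret prob_space M by fact
  have V: "V \<in> M \<rightarrow>\<^sub>M T" using assms by (simp add: indep_rv_def)
  have set: "indep_set {U -` A \<inter> space M | A. A \<in> sets S} {V -` B \<inter> space M | B. B \<in> sets T}"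
    using assms by (simp add: indep_rv_def)
  have sub: "{(\<lambda>\<omega>. f (V \<omega>)) -` B \<inter> space M | B. B \<in> sets T'} \<subseteq> {V -` B \<inter> space M | B. B \<in> sets T}"
  proof safe
    fix B assume "B \<in> sets T'"
    then have "f -` B \<inter> space T \<in> sets T" by (rule measurable_sets[OF assms(2)])
    moreover have "(\<lambda>\<omega>. f (V \<omega>)) -` B \<inter> space M = V -` (f -` B \<inter> space T) \<inter> space M"
      using measurable_space[OF V] by auto
    ultimately show "\<exists>B'. (\<lambda>\<omega>. f (V \<omega>)) -` B \<inter> space M = V -` B' \<inter> space M \<and> B' \<in> sets T" by blast
  qed
  have "indep_set {U -` A \<inter> space M | A. A \<in> sets S} {(\<lambda>\<omega>. f (V \<omega>)) -` B \<inter> space M | B. B \<in> sets T'}"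
    by (intro indep_setI indep_setD_ev1[OF set] order_trans[OF sub indep_setD_ev2[OF set]]
        indep_setD[OF set] subsetD[OF sub])
  then show ?thesis
    using assms(1) measurable_compose[OF V assms(2)] by (simp add: indep_rv_def)
qed

text \<open>The Borel--Cantelli lemma at the countably many levels \<open>1 / (k + 1)\<close>; the factor \<open>T\<close> may
depend on the level.\<close>

lemma AE_tendsto_zero_of_polynomial_tails:
  fixes Z :: "nat \<Rightarrow> 'w \<Rightarrow> real"
  assumes "prob_space M" and [measurable]: "\<And>n. Z n \<in> borel_measurable M" and q: "1 < q"
    and tail: "\<And>\<delta>. 0 < \<delta> \<Longrightarrow> \<exists>T\<ge>0. \<forall>\<^sub>F n in sequentially.
        emeasure M {\<omega> \<in> space M. \<delta> \<le> \<bar>Z n \<omega>\<bar>} \<le> ennreal (T * real n powr (- q))"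
  shows "AE \<omega> in M. (\<lambda>n. Z n \<omega>) \<longlonglongrightarrow> 0"
proof -
  interpret prob_space M by fact
  have "AE \<omega> in M. \<forall>\<^sub>F n in sequentially. \<bar>Z n \<omega>\<bar> < 1 / real (Suc k)" for k
  proof -
    obtain T where T: "0 \<le> T" "\<forall>\<^sub>F n in sequentially.
        emeasure M {\<omega> \<in> space M. 1 / real (Suc k) \<le> \<bar>Z n \<omega>\<bar>} \<le> ennreal (T * real n powr (- q))"
      using tail[of "1 / real (Suc k)"] by auto
    have "AE \<omega> in M. \<forall>\<^sub>F n in sequentially. \<omega> \<in> space M - {\<omega> \<in> space M. 1 / real (Suc k) \<le> \<bar>Z n \<omega>\<bar>}"
    proof (rule borel_cantelli_AE1)
      show "summable (\<lambda>n. prob {\<omega> \<in> space M. 1 / real (Suc k) \<le> \<bar>Z n \<omega>\<bar>})"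
      proof (rule summable_comparison_test_ev)
        show "summable (\<lambda>n. T * real n powr (- q))"
          using q by (intro summable_mult) (simp add: summable_real_powr_iff)
        show "\<forall>\<^sub>F n in sequentially. norm (prob {\<omega> \<in> space M. 1 / real (Suc k) \<le> \<bar>Z n \<omega>\<bar>}) \<le> T * real n powr (- q)"
          using T(2) by eventually_elim (use T(1) in \<open>simp add: emeasure_eq_measure\<close>)
      qed
    qed (auto simp: emeasure_eq_measure)
    then show ?thesis by (rule AE_mp) (auto intro!: AE_I2 elim!: eventually_mono)
  qed
  then have "AE \<omega> in M. \<forall>k. \<forall>\<^sub>F n in sequentially. \<bar>Z n \<omega>\<bar> < 1 / real (Suc k)"
    unfolding AE_all_countable by blast
  then show ?thesis
  proof (rule AE_mp, intro AE_I2 impI)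
    fix \<omega> assume ev: "\<forall>k. \<forall>\<^sub>F n in sequentially. \<bar>Z n \<omega>\<bar> < 1 / real (Suc k)"
    show "(\<lambda>n. Z n \<omega>) \<longlonglongrightarrow> 0"
    proof (rule tendstoI)
      fix e :: real assume "0 < e"
      then obtain k where "1 / real (Suc k) < e" using nat_approx_posE by blast
      then show "\<forall>\<^sub>F n in sequentially. dist (Z n \<omega>) 0 < e"
        using ev[rule_format, of k] by (auto elim!: eventually_mono)
    qed
  qed
qed

section \<open>Random signs and reflections\<close>

text \<open>A vector of independent signs has, unlike a Gaussian one, a deterministic norm. It can
therefore replace any fixed vector of the same norm when the law in question is invariant under
rotations.\<close>

definition rademacher :: "real measure" where
  "rademacher = distr (measure_pmf (pmf_of_set {-1, 1})) borel (\<lambda>x. x)"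

lemma prob_space_rademacher: "prob_space rademacher"
  unfolding rademacher_def by (rule prob_space.prob_space_distr) (auto intro: measure_pmf.prob_space_axioms)

lemma moment_bounded_rademacher: "moment_bounded (\<lambda>_. rademacher) 1 8 1"
proof (rule moment_bounded.intro)
  have int: "integrable rademacher f" if "f \<in> borel_measurable borel" for f :: "real \<Rightarrow> real"
    unfolding rademacher_def using that
    by (subst integrable_distr_eq) (auto intro: integrable_measure_pmf_finite)
  have lint: "(\<integral>y. f y \<partial>rademacher) = (f 1 + f (- 1)) / 2" if "f \<in> borel_measurable borel" for f :: "real \<Rightarrow> real"
    unfolding rademacher_def using that
    by (subst integral_distr) (auto simp: integral_pmf_of_set)
  show "prob_space rademacher" by (rule prob_space_rademacher)
  show "sets rademacher = sets borel" by (simp add: rademacher_def)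
  show "integrable rademacher (\<lambda>y. (1 + y\<^sup>2) powr (2 + 1))" by (rule int) measurable
  have "(\<lambda>y::real. (1 + y\<^sup>2) powr (2 + 1)) \<in> borel_measurable borel" by measurable
  from lint[OF this] show "(\<integral>y. (1 + y\<^sup>2) powr (2 + 1) \<partial>rademacher) \<le> 8"
    using powr_realpow[of 2 3] by simp
  show "(\<integral>y. y \<partial>rademacher) = 0" using lint[of "\<lambda>y. y"] by simp
  show "(\<integral>y. y\<^sup>2 \<partial>rademacher) = 1" using lint[of "\<lambda>y. y\<^sup>2"] by simp
qed auto

lemma AE_rademacher: "AE y in rademacher. y\<^sup>2 = 1"
  unfolding rademacher_def by (subst AE_distr_iff) (auto simp: AE_measure_pmf_iff)

text \<open>The Householder reflection \<open>V = I - 2 u u^T / |u|\<^sup>2\<close> with \<open>u = v - w\<close> exchanges \<open>v\<close> and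
\<open>w\<close>, since the two have equal norms.\<close>

lemma orth_mat_transitive_on_spheres:
  assumes v: "v \<in> carrier_vec k" and w: "w \<in> carrier_vec k" and eq: "v \<bullet> v = w \<bullet> w"
  shows "\<exists>V. orth_mat k V \<and> V *\<^sub>v v = w"
proof (cases "v = w")
  case True
  then show ?thesis using v by (intro exI[of _ "1\<^sub>m k"]) (simp add: orth_mat_def)
next
  case False
  define u where "u = (\<lambda>i. v $ i - w $ i)"
  define N where "N = (\<Sum>i<k. u i * u i)"
  obtain i0 where i0: "i0 < k" "u i0 \<noteq> 0"
    using False v w unfolding u_def by (metis carrier_vecD eq_iff_diff_eq_0 eq_vecI)
  have "0 < u i0 * u i0" using i0 by (auto simp: zero_less_mult_iff)
  also have "\<dots> \<le> N" unfolding N_def using i0 by (intro member_le_sum[of i0]) auto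
  finally have N: "0 < N" .
  define c where "c = 2 / N"
  have cN: "c * N = 2" using N by (simp add: c_def)
  define V where "V = mat k k (\<lambda>(i, j). (if i = j then 1 else 0) - c * u i * u j)"
  have "orth_mat k V"
    unfolding orth_mat_def
  proof (intro conjI eq_matI)
    fix i j assume "i < dim_row (1\<^sub>m k :: real mat)" "j < dim_col (1\<^sub>m k :: real mat)"
    then have ij: "i < k" "j < k" by auto
    have "(transpose_mat V * V) $$ (i, j) = (\<Sum>h<k. ((if h = i then 1 else 0) - c * u h * u i) * ((if h = j then 1 else 0) - c * u h * u j))"
      using ij by (simp add: V_def scalar_prod_def lessThan_atLeast0)
    also have "\<dots> = (\<Sum>h<k. (if h = i then (if i = j then 1 else 0) else 0) - (if h = i then c * u i * u j else 0)
        - (if h = j then c * u i * u j else 0) + c * c * u i * u j * (u h * u h))"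
      by (intro sum.cong) (auto simp: algebra_simps)
    also have "\<dots> = (\<Sum>h<k. if h = i then (if i = j then 1 else 0) else 0) - (\<Sum>h<k. if h = i then c * u i * u j else 0)
        - (\<Sum>h<k. if h = j then c * u i * u j else 0) + c * c * u i * u j * N"
      unfolding N_def by (simp only: sum.distrib sum_subtractf sum_distrib_left)
    also have "\<dots> = (if i = j then 1 else 0) - 2 * c * u i * u j + c * (c * N) * u i * u j"
      using ij by simp
    also have "\<dots> = (if i = j then 1 else 0)" by (simp add: cN)
    finally show "(transpose_mat V * V) $$ (i, j) = 1\<^sub>m k $$ (i, j)" using ij by simp
  qed (auto simp: V_def)
  moreover have "V *\<^sub>v v = w"
  proof (rule eq_vecI)
    have sv: "(\<Sum>j<k. v $ j * v $ j) = (\<Sum>j<k. w $ j * w $ j)"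
      using eq v w by (simp add: scalar_prod_def lessThan_atLeast0)
    have "2 * (\<Sum>j<k. u j * v $ j) = N"
    proof -
      have "N = (\<Sum>j<k. v $ j * v $ j) - 2 * (\<Sum>j<k. w $ j * v $ j) + (\<Sum>j<k. w $ j * w $ j)"
        unfolding N_def u_def by (simp add: algebra_simps sum.distrib sum_subtractf sum_distrib_left)
      also have "\<dots> = 2 * (\<Sum>j<k. u j * v $ j)"
        unfolding sv[symmetric] u_def by (simp add: algebra_simps sum_subtractf)
      finally show ?thesis by simp
    qed
    note uv = this
    fix i assume "i < dim_vec w"
    then have i: "i < k" using w by simp
    have "(V *\<^sub>v v) $ i = (\<Sum>j<k. ((if i = j then 1 else 0) - c * u i * u j) * v $ j)"
      using i v by (simp add: V_def scalar_prod_def lessThan_atLeast0)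
    also have "\<dots> = (\<Sum>j<k. (if j = i then v $ i else 0) - c * u i * (u j * v $ j))"
      by (intro sum.cong) (auto simp: algebra_simps)
    also have "\<dots> = v $ i - c * u i * (\<Sum>j<k. u j * v $ j)"
      using i by (simp only: sum_subtractf sum_distrib_left[symmetric]) simp
    also have "\<dots> = v $ i - u i * (c * N) / 2" by (simp add: uv[symmetric])
    also have "\<dots> = v $ i - u i" by (simp add: cN)
    also have "\<dots> = w $ i" by (simp add: u_def)
    finally show "(V *\<^sub>v v) $ i = w $ i" .
  qed (use w in \<open>auto simp: V_def\<close>)
  ultimately show ?thesis by blast
qed

section \<open>Concentration of the signal form\<close>

text \<open>The building blocks of training error and risk: powers of a resolvent, evaluated as a
quadratic form and as a trace.\<close>

definition resolvent_form :: "real mat \<Rightarrow> real \<Rightarrow> nat \<Rightarrow> real Matrix.vec \<Rightarrow> real" where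
  "resolvent_form S l k b = b \<bullet> (resolvent S l ^\<^sub>m k *\<^sub>v b)"

definition resolvent_trace :: "nat \<Rightarrow> real mat \<Rightarrow> real \<Rightarrow> nat \<Rightarrow> real" where
  "resolvent_trace d S l k = (\<Sum>i<d. (resolvent S l ^\<^sub>m k) $$ (i, i))"

lemma measurable_resolvent_form:
  assumes "S \<in> N \<rightarrow>\<^sub>M mat_borel d d" "b \<in> N \<rightarrow>\<^sub>M vec_borel d"
  shows "(\<lambda>w. resolvent_form (S w) l k (b w)) \<in> borel_measurable N"
  unfolding resolvent_form_def
  by (rule measurable_scalar_prod[OF assms(2)
        measurable_mult_mat_vec[OF measurable_pow_mat[OF measurable_resolvent[OF assms(1)]] assms(2)]])

lemma measurable_resolvent_trace:
  assumes "S \<in> N \<rightarrow>\<^sub>M mat_borel d d"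
  shows "(\<lambda>w. resolvent_trace d (S w) l k) \<in> borel_measurable N"
  unfolding resolvent_trace_def
  by (intro borel_measurable_sum measurable_mat_entry[OF measurable_pow_mat[OF measurable_resolvent[OF assms]]]) auto

lemma measurable_gram: "x \<in> N \<rightarrow>\<^sub>M mat_borel n p \<Longrightarrow> (\<lambda>w. transpose_mat (x w) * x w) \<in> N \<rightarrow>\<^sub>M mat_borel p p"
  by (intro measurable_mult_mat measurable_transpose_mat)

lemma measurable_cogram: "x \<in> N \<rightarrow>\<^sub>M mat_borel n p \<Longrightarrow> (\<lambda>w. x w * transpose_mat (x w)) \<in> N \<rightarrow>\<^sub>M mat_borel n n"
  by (intro measurable_mult_mat measurable_transpose_mat)

text \<open>The centring is the mean of the quadratic form over a uniformly distributed direction \<open>b\<close>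
of squared norm \<open>r\<^sup>2 n\<close>.\<close>

definition signal_dev :: "nat \<Rightarrow> nat \<Rightarrow> real \<Rightarrow> real mat \<Rightarrow> real Matrix.vec \<Rightarrow> nat \<Rightarrow> real \<Rightarrow> real" where
  "signal_dev n p r x b k l = resolvent_form (transpose_mat x * x) l k b / real n
     - r\<^sup>2 * resolvent_trace p (transpose_mat x * x) l k / real p"

text \<open>The centring is the mean of the quadratic form over centred independent entries of \<open>e\<close>
with variance \<open>\<sigma>\<^sup>2\<close>.\<close>

definition noise_dev :: "nat \<Rightarrow> real \<Rightarrow> real mat \<Rightarrow> real Matrix.vec \<Rightarrow> nat \<Rightarrow> real \<Rightarrow> real" where
  "noise_dev n \<sigma> x e k l = resolvent_form (x * transpose_mat x) l k e / real n
     - \<sigma>\<^sup>2 * resolvent_trace n (x * transpose_mat x) l k / real n"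

lemma measurable_signal_dev:
  assumes "x \<in> N \<rightarrow>\<^sub>M mat_borel n p" "b \<in> N \<rightarrow>\<^sub>M vec_borel p"
  shows "(\<lambda>w. signal_dev n p r (x w) (b w) k l) \<in> borel_measurable N"
  unfolding signal_dev_def using assms
  by (intro borel_measurable_diff borel_measurable_divide borel_measurable_times borel_measurable_const
      measurable_resolvent_form[OF measurable_gram] measurable_resolvent_trace[OF measurable_gram])

lemma measurable_noise_dev:
  assumes "x \<in> N \<rightarrow>\<^sub>M mat_borel n p" "e \<in> N \<rightarrow>\<^sub>M vec_borel n"
  shows "(\<lambda>w. noise_dev n \<sigma> (x w) (e w) k l) \<in> borel_measurable N"
  unfolding noise_dev_def using assms
  by (intro borel_measurable_diff borel_measurable_divide borel_measurable_times borel_measurable_const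
      measurable_resolvent_form[OF measurable_cogram] measurable_resolvent_trace[OF measurable_cogram])

lemma resolvent_form_gram:
  assumes svd: "is_svd n p x Q D W" and l: "0 < l" and b: "b \<in> carrier_vec p"
  shows "resolvent_form (transpose_mat x * x) l k b = (\<Sum>i<p. ((W *\<^sub>v b) $ i)\<^sup>2 / ((diag_entry D i)\<^sup>2 + l) ^ k)"
  unfolding resolvent_form_def resolvent_gram_pow[OF svd l] scalar_prod_spectral_mat[OF is_svd_carrier(6)[OF svd] b b]
  by (simp add: power2_eq_square)

lemma resolvent_form_cogram:
  assumes svd: "is_svd n p x Q D W" and l: "0 < l" and b: "b \<in> carrier_vec n"
  shows "resolvent_form (x * transpose_mat x) l k b = (\<Sum>i<n. ((Q *\<^sub>v b) $ i)\<^sup>2 / ((diag_entry D i)\<^sup>2 + l) ^ k)"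
  unfolding resolvent_form_def resolvent_cogram_pow[OF svd l] scalar_prod_spectral_mat[OF is_svd_carrier(5)[OF svd] b b]
  by (simp add: power2_eq_square)

lemma resolvent_trace_gram:
  assumes svd: "is_svd n p x Q D W" and l: "0 < l"
  shows "resolvent_trace p (transpose_mat x * x) l k = (\<Sum>i<p. 1 / ((diag_entry D i)\<^sup>2 + l) ^ k)"
  unfolding resolvent_trace_def resolvent_gram_pow[OF svd l] by (rule trace_spectral_mat[OF is_svd_carrier(6)[OF svd]])

lemma resolvent_trace_cogram:
  assumes svd: "is_svd n p x Q D W" and l: "0 < l"
  shows "resolvent_trace n (x * transpose_mat x) l k = (\<Sum>i<n. 1 / ((diag_entry D i)\<^sup>2 + l) ^ k)"
  unfolding resolvent_trace_def resolvent_cogram_pow[OF svd l] by (rule trace_spectral_mat[OF is_svd_carrier(5)[OF svd]])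

lemma scalar_prod_mult_mat_vec_quad:
  assumes "A \<in> carrier_mat d d" "b \<in> carrier_vec d"
  shows "b \<bullet> (A *\<^sub>v b) = quad (\<lambda>i j. A $$ (i, j)) d (\<lambda>i. b $ i)"
  using assms by (auto simp: quad_def scalar_prod_def lessThan_atLeast0 sum_distrib_left mult_ac intro!: sum.cong)

lemma resolvent_power_le:
  fixes d l :: real
  assumes "0 < l"
  shows "\<bar>1 / (d\<^sup>2 + l) ^ k\<bar> \<le> 1 / l ^ k"
proof -
  have "l ^ k \<le> (d\<^sup>2 + l) ^ k" using assms by (intro power_mono) auto
  moreover have "0 < d\<^sup>2 + l" using assms zero_le_power2[of d] by linarith
  ultimately show ?thesis using assms by (simp add: frac_le)
qed

lemma right_rot_invariant_rotate_signal:
  assumes inv: "right_rot_invariant M n p X"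
    and V: "orth_mat p V"
    and P: "Measurable.pred (mat_borel n p) P"
  shows "emeasure M {\<omega> \<in> space M. P (X \<omega> * V)} = emeasure M {\<omega> \<in> space M. P (X \<omega>)}"
proof -
  have X: "X \<in> M \<rightarrow>\<^sub>M mat_borel n p"
    and eq: "distr M (mat_borel n p) (\<lambda>\<omega>. X \<omega> * V) = distr M (mat_borel n p) X"
    using inv V by (auto simp: right_rot_invariant_def)
  have "(\<lambda>_. V) \<in> M \<rightarrow>\<^sub>M mat_borel p p"
    using orth_mat_carrier[OF V] by (intro measurable_const) simp
  then have XV: "(\<lambda>\<omega>. X \<omega> * V) \<in> M \<rightarrow>\<^sub>M mat_borel n p" by (rule measurable_mult_mat[OF X])
  have E: "{x \<in> space (mat_borel n p). P x} \<in> sets (mat_borel n p)" using P by (rule predE)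
  have "emeasure M {\<omega> \<in> space M. P (Y \<omega>)} = emeasure (distr M (mat_borel n p) Y) {x \<in> space (mat_borel n p). P x}"
    if Y: "Y \<in> M \<rightarrow>\<^sub>M mat_borel n p" for Y
    unfolding emeasure_distr[OF Y E] using measurable_space[OF Y]
    by (intro arg_cong[where f="emeasure M"]) (auto simp: vimage_def)
  from this[OF X] this[OF XV] eq show ?thesis by simp
qed

text \<open>Rotations act transitively on spheres, so by invariance of the law of \<open>X\<close> the probability
depends on \<open>b\<close> only through its norm. It is thus equal to its average over the vectors with
entries \<open>\<plusminus> r sqrt(n/p)\<close>. Exchanging the two integrals leaves, for each fixed design, the tail of
a quadratic form in independent signs, whose matrix has rows of norm at most \<open>1 / l ^ k\<close>.\<close>

lemma signal_tail_fixed: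
  assumes M: "prob_space M" and inv: "right_rot_invariant M n p X"
    and svd: "\<And>\<omega>. \<omega> \<in> space M \<Longrightarrow> is_svd n p (X \<omega>) (Q \<omega>) (D \<omega>) (W \<omega>)"
    and n: "1 \<le> n" and p: "1 \<le> p" and l: "0 < l" and \<delta>: "0 < \<delta>"
    and b: "b \<in> carrier_vec p" and norm_b: "b \<bullet> b = r\<^sup>2 * real n"
  shows "emeasure M {\<omega> \<in> space M. \<delta> \<le> \<bar>signal_dev n p r (X \<omega>) b k l\<bar>}
    \<le> ennreal (quad_tail_const 8 1 ((1 / l ^ k)\<^sup>2) (\<delta> / (r\<^sup>2 + 1)) * real p powr (- (1 + 1 / 2)))"
proof -
  interpret prob_space M by fact
  interpret R: moment_bounded "\<lambda>_. rademacher" 1 8 1 by (rule moment_bounded_rademacher)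
  define \<nu> where "\<nu> = Pi\<^sub>M {..<p} (\<lambda>_::nat. rademacher)"
  interpret \<nu>: prob_space \<nu> unfolding \<nu>_def by (intro prob_space_PiM prob_space_rademacher)
  interpret pair_sigma_finite \<nu> M by unfold_locales
  have X: "X \<in> M \<rightarrow>\<^sub>M mat_borel n p" using inv by (simp add: right_rot_invariant_def)
  define dev where "dev = (\<lambda>x b. signal_dev n p r x b k l)"
  \<comment> \<open>Scaled such that \<open>sv s\<close> has squared norm \<open>r\<^sup>2 n\<close> as soon as all entries of \<open>s\<close> are signs.\<close>
  define sv where "sv = (\<lambda>s. Matrix.vec p (\<lambda>i. r * sqrt (real n / real p) * s i))"
  define C where "C = ennreal (quad_tail_const 8 1 ((1 / l ^ k)\<^sup>2) (\<delta> / (r\<^sup>2 + 1)) * real p powr (- (1 + 1 / 2)))"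
  have rotate: "emeasure M {\<omega> \<in> space M. \<delta> \<le> \<bar>dev (X \<omega>) b'\<bar>} = emeasure M {\<omega> \<in> space M. \<delta> \<le> \<bar>dev (X \<omega>) b\<bar>}"
    if b': "b' \<in> carrier_vec p" "b' \<bullet> b' = b \<bullet> b" for b'
  proof -
    obtain V where V: "orth_mat p V" "V *\<^sub>v b' = b"
      using orth_mat_transitive_on_spheres[OF b'(1) b b'(2)] by blast
    have "dev (X \<omega> * V) b' = dev (X \<omega>) b" if w: "\<omega> \<in> space M" for \<omega>
    proof -
      note s = svd[OF w] and s' = is_svd_rotate[OF svd[OF w] V(1)]
      have "(W \<omega> * V) *\<^sub>v b' = W \<omega> *\<^sub>v b"
        using is_svd_carrier(3)[OF s] orth_mat_carrier[OF V(1)] b' V(2) by (simp add: assoc_mult_mat_vec)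
      then show ?thesis
        unfolding dev_def signal_dev_def resolvent_form_gram[OF s' l b'(1)] resolvent_form_gram[OF s l b]
          resolvent_trace_gram[OF s' l] resolvent_trace_gram[OF s l] by simp
    qed
    then have "{\<omega> \<in> space M. \<delta> \<le> \<bar>dev (X \<omega>) b\<bar>} = {\<omega> \<in> space M. \<delta> \<le> \<bar>dev (X \<omega> * V) b'\<bar>}" by auto
    moreover have "emeasure M {\<omega> \<in> space M. \<delta> \<le> \<bar>dev (X \<omega> * V) b'\<bar>} = emeasure M {\<omega> \<in> space M. \<delta> \<le> \<bar>dev (X \<omega>) b'\<bar>}"
    proof (rule right_rot_invariant_rotate_signal[OF inv V(1)])
      have "(\<lambda>x. dev x b') \<in> borel_measurable (mat_borel n p)"
        unfolding dev_def using b' by (intro measurable_signal_dev measurable_const measurable_ident) auto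
      then show "Measurable.pred (mat_borel n p) (\<lambda>x. \<delta> \<le> \<bar>dev x b'\<bar>)" by measurable
    qed
    ultimately show ?thesis by simp
  qed
  have sv: "sv \<in> \<nu> \<rightarrow>\<^sub>M vec_borel p"
    unfolding sv_def \<nu>_def
    by (rule measurable_vec_borelI) (auto intro!: borel_measurable_times measurable_component_singleton)
  define E where "E = {z \<in> space (\<nu> \<Otimes>\<^sub>M M). \<delta> \<le> \<bar>dev (X (snd z)) (sv (fst z))\<bar>}"
  have "(\<lambda>z. dev (X (snd z)) (sv (fst z))) \<in> borel_measurable (\<nu> \<Otimes>\<^sub>M M)"
    unfolding dev_def
    by (intro measurable_signal_dev measurable_compose[OF measurable_snd X] measurable_compose[OF measurable_fst sv])
  then have E: "E \<in> sets (\<nu> \<Otimes>\<^sub>M M)" unfolding E_def by measurable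
  have "AE s in \<nu>. \<forall>i\<in>{..<p}. (s i)\<^sup>2 = 1"
    unfolding \<nu>_def
    by (intro AE_ball_countable[THEN iffD2] ballI AE_PiM_component prob_space_rademacher AE_rademacher) auto
  then have "AE s in \<nu>. emeasure M (Pair s -` E) = emeasure M {\<omega> \<in> space M. \<delta> \<le> \<bar>dev (X \<omega>) b\<bar>}"
  proof (rule AE_mp, intro AE_I2 impI)
    fix s assume s: "s \<in> space \<nu>" "\<forall>i\<in>{..<p}. (s i)\<^sup>2 = 1"
    have "sv s \<bullet> sv s = (\<Sum>i<p. r\<^sup>2 * (real n / real p) * (s i)\<^sup>2)"
      by (simp add: sv_def scalar_prod_def lessThan_atLeast0 power2_eq_square[symmetric] power_mult_distrib)
    also have "\<dots> = b \<bullet> b" using s p norm_b by simp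
    finally have "emeasure M {\<omega> \<in> space M. \<delta> \<le> \<bar>dev (X \<omega>) (sv s)\<bar>} = emeasure M {\<omega> \<in> space M. \<delta> \<le> \<bar>dev (X \<omega>) b\<bar>}"
      by (intro rotate) (simp_all add: sv_def)
    moreover have "Pair s -` E = {\<omega> \<in> space M. \<delta> \<le> \<bar>dev (X \<omega>) (sv s)\<bar>}"
      using s by (auto simp: E_def space_pair_measure)
    ultimately show "emeasure M (Pair s -` E) = emeasure M {\<omega> \<in> space M. \<delta> \<le> \<bar>dev (X \<omega>) b\<bar>}" by simp
  qed
  then have "(\<integral>\<^sup>+s. emeasure M (Pair s -` E) \<partial>\<nu>) = (\<integral>\<^sup>+s. emeasure M {\<omega> \<in> space M. \<delta> \<le> \<bar>dev (X \<omega>) b\<bar>} \<partial>\<nu>)"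
    by (rule nn_integral_cong_AE)
  then have "emeasure M {\<omega> \<in> space M. \<delta> \<le> \<bar>dev (X \<omega>) b\<bar>} = (\<integral>\<^sup>+s. emeasure M (Pair s -` E) \<partial>\<nu>)"
    by (simp add: \<nu>.emeasure_space_1)
  also have "\<dots> = emeasure (\<nu> \<Otimes>\<^sub>M M) E" by (rule sigma_finite_measure.emeasure_pair_measure_alt[OF prob_space_imp_sigma_finite[OF M] E, symmetric])
  also have "\<dots> = (\<integral>\<^sup>+\<omega>. emeasure \<nu> ((\<lambda>s. (s, \<omega>)) -` E) \<partial>M)" by (rule emeasure_pair_measure_alt2[OF E])
  also have "\<dots> \<le> (\<integral>\<^sup>+\<omega>. C \<partial>M)"
  proof (rule nn_integral_mono)
    fix \<omega> assume w: "\<omega> \<in> space M"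
    note s = svd[OF w]
    define A where "A = (\<lambda>i j. (resolvent (transpose_mat (X \<omega>) * X \<omega>) l ^\<^sub>m k) $$ (i, j))"
    have A_eq: "A i j = spectral_mat p (W \<omega>) (\<lambda>i. 1 / ((diag_entry (D \<omega>) i)\<^sup>2 + l) ^ k) $$ (i, j)" for i j
      by (simp add: A_def resolvent_gram_pow[OF s l])
    \<comment> \<open>The divisor \<open>r\<^sup>2 + 1\<close> instead of \<open>r\<^sup>2\<close> covers \<open>r = 0\<close>.\<close>
    have "emeasure \<nu> ((\<lambda>s. (s, \<omega>)) -` E) \<le>
       emeasure \<nu> {s \<in> space \<nu>. \<delta> / (r\<^sup>2 + 1) * real p \<le> \<bar>quad_dev 1 A p s\<bar>}"
    proof (rule emeasure_mono)
      show "(\<lambda>s. (s, \<omega>)) -` E \<subseteq> {s \<in> space \<nu>. \<delta> / (r\<^sup>2 + 1) * real p \<le> \<bar>quad_dev 1 A p s\<bar>}"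
      proof safe
        fix t assume t: "(t, \<omega>) \<in> E"
        then show "t \<in> space \<nu>" by (simp add: E_def space_pair_measure)
        have "resolvent_form (transpose_mat (X \<omega>) * X \<omega>) l k (sv t) = quad A p (\<lambda>i. sv t $ i)"
          unfolding resolvent_form_def A_def
          by (rule scalar_prod_mult_mat_vec_quad) (simp_all add: resolvent_gram_pow[OF s l] sv_def)
        also have "\<dots> = (\<Sum>i<p. \<Sum>j<p. (r * sqrt (real n / real p))\<^sup>2 * (A i j * t i * t j))"
          unfolding quad_def by (intro sum.cong refl) (simp add: sv_def power2_eq_square mult_ac)
        also have "\<dots> = r\<^sup>2 * (real n / real p) * quad A p t"
          unfolding quad_def by (simp add: sum_distrib_left power_mult_distrib)
        finally have "dev (X \<omega>) (sv t) = r\<^sup>2 / real p * quad_dev 1 A p t"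
          using n p by (simp add: dev_def signal_dev_def quad_dev_def A_def resolvent_trace_def field_simps)
        then have "\<delta> \<le> r\<^sup>2 / real p * \<bar>quad_dev 1 A p t\<bar>"
          using t by (simp add: E_def abs_mult)
        also have "\<dots> \<le> (r\<^sup>2 + 1) / real p * \<bar>quad_dev 1 A p t\<bar>"
          by (intro mult_right_mono divide_right_mono) auto
        finally show "\<delta> / (r\<^sup>2 + 1) * real p \<le> \<bar>quad_dev 1 A p t\<bar>"
          using p by (simp add: field_simps add_pos_nonneg)
      qed
      show "{s \<in> space \<nu>. \<delta> / (r\<^sup>2 + 1) * real p \<le> \<bar>quad_dev 1 A p s\<bar>} \<in> sets \<nu>"
        unfolding \<nu>_def by measurable
    qed
    also have "\<dots> \<le> C"
      unfolding \<nu>_def C_def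
    proof (rule R.quad_dev_tail[OF _ _ p])
      show "A i j = A j i" if "i < p" "j < p" for i j
        using that unfolding A_eq by (rule spectral_mat_sym)
      show "(\<Sum>j<p. (A i j)\<^sup>2) \<le> (1 / l ^ k)\<^sup>2" if "i < p" for i
        unfolding A_eq using that by (intro spectral_mat_row_le is_svd_carrier(6)[OF s] resolvent_power_le l)
      show "0 < \<delta> / (r\<^sup>2 + 1)" using \<delta> by (simp add: add_nonneg_pos)
    qed
    finally show "emeasure \<nu> ((\<lambda>s. (s, \<omega>)) -` E) \<le> C" .
  qed
  also have "\<dots> = C" by (simp add: emeasure_space_1)
  finally show ?thesis unfolding C_def dev_def .
qed

section \<open>Concentration of noise and cross forms\<close>

text \<open>Beyond the dimension the marginal law of entry 0 is repeated, so that all members of the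
family satisfy the moment bounds.\<close>

definition noise_law :: "'w measure \<Rightarrow> nat \<Rightarrow> ('w \<Rightarrow> real Matrix.vec) \<Rightarrow> nat \<Rightarrow> real measure" where
  "noise_law M n \<epsilon> i = distr M borel (\<lambda>\<omega>. \<epsilon> \<omega> $ (if i < n then i else 0))"

text \<open>Translates moments of order \<open>4 + \<eta>\<close> into the weighted moment of \<^locale>\<open>moment_bounded\<close>; this is
where \<open>\<kappa>\<close> is required not to exceed \<open>\<eta> / 2\<close>.\<close>

lemma powr_one_plus_square_le:
  fixes y \<kappa> \<eta> :: real
  assumes \<kappa>: "0 < \<kappa>" "\<kappa> \<le> 1" "2 * \<kappa> \<le> \<eta>"
  shows "(1 + y\<^sup>2) powr (2 + \<kappa>) \<le> 16 + 8 * \<bar>y\<bar> powr (4 + \<eta>)"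
proof -
  have two: "2 powr (2 + \<kappa>) \<le> 8" using powr_mono[of "2 + \<kappa>" 3 2] \<kappa> powr_realpow[of 2 3] by simp
  show ?thesis
  proof (cases "\<bar>y\<bar> \<le> 1")
    case True
    then have "y\<^sup>2 \<le> 1" by (simp add: abs_square_le_1)
    then have "(1 + y\<^sup>2) powr (2 + \<kappa>) \<le> 2 powr (2 + \<kappa>)" using \<kappa> by (intro powr_mono2) auto
    then show ?thesis using two powr_ge_zero[of "\<bar>y\<bar>" "4 + \<eta>"] by linarith
  next
    case False
    then have "1 \<le> y\<^sup>2" using abs_square_le_1[of y] by (auto simp: abs_if not_le)
    then have "(1 + y\<^sup>2) powr (2 + \<kappa>) \<le> (2 * y\<^sup>2) powr (2 + \<kappa>)" using \<kappa> by (intro powr_mono2) auto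
    also have "\<dots> = 2 powr (2 + \<kappa>) * (y\<^sup>2) powr (2 + \<kappa>)" by (simp add: powr_mult)
    also have "(y\<^sup>2) powr (2 + \<kappa>) = \<bar>y\<bar> powr (4 + 2 * \<kappa>)"
      using powr_powr[of "\<bar>y\<bar>" 2 "2 + \<kappa>"] by simp
    also have "2 powr (2 + \<kappa>) * \<bar>y\<bar> powr (4 + 2 * \<kappa>) \<le> 8 * \<bar>y\<bar> powr (4 + \<eta>)"
      using two False \<kappa> by (intro mult_mono powr_mono) auto
    finally show ?thesis by simp
  qed
qed

text \<open>The exponent \<open>\<kappa>\<close> is the part of the spare moments \<open>\<eta>\<close> that enters the tail bounds.\<close>

locale noise =
  fixes M :: "'w measure" and n :: nat and \<epsilon> :: "'w \<Rightarrow> real Matrix.vec" and \<sigma> \<eta> \<kappa> K :: real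
  assumes M: "prob_space M" and n: "1 \<le> n"
    and \<epsilon>: "\<epsilon> \<in> M \<rightarrow>\<^sub>M vec_borel n"
    and indep: "prob_space.indep_vars M (\<lambda>_. borel) (\<lambda>i \<omega>. \<epsilon> \<omega> $ i) {..<n}"
    and mean: "\<And>i. i < n \<Longrightarrow> (\<integral>\<omega>. \<epsilon> \<omega> $ i \<partial>M) = 0"
    and variance: "\<And>i. i < n \<Longrightarrow> (\<integral>\<omega>. (\<epsilon> \<omega> $ i)\<^sup>2 \<partial>M) = \<sigma>\<^sup>2"
    and integrable: "\<And>i. i < n \<Longrightarrow> integrable M (\<lambda>\<omega>. \<bar>\<epsilon> \<omega> $ i\<bar> powr (4 + \<eta>))"
    and moment: "\<And>i. i < n \<Longrightarrow> (\<integral>\<omega>. \<bar>\<epsilon> \<omega> $ i\<bar> powr (4 + \<eta>) \<partial>M) \<le> K"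
    and \<kappa>: "0 < \<kappa>" "\<kappa> \<le> 1" "2 * \<kappa> \<le> \<eta>"
begin

lemma moment_bounded_noise_law: "moment_bounded (noise_law M n \<epsilon>) (\<sigma>\<^sup>2) (16 + 8 * K) \<kappa>"
proof (rule moment_bounded.intro)
  interpret prob_space M by (rule M)
  fix i
  define j where "j = (if i < n then i else 0)"
  have j: "j < n" using n by (auto simp: j_def)
  have [measurable]: "(\<lambda>\<omega>. \<epsilon> \<omega> $ j) \<in> borel_measurable M" by (rule measurable_vec_entry[OF \<epsilon> j])
  have law: "noise_law M n \<epsilon> i = distr M borel (\<lambda>\<omega>. \<epsilon> \<omega> $ j)" by (simp add: noise_law_def j_def)
  show "prob_space (noise_law M n \<epsilon> i)" unfolding law by (rule prob_space_distr) measurable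
  show "sets (noise_law M n \<epsilon> i) = sets borel" by (simp add: law)
  have int: "integrable M (\<lambda>\<omega>. (1 + (\<epsilon> \<omega> $ j)\<^sup>2) powr (2 + \<kappa>))"
  proof (rule Bochner_Integration.integrable_bound)
    show "integrable M (\<lambda>\<omega>. 16 + 8 * \<bar>\<epsilon> \<omega> $ j\<bar> powr (4 + \<eta>))"
      using integrable[OF j] by simp
    show "AE \<omega> in M. norm ((1 + (\<epsilon> \<omega> $ j)\<^sup>2) powr (2 + \<kappa>)) \<le> norm (16 + 8 * \<bar>\<epsilon> \<omega> $ j\<bar> powr (4 + \<eta>))"
      using powr_one_plus_square_le[OF \<kappa>] by (intro AE_I2) (auto intro: order_trans[OF _ abs_ge_self])
  qed measurable
  show "integrable (noise_law M n \<epsilon> i) (\<lambda>y. (1 + y\<^sup>2) powr (2 + \<kappa>))"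
    unfolding law using int by (subst integrable_distr_eq) auto
  have "(\<integral>y. (1 + y\<^sup>2) powr (2 + \<kappa>) \<partial>noise_law M n \<epsilon> i) = (\<integral>\<omega>. (1 + (\<epsilon> \<omega> $ j)\<^sup>2) powr (2 + \<kappa>) \<partial>M)"
    unfolding law by (rule integral_distr) measurable
  also have "\<dots> \<le> (\<integral>\<omega>. 16 + 8 * \<bar>\<epsilon> \<omega> $ j\<bar> powr (4 + \<eta>) \<partial>M)"
    using int integrable[OF j] powr_one_plus_square_le[OF \<kappa>] by (intro integral_mono) auto
  also have "\<dots> = 16 + 8 * (\<integral>\<omega>. \<bar>\<epsilon> \<omega> $ j\<bar> powr (4 + \<eta>) \<partial>M)"
    using integrable[OF j] by (simp add: prob_space)
  also have "\<dots> \<le> 16 + 8 * K" using moment[OF j] by simp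
  finally show "(\<integral>y. (1 + y\<^sup>2) powr (2 + \<kappa>) \<partial>noise_law M n \<epsilon> i) \<le> 16 + 8 * K" .
  have "(\<integral>y. y \<partial>noise_law M n \<epsilon> i) = (\<integral>\<omega>. \<epsilon> \<omega> $ j \<partial>M)"
    unfolding law by (rule integral_distr) measurable
  then show "(\<integral>y. y \<partial>noise_law M n \<epsilon> i) = 0" using mean[OF j] by simp
  have "(\<integral>y. y\<^sup>2 \<partial>noise_law M n \<epsilon> i) = (\<integral>\<omega>. (\<epsilon> \<omega> $ j)\<^sup>2 \<partial>M)"
    unfolding law by (rule integral_distr) measurable
  then show "(\<integral>y. y\<^sup>2 \<partial>noise_law M n \<epsilon> i) = \<sigma>\<^sup>2" using variance[OF j] by simp
qed (use \<kappa> in auto)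

lemma emeasure_noise:
  assumes R: "Measurable.pred (Pi\<^sub>M {..<n} (noise_law M n \<epsilon>)) R"
  shows "emeasure M {\<omega> \<in> space M. R (\<lambda>i\<in>{..<n}. \<epsilon> \<omega> $ i)}
    = emeasure (Pi\<^sub>M {..<n} (noise_law M n \<epsilon>)) {x \<in> space (Pi\<^sub>M {..<n} (noise_law M n \<epsilon>)). R x}"
proof -
  interpret prob_space M by (rule M)
  let ?P = "Pi\<^sub>M {..<n} (noise_law M n \<epsilon>)"
  have meas: "(\<lambda>\<omega>. \<epsilon> \<omega> $ i) \<in> borel_measurable M" if "i < n" for i
    by (rule measurable_vec_entry[OF \<epsilon> that])
  have "{..<n} \<noteq> {}" using n by (simp add: lessThan_empty_iff)
  then have "distr M (\<Pi>\<^sub>M i\<in>{..<n}. borel) (\<lambda>\<omega>. \<lambda>i\<in>{..<n}. \<epsilon> \<omega> $ i) = (\<Pi>\<^sub>M i\<in>{..<n}. distr M borel (\<lambda>\<omega>. \<epsilon> \<omega> $ i))"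
    by (rule indep_vars_iff_distr_eq_PiM'[THEN iffD1, OF _ _ indep]) (use meas in auto)
  also have "\<dots> = ?P" by (intro PiM_cong) (auto simp: noise_law_def)
  finally have law: "distr M (\<Pi>\<^sub>M i\<in>{..<n}. borel) (\<lambda>\<omega>. \<lambda>i\<in>{..<n}. \<epsilon> \<omega> $ i) = ?P" .
  have sets: "sets ?P = sets (\<Pi>\<^sub>M i\<in>{..<n}. (borel :: real measure))"
    by (intro sets_PiM_cong) (auto simp: noise_law_def)
  have space: "space ?P = space (\<Pi>\<^sub>M i\<in>{..<n}. (borel :: real measure))"
    by (rule sets_eq_imp_space_eq[OF sets])
  have T: "(\<lambda>\<omega>. \<lambda>i\<in>{..<n}. \<epsilon> \<omega> $ i) \<in> M \<rightarrow>\<^sub>M (\<Pi>\<^sub>M i\<in>{..<n}. borel)"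
    using meas by (intro measurable_restrict) auto
  have E: "{x \<in> space ?P. R x} \<in> sets (\<Pi>\<^sub>M i\<in>{..<n}. (borel :: real measure))"
    using R unfolding sets[symmetric] by (rule predE)
  have "emeasure ?P {x \<in> space ?P. R x} = emeasure M ((\<lambda>\<omega>. \<lambda>i\<in>{..<n}. \<epsilon> \<omega> $ i) -` {x \<in> space ?P. R x} \<inter> space M)"
    by (subst law[symmetric], rule emeasure_distr[OF T E])
  also have "(\<lambda>\<omega>. \<lambda>i\<in>{..<n}. \<epsilon> \<omega> $ i) -` {x \<in> space ?P. R x} \<inter> space M = {\<omega> \<in> space M. R (\<lambda>i\<in>{..<n}. \<epsilon> \<omega> $ i)}"
    unfolding space using measurable_space[OF T] by auto
  finally show ?thesis by simp
qed

text \<open>For a fixed design the rows of the powers of \<open>(X X^T + l)^-1\<close> are bounded by \<open>1 / l ^ k\<close>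
whatever the singular values, so the bound is uniform over designs.\<close>

lemma noise_tail_fixed:
  assumes svd: "is_svd n p x Q D W" and l: "0 < l" and \<delta>: "0 < \<delta>"
  shows "emeasure M {\<omega> \<in> space M. \<delta> \<le> \<bar>noise_dev n \<sigma> x (\<epsilon> \<omega>) k l\<bar>}
    \<le> ennreal (quad_tail_const (16 + 8 * K) \<kappa> ((1 / l ^ k)\<^sup>2) \<delta> * real n powr (- (1 + \<kappa> / 2)))"
proof -
  interpret N: moment_bounded "noise_law M n \<epsilon>" "\<sigma>\<^sup>2" "16 + 8 * K" \<kappa> by (rule moment_bounded_noise_law)
  let ?P = "Pi\<^sub>M {..<n} (noise_law M n \<epsilon>)"
  define A where "A = (\<lambda>i j. (resolvent (x * transpose_mat x) l ^\<^sub>m k) $$ (i, j))"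
  have A_eq: "A i j = spectral_mat n Q (\<lambda>i. 1 / ((diag_entry D i)\<^sup>2 + l) ^ k) $$ (i, j)" for i j
    by (simp add: A_def resolvent_cogram_pow[OF svd l])
  have "noise_dev n \<sigma> x (\<epsilon> \<omega>) k l = quad_dev (\<sigma>\<^sup>2) A n (\<lambda>i\<in>{..<n}. \<epsilon> \<omega> $ i) / real n" if "\<omega> \<in> space M" for \<omega>
  proof -
    have "resolvent_form (x * transpose_mat x) l k (\<epsilon> \<omega>) = quad A n (\<lambda>i. \<epsilon> \<omega> $ i)"
      unfolding resolvent_form_def A_def
      by (rule scalar_prod_mult_mat_vec_quad)
         (use carrier_of_measurable_vec[OF \<epsilon> that] in \<open>simp_all add: resolvent_cogram_pow[OF svd l]\<close>)
    also have "\<dots> = quad A n (\<lambda>i\<in>{..<n}. \<epsilon> \<omega> $ i)" unfolding quad_def by (intro sum.cong) auto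
    finally show ?thesis by (simp add: noise_dev_def quad_dev_def A_def resolvent_trace_def diff_divide_distrib)
  qed
  then have "{\<omega> \<in> space M. \<delta> \<le> \<bar>noise_dev n \<sigma> x (\<epsilon> \<omega>) k l\<bar>}
     = {\<omega> \<in> space M. \<delta> * real n \<le> \<bar>quad_dev (\<sigma>\<^sup>2) A n (\<lambda>i\<in>{..<n}. \<epsilon> \<omega> $ i)\<bar>}"
    using n by (auto simp: abs_divide pos_le_divide_eq)
  also have "emeasure M \<dots> = emeasure ?P {x \<in> space ?P. \<delta> * real n \<le> \<bar>quad_dev (\<sigma>\<^sup>2) A n x\<bar>}"
    by (rule emeasure_noise) measurable
  also have "\<dots> \<le> ennreal (quad_tail_const (16 + 8 * K) \<kappa> ((1 / l ^ k)\<^sup>2) \<delta> * real n powr (- (1 + \<kappa> / 2)))"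
  proof (rule N.quad_dev_tail[OF _ _ n \<delta>])
    show "A i j = A j i" if "i < n" "j < n" for i j
      using that unfolding A_eq by (rule spectral_mat_sym)
    show "(\<Sum>j<n. (A i j)\<^sup>2) \<le> (1 / l ^ k)\<^sup>2" if "i < n" for i
      unfolding A_eq using that by (intro spectral_mat_row_le is_svd_carrier(5)[OF svd] resolvent_power_le l)
  qed
  finally show ?thesis .
qed

lemma noise_linear_tail_fixed:
  assumes c: "c \<in> carrier_vec n" "c \<bullet> c \<le> a * real n" and \<delta>: "0 < \<delta>"
  shows "emeasure M {\<omega> \<in> space M. \<delta> \<le> \<bar>\<epsilon> \<omega> \<bullet> c / real n\<bar>}
    \<le> ennreal (4 * (16 + 8 * K)\<^sup>2 * a\<^sup>2 / \<delta> ^ 4 * real n powr - 2)"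
proof -
  interpret N: moment_bounded "noise_law M n \<epsilon>" "\<sigma>\<^sup>2" "16 + 8 * K" \<kappa> by (rule moment_bounded_noise_law)
  let ?P = "Pi\<^sub>M {..<n} (noise_law M n \<epsilon>)"
  have "\<epsilon> \<omega> \<bullet> c = lin (\<lambda>i. c $ i) n (\<lambda>i\<in>{..<n}. \<epsilon> \<omega> $ i)" for \<omega>
    using c by (auto simp: lin_def scalar_prod_def lessThan_atLeast0 mult.commute intro!: sum.cong)
  then have "{\<omega> \<in> space M. \<delta> \<le> \<bar>\<epsilon> \<omega> \<bullet> c / real n\<bar>}
     = {\<omega> \<in> space M. \<delta> * real n \<le> \<bar>lin (\<lambda>i. c $ i) n (\<lambda>i\<in>{..<n}. \<epsilon> \<omega> $ i)\<bar>}"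
    using n by (auto simp: field_simps abs_divide)
  also have "emeasure M \<dots> = emeasure ?P {x \<in> space ?P. \<delta> * real n \<le> \<bar>lin (\<lambda>i. c $ i) n x\<bar>}"
    by (rule emeasure_noise) measurable
  also have "\<dots> \<le> ennreal (4 * (16 + 8 * K)\<^sup>2 * a\<^sup>2 / \<delta> ^ 4 * real n powr - 2)"
    by (rule N.lin_tail[OF n \<delta>])
       (use c in \<open>simp add: scalar_prod_def lessThan_atLeast0 power2_eq_square\<close>)
  finally show ?thesis .
qed

end

text \<open>The signal is frozen by independence, and \<open>p\<close> being comparable to \<open>n\<close> turns the tail in
\<open>p\<close> into a tail in \<open>n\<close>.\<close>

lemma AE_signal_concentration:
  assumes M: "prob_space M" and p: "\<And>n. 0 < p n"
    and ratio: "(\<lambda>n. real (p n) / real n) \<longlonglongrightarrow> \<gamma>" "0 < \<gamma>"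
    and inv: "\<And>n. right_rot_invariant M n (p n) (X n)"
    and svd: "\<And>n \<omega>. \<omega> \<in> space M \<Longrightarrow> is_svd n (p n) (X n \<omega>) (Q n \<omega>) (D n \<omega>) (W n \<omega>)"
    and ind: "\<And>n. indep_rv M (vec_borel (p n)) (\<beta> n) (mat_borel n (p n)) (X n)"
    and norm: "\<And>n \<omega>. \<omega> \<in> space M \<Longrightarrow> \<beta> n \<omega> \<bullet> \<beta> n \<omega> = r\<^sup>2 * real n"
    and l: "0 < l"
  shows "AE \<omega> in M. (\<lambda>n. signal_dev n (p n) r (X n \<omega>) (\<beta> n \<omega>) k l) \<longlonglongrightarrow> 0"
proof (rule AE_tendsto_zero_of_polynomial_tails[OF M, where q="1 + 1 / 2"])
  have X: "X n \<in> M \<rightarrow>\<^sub>M mat_borel n (p n)" and \<beta>: "\<beta> n \<in> M \<rightarrow>\<^sub>M vec_borel (p n)" for n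
    using ind[of n] by (auto simp: indep_rv_def)
  show "(\<lambda>\<omega>. signal_dev n (p n) r (X n \<omega>) (\<beta> n \<omega>) k l) \<in> borel_measurable M" for n
    by (rule measurable_signal_dev[OF X \<beta>])
  fix \<delta> :: real assume \<delta>: "0 < \<delta>"
  define T where "T = quad_tail_const 8 1 ((1 / l ^ k)\<^sup>2) (\<delta> / (r\<^sup>2 + 1))"
  have T0: "0 \<le> T" by (simp add: T_def quad_tail_const_def quad_step_const_def)
  have p_ge: "\<forall>\<^sub>F n in sequentially. 1 \<le> n \<and> \<gamma> / 2 * real n \<le> real (p n)"
  proof -
    have "\<forall>\<^sub>F n in sequentially. \<gamma> / 2 < real (p n) / real n"
      using ratio by (intro order_tendstoD(1)[OF ratio(1)]) simp
    then show ?thesis using eventually_ge_at_top[of 1]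
      by eventually_elim (auto simp: field_simps)
  qed
  show "\<exists>T\<ge>0. \<forall>\<^sub>F n in sequentially. emeasure M {\<omega> \<in> space M. \<delta> \<le> \<bar>signal_dev n (p n) r (X n \<omega>) (\<beta> n \<omega>) k l\<bar>}
      \<le> ennreal (T * real n powr (- (1 + 1 / 2)))"
  proof (intro exI[of _ "T * (\<gamma> / 2) powr (- (1 + 1 / 2))"] conjI)
    show "\<forall>\<^sub>F n in sequentially. emeasure M {\<omega> \<in> space M. \<delta> \<le> \<bar>signal_dev n (p n) r (X n \<omega>) (\<beta> n \<omega>) k l\<bar>}
      \<le> ennreal (T * (\<gamma> / 2) powr (- (1 + 1 / 2)) * real n powr (- (1 + 1 / 2)))"
      using p_ge
    proof eventually_elim
      case (elim n)
      have "emeasure M {\<omega> \<in> space M. \<delta> \<le> \<bar>signal_dev n (p n) r (X n \<omega>) (\<beta> n \<omega>) k l\<bar>}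
        \<le> ennreal (T * real (p n) powr (- (1 + 1 / 2)))"
      proof (rule emeasure_le_of_independent_sections[OF M ind, where P="\<lambda>b x. \<delta> \<le> \<bar>signal_dev n (p n) r x b k l\<bar>"])
        have "(\<lambda>z. signal_dev n (p n) r (snd z) (fst z) k l) \<in> borel_measurable (vec_borel (p n) \<Otimes>\<^sub>M mat_borel n (p n))"
          by (intro measurable_signal_dev measurable_fst measurable_snd)
        then show "Measurable.pred (vec_borel (p n) \<Otimes>\<^sub>M mat_borel n (p n)) (\<lambda>z. \<delta> \<le> \<bar>signal_dev n (p n) r (snd z) (fst z) k l\<bar>)"
          by measurable
        fix \<omega>' assume w: "\<omega>' \<in> space M"
        show "emeasure M {\<omega> \<in> space M. \<delta> \<le> \<bar>signal_dev n (p n) r (X n \<omega>) (\<beta> n \<omega>') k l\<bar>}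
          \<le> ennreal (T * real (p n) powr (- (1 + 1 / 2)))"
          unfolding T_def using elim p[of n]
          by (intro signal_tail_fixed[OF M inv svd _ _ l \<delta> carrier_of_measurable_vec[OF \<beta> w] norm[OF w]]) auto
      qed
      also have "\<dots> \<le> ennreal (T * ((\<gamma> / 2) powr (- (1 + 1 / 2)) * real n powr (- (1 + 1 / 2))))"
      proof (intro ennreal_leI mult_left_mono T0)
        have "real (p n) powr (- (1 + 1 / 2)) \<le> (\<gamma> / 2 * real n) powr (- (1 + 1 / 2))"
          using elim ratio by (intro powr_mono2') auto
        also have "\<dots> = (\<gamma> / 2) powr (- (1 + 1 / 2)) * real n powr (- (1 + 1 / 2))"
          by (rule powr_mult)
        finally show "real (p n) powr (- (1 + 1 / 2)) \<le> (\<gamma> / 2) powr (- (1 + 1 / 2)) * real n powr (- (1 + 1 / 2))" .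
      qed
      finally show ?case by (simp only: mult.assoc)
    qed
  qed (use T0 in simp)
qed simp

text \<open>The design is frozen by independence, since the noise bound is the same for every design.\<close>

lemma AE_noise_concentration:
  assumes M: "prob_space M"
    and noise: "\<And>n. 1 \<le> n \<Longrightarrow> noise M n (\<epsilon> n) \<sigma> \<eta> \<kappa> K"
    and \<epsilon>: "\<And>n. \<epsilon> n \<in> M \<rightarrow>\<^sub>M vec_borel n"
    and svd: "\<And>n \<omega>. \<omega> \<in> space M \<Longrightarrow> is_svd n (p n) (X n \<omega>) (Q n \<omega>) (D n \<omega>) (W n \<omega>)"
    and ind: "\<And>n. indep_rv M (mat_borel n (p n)) (X n) (vec_borel n) (\<epsilon> n)"
    and l: "0 < l"
  shows "AE \<omega> in M. (\<lambda>n. noise_dev n \<sigma> (X n \<omega>) (\<epsilon> n \<omega>) k l) \<longlonglongrightarrow> 0"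
proof (rule AE_tendsto_zero_of_polynomial_tails[OF M, where q="1 + \<kappa> / 2"])
  have X: "X n \<in> M \<rightarrow>\<^sub>M mat_borel n (p n)" for n
    using ind[of n] by (auto simp: indep_rv_def)
  show "(\<lambda>\<omega>. noise_dev n \<sigma> (X n \<omega>) (\<epsilon> n \<omega>) k l) \<in> borel_measurable M" for n
    by (rule measurable_noise_dev[OF X \<epsilon>])
  show "1 < 1 + \<kappa> / 2" using noise.\<kappa>(1)[OF noise[of 1]] by simp
  fix \<delta> :: real assume \<delta>: "0 < \<delta>"
  define T where "T = \<bar>quad_tail_const (16 + 8 * K) \<kappa> ((1 / l ^ k)\<^sup>2) \<delta>\<bar>"
  have "\<forall>\<^sub>F n in sequentially. emeasure M {\<omega> \<in> space M. \<delta> \<le> \<bar>noise_dev n \<sigma> (X n \<omega>) (\<epsilon> n \<omega>) k l\<bar>}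
      \<le> ennreal (T * real n powr (- (1 + \<kappa> / 2)))"
    using eventually_ge_at_top[of 1]
  proof eventually_elim
    case (elim n)
    show ?case
    proof (rule emeasure_le_of_independent_sections[OF M ind, where P="\<lambda>x e. \<delta> \<le> \<bar>noise_dev n \<sigma> x e k l\<bar>"])
      have "(\<lambda>z. noise_dev n \<sigma> (fst z) (snd z) k l) \<in> borel_measurable (mat_borel n (p n) \<Otimes>\<^sub>M vec_borel n)"
        by (intro measurable_noise_dev[where p="p n"] measurable_fst measurable_snd)
      then show "Measurable.pred (mat_borel n (p n) \<Otimes>\<^sub>M vec_borel n) (\<lambda>z. \<delta> \<le> \<bar>noise_dev n \<sigma> (fst z) (snd z) k l\<bar>)"
        by measurable
      fix \<omega>' assume w: "\<omega>' \<in> space M"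
      show "emeasure M {\<omega> \<in> space M. \<delta> \<le> \<bar>noise_dev n \<sigma> (X n \<omega>') (\<epsilon> n \<omega>) k l\<bar>} \<le> ennreal (T * real n powr (- (1 + \<kappa> / 2)))"
        by (rule order_trans[OF noise.noise_tail_fixed[OF noise[OF elim] svd[OF w] l \<delta>]])
           (auto simp: T_def intro!: ennreal_leI mult_right_mono)
    qed
  qed
  moreover have "0 \<le> T" by (simp add: T_def)
  ultimately show "\<exists>T\<ge>0. \<forall>\<^sub>F n in sequentially. emeasure M {\<omega> \<in> space M. \<delta> \<le> \<bar>noise_dev n \<sigma> (X n \<omega>) (\<epsilon> n \<omega>) k l\<bar>}
      \<le> ennreal (T * real n powr (- (1 + \<kappa> / 2)))" by blast
qed

definition cross_form :: "real mat \<Rightarrow> real \<Rightarrow> real Matrix.vec \<Rightarrow> real Matrix.vec \<Rightarrow> real" where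
  "cross_form x l b e = e \<bullet> (x *\<^sub>v (resolvent (transpose_mat x * x) l ^\<^sub>m 2 *\<^sub>v b))"

lemma cross_form_svd:
  assumes svd: "is_svd n p x Q D W" and l: "0 < l" and b: "b \<in> carrier_vec p" and e: "e \<in> carrier_vec n"
  shows "cross_form x l b e =
    (\<Sum>i<n. if i < p then diag_entry D i * (W *\<^sub>v b) $ i * (Q *\<^sub>v e) $ i / ((diag_entry D i)\<^sup>2 + l)\<^sup>2 else 0)"
proof -
  note c = is_svd_carrier[OF svd]
  let ?f = "\<lambda>i. 1 / ((diag_entry D i)\<^sup>2 + l)\<^sup>2"
  define u where "u = spectral_mat p W ?f *\<^sub>v b"
  have u: "u \<in> carrier_vec p" using b unfolding u_def by (intro mult_mat_vec_carrier) auto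
  have "cross_form x l b e = e \<bullet> (x *\<^sub>v u)" by (simp add: cross_form_def resolvent_gram_pow[OF svd l] u_def)
  also have "\<dots> = (Q *\<^sub>v e) \<bullet> (Q *\<^sub>v (x *\<^sub>v u))"
    using c u e by (subst orth_mat_scalar_prod[OF c(5)]) auto
  also have "\<dots> = (\<Sum>i<n. (Q *\<^sub>v e) $ i * (Q *\<^sub>v (x *\<^sub>v u)) $ i)"
    using c by (simp add: scalar_prod_def lessThan_atLeast0)
  also have "\<dots> = (\<Sum>i<n. if i < p then diag_entry D i * (W *\<^sub>v b) $ i * (Q *\<^sub>v e) $ i / ((diag_entry D i)\<^sup>2 + l)\<^sup>2 else 0)"
    using is_svd_apply[OF svd u] spectral_mat_apply[OF c(6) b, of _ ?f] unfolding u_def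
    by (intro sum.cong refl) (auto simp: mult_ac)
  finally show ?thesis .
qed

text \<open>In singular coordinates the squared factor is \<open>d\<^sup>2 / (d\<^sup>2 + l)^4 \<le> 1 / l^3\<close>. Hence, as a
linear form in the noise, the cross form has coefficients of squared norm \<open>O(n)\<close> when
\<open>|b|\<^sup>2 = O(n)\<close>, uniformly over designs.\<close>

lemma norm_resolvent_signal_le:
  assumes svd: "is_svd n p x Q D W" and l: "0 < l" and b: "b \<in> carrier_vec p"
  defines "c \<equiv> x *\<^sub>v (resolvent (transpose_mat x * x) l ^\<^sub>m 2 *\<^sub>v b)"
  shows "c \<bullet> c \<le> (b \<bullet> b) / l ^ 3"
proof -
  note cc = is_svd_carrier[OF svd]
  let ?f = "\<lambda>i. 1 / ((diag_entry D i)\<^sup>2 + l)\<^sup>2"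
  define u where "u = spectral_mat p W ?f *\<^sub>v b"
  have u: "u \<in> carrier_vec p" using b unfolding u_def by (intro mult_mat_vec_carrier) auto
  have c: "c = x *\<^sub>v u" unfolding c_def resolvent_gram_pow[OF svd l] u_def by simp
  let ?d = "diag_entry D" and ?w = "\<lambda>i. (W *\<^sub>v b) $ i"
  have le: "(?d i * (?f i * ?w i))\<^sup>2 \<le> (?w i)\<^sup>2 / l ^ 3" for i
  proof -
    let ?s = "(?d i)\<^sup>2 + l"
    have s: "l \<le> ?s" "(?d i)\<^sup>2 \<le> ?s" "0 < ?s" using l zero_le_power2[of "?d i"] by linarith+
    have "(?d i)\<^sup>2 * l ^ 3 \<le> ?s * ?s ^ 3" using s l by (intro mult_mono power_mono) auto
    moreover have "?s * ?s ^ 3 = ?s ^ 4" by (simp add: power_Suc[symmetric] del: power_Suc)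
    moreover have "t / v \<le> 1 / u" if "t * u \<le> v" "0 < v" "0 < u" for t u v :: real
      using that by (simp add: field_simps)
    ultimately have "(?d i)\<^sup>2 / ?s ^ 4 \<le> 1 / l ^ 3" using s(3) l zero_less_power by metis
    then have "(?d i)\<^sup>2 / ?s ^ 4 * (?w i)\<^sup>2 \<le> 1 / l ^ 3 * (?w i)\<^sup>2" by (rule mult_right_mono) simp
    then show ?thesis by (simp add: power_mult_distrib power_divide)
  qed
  have "c \<bullet> c = (Q *\<^sub>v (x *\<^sub>v u)) \<bullet> (Q *\<^sub>v (x *\<^sub>v u))"
    unfolding c using cc u by (subst orth_mat_scalar_prod[OF cc(5)]) auto
  also have "\<dots> = (\<Sum>i<n. ((Q *\<^sub>v (x *\<^sub>v u)) $ i)\<^sup>2)"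
    using cc by (simp add: scalar_prod_def lessThan_atLeast0 power2_eq_square)
  also have "\<dots> = (\<Sum>i<n. if i < p then (?d i * (?f i * ?w i))\<^sup>2 else 0)"
    using is_svd_apply[OF svd u] spectral_mat_apply[OF cc(6) b, of _ ?f] unfolding u_def
    by (intro sum.cong refl) auto
  also have "\<dots> = (\<Sum>i\<in>{..<n} \<inter> {..<p}. (?d i * (?f i * ?w i))\<^sup>2)"
    by (subst sum.inter_restrict) simp_all
  also have "\<dots> \<le> (\<Sum>i\<in>{..<n} \<inter> {..<p}. (?w i)\<^sup>2 / l ^ 3)" by (intro sum_mono le)
  also have "\<dots> \<le> (\<Sum>i<p. (?w i)\<^sup>2 / l ^ 3)" using l by (intro sum_mono2) auto
  also have "\<dots> = ((W *\<^sub>v b) \<bullet> (W *\<^sub>v b)) / l ^ 3"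
    using cc by (simp add: scalar_prod_def lessThan_atLeast0 power2_eq_square sum_divide_distrib)
  also have "\<dots> = (b \<bullet> b) / l ^ 3" by (simp add: orth_mat_scalar_prod[OF cc(6) b b])
  finally show ?thesis .
qed

text \<open>Freezing first the signal and then the design leaves a linear form in the noise.\<close>

lemma AE_cross_concentration:
  assumes M: "prob_space M"
    and noise: "\<And>n. 1 \<le> n \<Longrightarrow> noise M n (\<epsilon> n) \<sigma> \<eta> \<kappa> K"
    and svd: "\<And>n \<omega>. \<omega> \<in> space M \<Longrightarrow> is_svd n (p n) (X n \<omega>) (Q n \<omega>) (D n \<omega>) (W n \<omega>)"
    and ind: "\<And>n. indep_rv M (mat_borel n (p n)) (X n) (vec_borel n) (\<epsilon> n)"
    and ind': "\<And>n. indep_rv M (vec_borel (p n)) (\<beta> n) (mat_borel n (p n) \<Otimes>\<^sub>M vec_borel n) (\<lambda>\<omega>. (X n \<omega>, \<epsilon> n \<omega>))"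
    and norm: "\<And>n \<omega>. \<omega> \<in> space M \<Longrightarrow> \<beta> n \<omega> \<bullet> \<beta> n \<omega> = r\<^sup>2 * real n"
    and l: "0 < l"
  shows "AE \<omega> in M. (\<lambda>n. cross_form (X n \<omega>) l (\<beta> n \<omega>) (\<epsilon> n \<omega>) / real n) \<longlonglongrightarrow> 0"
proof (rule AE_tendsto_zero_of_polynomial_tails[OF M, where q=2])
  have X: "X n \<in> M \<rightarrow>\<^sub>M mat_borel n (p n)" and \<epsilon>: "\<epsilon> n \<in> M \<rightarrow>\<^sub>M vec_borel n"
    and \<beta>: "\<beta> n \<in> M \<rightarrow>\<^sub>M vec_borel (p n)" for n
    using ind[of n] ind'[of n] by (auto simp: indep_rv_def)
  have meas: "(\<lambda>w. cross_form (x w) l (b w) (e w) / real n) \<in> borel_measurable N"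
    if x: "x \<in> N \<rightarrow>\<^sub>M mat_borel n (p n)" and b: "b \<in> N \<rightarrow>\<^sub>M vec_borel (p n)" and e: "e \<in> N \<rightarrow>\<^sub>M vec_borel n"
    for x b e n and N :: "'c measure"
    unfolding cross_form_def
    by (intro borel_measurable_divide borel_measurable_const measurable_scalar_prod[OF e]
        measurable_mult_mat_vec[OF x] measurable_mult_mat_vec[OF measurable_pow_mat[OF measurable_resolvent[OF measurable_gram[OF x]]] b])
  show "(\<lambda>\<omega>. cross_form (X n \<omega>) l (\<beta> n \<omega>) (\<epsilon> n \<omega>) / real n) \<in> borel_measurable M" for n
    by (rule meas[OF X \<beta> \<epsilon>])
  fix \<delta> :: real assume \<delta>: "0 < \<delta>"
  define T where "T = 4 * (16 + 8 * K)\<^sup>2 * (r\<^sup>2 / l ^ 3)\<^sup>2 / \<delta> ^ 4"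
  have T0: "0 \<le> T" using \<delta> by (simp add: T_def)
  show "\<exists>T\<ge>0. \<forall>\<^sub>F n in sequentially.
      emeasure M {\<omega> \<in> space M. \<delta> \<le> \<bar>cross_form (X n \<omega>) l (\<beta> n \<omega>) (\<epsilon> n \<omega>) / real n\<bar>} \<le> ennreal (T * real n powr - 2)"
  proof (intro exI[of _ T] conjI T0)
    show "\<forall>\<^sub>F n in sequentially.
        emeasure M {\<omega> \<in> space M. \<delta> \<le> \<bar>cross_form (X n \<omega>) l (\<beta> n \<omega>) (\<epsilon> n \<omega>) / real n\<bar>} \<le> ennreal (T * real n powr - 2)"
      using eventually_ge_at_top[of 1]
    proof eventually_elim
      case (elim n)
      interpret noise M n "\<epsilon> n" \<sigma> \<eta> \<kappa> K by (rule noise[OF elim])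
      have fixed: "emeasure M {\<omega> \<in> space M. \<delta> \<le> \<bar>cross_form (X n \<omega>'') l (\<beta> n \<omega>') (\<epsilon> n \<omega>) / real n\<bar>} \<le> ennreal (T * real n powr - 2)"
        if w': "\<omega>' \<in> space M" and w'': "\<omega>'' \<in> space M" for \<omega>' \<omega>''
      proof -
        note s = svd[OF w'']
        have b: "\<beta> n \<omega>' \<in> carrier_vec (p n)" by (rule carrier_of_measurable_vec[OF \<beta> w'])
        show ?thesis
          unfolding cross_form_def T_def
        proof (rule noise_linear_tail_fixed[OF _ _ \<delta>])
          show "X n \<omega>'' *\<^sub>v (resolvent (transpose_mat (X n \<omega>'') * X n \<omega>'') l ^\<^sub>m 2 *\<^sub>v \<beta> n \<omega>') \<in> carrier_vec n"
            by (rule mult_mat_vec_carrier[OF is_svd_carrier(1)[OF s] mult_mat_vec_carrier[OF _ b]])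
               (simp add: resolvent_gram_pow[OF s l])
          show "(X n \<omega>'' *\<^sub>v (resolvent (transpose_mat (X n \<omega>'') * X n \<omega>'') l ^\<^sub>m 2 *\<^sub>v \<beta> n \<omega>'))
            \<bullet> (X n \<omega>'' *\<^sub>v (resolvent (transpose_mat (X n \<omega>'') * X n \<omega>'') l ^\<^sub>m 2 *\<^sub>v \<beta> n \<omega>')) \<le> r\<^sup>2 / l ^ 3 * real n"
            using norm_resolvent_signal_le[OF s l b] norm[OF w'] by simp
        qed
      qed
      have "emeasure M {\<omega> \<in> space M. \<delta> \<le> \<bar>cross_form (fst (X n \<omega>, \<epsilon> n \<omega>)) l (\<beta> n \<omega>) (snd (X n \<omega>, \<epsilon> n \<omega>)) / real n\<bar>}
        \<le> ennreal (T * real n powr - 2)"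
      proof (rule emeasure_le_of_independent_sections[OF assms(1) ind',
            where P="\<lambda>b z. \<delta> \<le> \<bar>cross_form (fst z) l b (snd z) / real n\<bar>"])
        have "(\<lambda>z. cross_form (fst (snd z)) l (fst z) (snd (snd z)) / real n)
          \<in> borel_measurable (vec_borel (p n) \<Otimes>\<^sub>M (mat_borel n (p n) \<Otimes>\<^sub>M vec_borel n))"
          by (intro meas measurable_compose[OF measurable_snd measurable_fst] measurable_fst
              measurable_compose[OF measurable_snd measurable_snd])
        then show "Measurable.pred (vec_borel (p n) \<Otimes>\<^sub>M (mat_borel n (p n) \<Otimes>\<^sub>M vec_borel n))
          (\<lambda>z. \<delta> \<le> \<bar>cross_form (fst (snd z)) l (fst z) (snd (snd z)) / real n\<bar>)"
          by measurable
        fix \<omega>' assume w': "\<omega>' \<in> space M"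
        have "emeasure M {\<omega> \<in> space M. \<delta> \<le> \<bar>cross_form (X n \<omega>) l (\<beta> n \<omega>') (\<epsilon> n \<omega>) / real n\<bar>} \<le> ennreal (T * real n powr - 2)"
        proof (rule emeasure_le_of_independent_sections[OF assms(1) ind,
            where P="\<lambda>x e. \<delta> \<le> \<bar>cross_form x l (\<beta> n \<omega>') e / real n\<bar>"])
          have "(\<lambda>z. cross_form (fst z) l (\<beta> n \<omega>') (snd z) / real n) \<in> borel_measurable (mat_borel n (p n) \<Otimes>\<^sub>M vec_borel n)"
            using carrier_of_measurable_vec[OF \<beta> w']
            by (intro meas measurable_fst measurable_snd measurable_const) simp
          then show "Measurable.pred (mat_borel n (p n) \<Otimes>\<^sub>M vec_borel n) (\<lambda>z. \<delta> \<le> \<bar>cross_form (fst z) l (\<beta> n \<omega>') (snd z) / real n\<bar>)"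
            by measurable
          show "emeasure M {\<omega> \<in> space M. \<delta> \<le> \<bar>cross_form (X n \<omega>'') l (\<beta> n \<omega>') (\<epsilon> n \<omega>) / real n\<bar>} \<le> ennreal (T * real n powr - 2)"
            if "\<omega>'' \<in> space M" for \<omega>''
            by (rule fixed[OF w' that])
        qed
        then show "emeasure M {\<omega> \<in> space M. \<delta> \<le> \<bar>cross_form (fst (X n \<omega>, \<epsilon> n \<omega>)) l (\<beta> n \<omega>') (snd (X n \<omega>, \<epsilon> n \<omega>)) / real n\<bar>}
          \<le> ennreal (T * real n powr - 2)"
          by simp
      qed
      then show ?case by simp
    qed
  qed
qed simp

section \<open>Out-of-sample risk\<close>

text \<open>The function \<open>I v = E |Xt v|\<^sup>2\<close> is invariant under rotations and quadratic in \<open>v\<close>, hence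
\<open>I v = |v|\<^sup>2 I e\<close> for every unit vector \<open>e\<close>. Averaging over the standard basis gives
\<open>I v = |v|\<^sup>2 E tr(Dt^T Dt) / p\<close>, and the normalization fixes the constant.\<close>

lemma oos_risk_eq:
  assumes M: "prob_space M" and inv: "right_rot_invariant M m p Xt"
    and svd: "\<And>\<omega>. \<omega> \<in> space M \<Longrightarrow> is_svd m p (Xt \<omega>) (Qt \<omega>) (Dt \<omega>) (Wt \<omega>)"
    and n: "0 < n" and m: "0 < m" and p: "0 < p"
    and normalized: "real n * (\<integral>\<omega>. mat_trace (transpose_mat (Dt \<omega>) * Dt \<omega>) \<partial>M) / (real m * real p) = 1"
    and b: "b \<in> carrier_vec p" and \<beta>: "\<beta> \<in> carrier_vec p"
  shows "oos_risk M m Xt b \<beta> = ((b - \<beta>) \<bullet> (b - \<beta>)) / real n"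
proof -
  have Xt: "Xt \<in> M \<rightarrow>\<^sub>M mat_borel m p" using inv by (simp add: right_rot_invariant_def)
  note cX = carrier_of_measurable_mat[OF Xt]
  define w where "w = b - \<beta>"
  have w: "w \<in> carrier_vec p" using b \<beta> by (simp add: w_def)
  define I where "I = (\<lambda>v. \<integral>\<omega>. (Xt \<omega> *\<^sub>v v) \<bullet> (Xt \<omega> *\<^sub>v v) \<partial>M)"
  have meas: "(\<lambda>z. (f z *\<^sub>v v) \<bullet> (f z *\<^sub>v v)) \<in> borel_measurable N"
    if "f \<in> N \<rightarrow>\<^sub>M mat_borel m p" "v \<in> carrier_vec p" for f v and N :: "'c measure"
  proof -
    have "(\<lambda>_. v) \<in> N \<rightarrow>\<^sub>M vec_borel p" using that(2) by (intro measurable_const) simp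
    from measurable_mult_mat_vec[OF that(1) this] show ?thesis by (intro measurable_scalar_prod)
  qed
  have rotate: "I (V *\<^sub>v v) = I v" if V: "orth_mat p V" and v: "v \<in> carrier_vec p" for V v
  proof -
    have "(\<lambda>_. V) \<in> M \<rightarrow>\<^sub>M mat_borel p p" using orth_mat_carrier[OF V] by (intro measurable_const) simp
    then have XV: "(\<lambda>\<omega>. Xt \<omega> * V) \<in> M \<rightarrow>\<^sub>M mat_borel m p" by (rule measurable_mult_mat[OF Xt])
    have q: "(\<lambda>x. (x *\<^sub>v v) \<bullet> (x *\<^sub>v v)) \<in> borel_measurable (mat_borel m p)"
      using meas[of "\<lambda>x. x" "mat_borel m p"] v by simp
    have "I (V *\<^sub>v v) = (\<integral>\<omega>. ((Xt \<omega> * V) *\<^sub>v v) \<bullet> ((Xt \<omega> * V) *\<^sub>v v) \<partial>M)"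
      unfolding I_def using assoc_mult_mat_vec[OF cX orth_mat_carrier[OF V] v]
      by (intro Bochner_Integration.integral_cong) auto
    also have "\<dots> = (\<integral>x. (x *\<^sub>v v) \<bullet> (x *\<^sub>v v) \<partial>distr M (mat_borel m p) (\<lambda>\<omega>. Xt \<omega> * V))"
      by (rule integral_distr[OF XV q, symmetric])
    also have "distr M (mat_borel m p) (\<lambda>\<omega>. Xt \<omega> * V) = distr M (mat_borel m p) Xt"
      using inv V by (simp add: right_rot_invariant_def)
    also have "(\<integral>x. (x *\<^sub>v v) \<bullet> (x *\<^sub>v v) \<partial>distr M (mat_borel m p) Xt) = I v"
      unfolding I_def by (rule integral_distr[OF Xt q])
    finally show ?thesis .
  qed
  define f where "f = (\<lambda>i \<omega>. (Xt \<omega> *\<^sub>v unit_vec p i) \<bullet> (Xt \<omega> *\<^sub>v unit_vec p i))"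
  have I_w: "I w = (w \<bullet> w) * (\<integral>\<omega>. f i \<omega> \<partial>M)" if i: "i < p" for i
  proof -
    have ww: "0 \<le> w \<bullet> w" by (simp add: scalar_prod_def sum_nonneg)
    define v where "v = sqrt (w \<bullet> w) \<cdot>\<^sub>v unit_vec p i"
    have v: "v \<in> carrier_vec p" by (simp add: v_def)
    have "v \<bullet> v = w \<bullet> w" using ww i by (simp add: v_def)
    then obtain V where V: "orth_mat p V" "V *\<^sub>v w = v"
      using orth_mat_transitive_on_spheres[OF w v] by auto
    have "I w = I v" using rotate[OF V(1) w] V(2) by simp
    also have "\<dots> = (\<integral>\<omega>. (w \<bullet> w) * f i \<omega> \<partial>M)"
      unfolding I_def
    proof (rule Bochner_Integration.integral_cong[OF refl])
      fix \<omega> assume "\<omega> \<in> space M"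
      then have X: "Xt \<omega> \<in> carrier_mat m p" by (rule cX)
      then have "Xt \<omega> *\<^sub>v v = sqrt (w \<bullet> w) \<cdot>\<^sub>v (Xt \<omega> *\<^sub>v unit_vec p i)"
        unfolding v_def by (intro mult_mat_vec) auto
      moreover have "Xt \<omega> *\<^sub>v unit_vec p i \<in> carrier_vec m" using X by auto
      ultimately show "(Xt \<omega> *\<^sub>v v) \<bullet> (Xt \<omega> *\<^sub>v v) = (w \<bullet> w) * f i \<omega>"
        using ww by (simp add: f_def)
    qed
    also have "\<dots> = (w \<bullet> w) * (\<integral>\<omega>. f i \<omega> \<partial>M)" by simp
    finally show ?thesis .
  qed
  have trace: "(\<Sum>i<p. f i \<omega>) = mat_trace (transpose_mat (Dt \<omega>) * Dt \<omega>)" if om: "\<omega> \<in> space M" for \<omega>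
  proof -
    note s = svd[OF om]
    note c = is_svd_carrier[OF s]
    have unit: "Xt \<omega> *\<^sub>v unit_vec p i = col (Xt \<omega>) i" if "i < p" for i
      using c(1) that by (intro eq_vecI) auto
    have "(\<Sum>i<p. f i \<omega>) = (\<Sum>i<p. (transpose_mat (Xt \<omega>) * Xt \<omega>) $$ (i, i))"
      using c by (intro sum.cong) (auto simp: f_def unit)
    also have "\<dots> = (\<Sum>i<p. (diag_entry (Dt \<omega>) i)\<^sup>2)"
      unfolding is_svd_gram[OF s] by (rule trace_spectral_mat[OF c(6)])
    also have "\<dots> = (\<Sum>i<p. (transpose_mat (Dt \<omega>) * Dt \<omega>) $$ (i, i))"
    proof (intro sum.cong refl)
      fix i assume "i \<in> {..<p}"
      then have i: "i < p" by simp
      have "(transpose_mat (Dt \<omega>) * Dt \<omega>) $$ (i, i) = (\<Sum>h<m. Dt \<omega> $$ (h, i) * Dt \<omega> $$ (h, i))"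
        using c i by (auto simp: scalar_prod_def lessThan_atLeast0)
      also have "\<dots> = (\<Sum>h<m. if h = i then (Dt \<omega> $$ (i, i))\<^sup>2 else 0)"
        using c i by (intro sum.cong) (auto simp: diagonal_mat_def power2_eq_square)
      also have "\<dots> = (diag_entry (Dt \<omega>) i)\<^sup>2" using c i by (simp add: diag_entry_def)
      finally show "(diag_entry (Dt \<omega>) i)\<^sup>2 = (transpose_mat (Dt \<omega>) * Dt \<omega>) $$ (i, i)" by simp
    qed
    also have "\<dots> = mat_trace (transpose_mat (Dt \<omega>) * Dt \<omega>)" using c by (simp add: mat_trace_def)
    finally show ?thesis .
  qed
  have trace_int: "(\<integral>\<omega>. mat_trace (transpose_mat (Dt \<omega>) * Dt \<omega>) \<partial>M) = (\<integral>\<omega>. (\<Sum>i<p. f i \<omega>) \<partial>M)"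
    using trace by (intro Bochner_Integration.integral_cong) auto
  \<comment> \<open>Integrals of functions that are not integrable are 0, so the normalization implies that
    \<open>Xt\<close> has second moments.\<close>
  have "(\<integral>\<omega>. (\<Sum>i<p. f i \<omega>) \<partial>M) \<noteq> 0" using normalized trace_int by auto
  then have int: "integrable M (\<lambda>\<omega>. \<Sum>i<p. f i \<omega>)" using not_integrable_integral_eq by blast
  have f_nonneg: "0 \<le> f i \<omega>" for i \<omega> by (simp add: f_def scalar_prod_def sum_nonneg)
  have int_f: "integrable M (f i)" if "i < p" for i
  proof (rule Bochner_Integration.integrable_bound[OF int])
    show "f i \<in> borel_measurable M" unfolding f_def by (rule meas[OF Xt]) simp
    show "AE \<omega> in M. norm (f i \<omega>) \<le> norm (\<Sum>i<p. f i \<omega>)"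
      using f_nonneg that by (intro AE_I2) (auto simp: sum_nonneg intro!: member_le_sum)
  qed
  have "real p * I w = (\<Sum>i<p. I w)" by simp
  also have "\<dots> = (\<Sum>i<p. (w \<bullet> w) * (\<integral>\<omega>. f i \<omega> \<partial>M))" using I_w by (intro sum.cong) auto
  also have "\<dots> = (w \<bullet> w) * (\<integral>\<omega>. (\<Sum>i<p. f i \<omega>) \<partial>M)"
    using int_f by (simp add: sum_distrib_left)
  finally have "real p * I w = (w \<bullet> w) * (\<integral>\<omega>. mat_trace (transpose_mat (Dt \<omega>) * Dt \<omega>) \<partial>M)"
    using trace_int by simp
  moreover have "(\<integral>\<omega>. mat_trace (transpose_mat (Dt \<omega>) * Dt \<omega>) \<partial>M) = real m * real p / real n"
    using normalized n m p by (simp add: field_simps)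
  ultimately have "I w = (w \<bullet> w) * real m / real n" using n p by (simp add: field_simps)
  moreover have "oos_risk M m Xt b \<beta> = I w / real m"
  proof -
    have "(\<integral>\<omega>. (vnorm (Xt \<omega> *\<^sub>v b - Xt \<omega> *\<^sub>v \<beta>))\<^sup>2 \<partial>M) = I w"
      unfolding I_def
    proof (rule Bochner_Integration.integral_cong[OF refl])
      fix \<omega> assume "\<omega> \<in> space M"
      then have "Xt \<omega> *\<^sub>v b - Xt \<omega> *\<^sub>v \<beta> = Xt \<omega> *\<^sub>v w"
        unfolding w_def by (intro mult_minus_distrib_mat_vec[OF cX b \<beta>, symmetric])
      then show "(vnorm (Xt \<omega> *\<^sub>v b - Xt \<omega> *\<^sub>v \<beta>))\<^sup>2 = (Xt \<omega> *\<^sub>v w) \<bullet> (Xt \<omega> *\<^sub>v w)"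
        by (simp add: vnorm_def scalar_prod_def sum_nonneg)
    qed
    then show ?thesis by (simp add: oos_risk_def)
  qed
  ultimately show ?thesis using m by (simp add: w_def)
qed

section \<open>Training error and risk in singular coordinates\<close>

lemma v_D_neg: "v_D D (- l) = (\<Sum>i<dim_row D. 1 / ((diag_entry D i)\<^sup>2 + l)) / real (dim_row D)"
  by (simp add: v_D_def)

lemma v_D'_neg:
  assumes l: "0 < l"
  shows "v_D' D (- l) = (\<Sum>i<dim_row D. 1 / ((diag_entry D i)\<^sup>2 + l)\<^sup>2) / real (dim_row D)"
proof -
  have nz: "(diag_entry D i)\<^sup>2 + l \<noteq> 0" for i
    using l zero_le_power2[of "diag_entry D i"] by linarith
  have "((\<lambda>z. 1 / ((diag_entry D i)\<^sup>2 - z)) has_real_derivative 1 / ((diag_entry D i)\<^sup>2 + l)\<^sup>2) (at (- l))" for i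
    using nz[of i] by (auto intro!: derivative_eq_intros simp: power2_eq_square)
  then have "(v_D D has_real_derivative (\<Sum>i<dim_row D. 1 / ((diag_entry D i)\<^sup>2 + l)\<^sup>2) / real (dim_row D)) (at (- l))"
    unfolding v_D_def by (intro DERIV_cdivide DERIV_sum)
  then show ?thesis unfolding v_D'_def by (rule DERIV_imp_deriv)
qed

lemma inverse_diff_eq:
  assumes "0 < s" "s = x + (l::real)"
  shows "1 / s - l * (1 / s\<^sup>2) = x / s\<^sup>2"
proof -
  have "1 / s - l * (1 / s\<^sup>2) = (s - l) / s\<^sup>2"
    using assms(1) by (simp add: diff_divide_distrib power2_eq_square)
  then show ?thesis using assms(2) by simp
qed

lemma v_minus_v':
  assumes l: "0 < l"
  shows "v_D D (- l) - l * v_D' D (- l) =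
    (\<Sum>i<dim_row D. (diag_entry D i)\<^sup>2 / ((diag_entry D i)\<^sup>2 + l)\<^sup>2) / real (dim_row D)"
proof -
  have pos: "0 < (diag_entry D i)\<^sup>2 + l" for i
    using l zero_le_power2[of "diag_entry D i"] by linarith
  have "(\<Sum>i<dim_row D. (diag_entry D i)\<^sup>2 / ((diag_entry D i)\<^sup>2 + l)\<^sup>2)
    = (\<Sum>i<dim_row D. 1 / ((diag_entry D i)\<^sup>2 + l) - l * (1 / ((diag_entry D i)\<^sup>2 + l)\<^sup>2))"
    by (intro sum.cong refl inverse_diff_eq[OF pos refl, symmetric])
  then show ?thesis
    unfolding v_D_neg v_D'_neg[OF l] by (simp add: sum_subtractf sum_distrib_left diff_divide_distrib)
qed

text \<open>The value \<open>c\<close> is that of a vanishing singular value. The identity covers \<open>n \<le> p\<close> and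
\<open>p \<le> n\<close> alike and is the source of the terms with \<open>\<gamma> - 1\<close> in the risk.\<close>

lemma sum_beyond_rank:
  fixes f :: "nat \<Rightarrow> real"
  assumes "\<And>i. min n p \<le> i \<Longrightarrow> f i = c"
  shows "(\<Sum>i<p. f i) = (\<Sum>i<n. f i) + (real p - real n) * c"
proof -
  have split: "(\<Sum>i<k. f i) = (\<Sum>i<min n p. f i) + (real k - real (min n p)) * c" if "min n p \<le> k" for k
  proof -
    have "{..<k} = {..<min n p} \<union> {min n p..<k}" using that by auto
    then have "(\<Sum>i<k. f i) = (\<Sum>i<min n p. f i) + (\<Sum>i\<in>{min n p..<k}. f i)"
      by (simp add: sum.union_disjoint ivl_disj_int)
    also have "(\<Sum>i\<in>{min n p..<k}. f i) = (real k - real (min n p)) * c"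
      using assms that by (simp add: of_nat_diff)
    finally show ?thesis .
  qed
  show ?thesis using split[of n] split[of p] by (simp add: algebra_simps)
qed

lemma diag_entry_beyond_rank: "D \<in> carrier_mat n p \<Longrightarrow> min n p \<le> i \<Longrightarrow> diag_entry D i = 0"
  by (auto simp: diag_entry_def)

lemma ridge_svd:
  assumes svd: "is_svd n p x Q D W" and l: "0 < l" and y: "y \<in> carrier_vec n"
  shows "ridge x y l = spectral_mat p W (\<lambda>i. 1 / ((diag_entry D i)\<^sup>2 + l)) *\<^sub>v (transpose_mat x *\<^sub>v y)"
    and "ridge x y l \<in> carrier_vec p"
    and "i < p \<Longrightarrow> (W *\<^sub>v ridge x y l) $ i = (if i < n then diag_entry D i * (Q *\<^sub>v y) $ i / ((diag_entry D i)\<^sup>2 + l) else 0)"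
proof -
  note c = is_svd_carrier[OF svd]
  show eq: "ridge x y l = spectral_mat p W (\<lambda>i. 1 / ((diag_entry D i)\<^sup>2 + l)) *\<^sub>v (transpose_mat x *\<^sub>v y)"
    unfolding ridge_def using mat_inverse_gram[OF svd l] c by simp
  have xy: "transpose_mat x *\<^sub>v y \<in> carrier_vec p" using c y by (intro mult_mat_vec_carrier[of _ p n]) auto
  show "ridge x y l \<in> carrier_vec p" unfolding eq by (rule mult_mat_vec_carrier[OF _ xy]) simp
  assume i: "i < p"
  show "(W *\<^sub>v ridge x y l) $ i = (if i < n then diag_entry D i * (Q *\<^sub>v y) $ i / ((diag_entry D i)\<^sup>2 + l) else 0)"
    unfolding eq spectral_mat_apply[OF c(6) xy i]
    using is_svd_apply[OF is_svd_transpose[OF svd] y i] diag_entry_transpose[OF c(4)] by simp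
qed

text \<open>Extension by zero, like that of the diagonal entries beyond the rank, lets sums of
products range over \<open>i < n\<close> or \<open>i < p\<close> interchangeably.\<close>

definition coord :: "real mat \<Rightarrow> nat \<Rightarrow> real Matrix.vec \<Rightarrow> nat \<Rightarrow> real" where
  "coord V k b i = (if i < k then (V *\<^sub>v b) $ i else 0)"

lemma resolvent_form_gram_coord:
  assumes svd: "is_svd n p x Q D W" and l: "0 < l" and b: "b \<in> carrier_vec p"
  shows "resolvent_form (transpose_mat x * x) l k b = (\<Sum>i<p. (coord W p b i)\<^sup>2 / ((diag_entry D i)\<^sup>2 + l) ^ k)"
  unfolding resolvent_form_gram[OF assms] by (intro sum.cong) (auto simp: coord_def)

lemma resolvent_form_cogram_coord:
  assumes svd: "is_svd n p x Q D W" and l: "0 < l" and b: "b \<in> carrier_vec n"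
  shows "resolvent_form (x * transpose_mat x) l k b = (\<Sum>i<n. (coord Q n b i)\<^sup>2 / ((diag_entry D i)\<^sup>2 + l) ^ k)"
  unfolding resolvent_form_cogram[OF assms] by (intro sum.cong) (auto simp: coord_def)

lemma cross_form_coord:
  assumes svd: "is_svd n p x Q D W" and l: "0 < l" and b: "b \<in> carrier_vec p" and e: "e \<in> carrier_vec n"
  shows "cross_form x l b e =
    (\<Sum>i<n. diag_entry D i * coord W p b i * coord Q n e i / ((diag_entry D i)\<^sup>2 + l)\<^sup>2)"
  unfolding cross_form_svd[OF assms] by (intro sum.cong) (auto simp: coord_def)

lemma sum_swap_dims:
  fixes f :: "nat \<Rightarrow> real"
  assumes "\<And>i. min n p \<le> i \<Longrightarrow> f i = 0"
  shows "(\<Sum>i<p. f i) = (\<Sum>i<n. f i)"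
  using sum_beyond_rank[of n p f 0] assms by simp

text \<open>In singular coordinates \<open>u\<close> of the signal and \<open>q\<close> of the noise, with singular value \<open>d\<close>,
the residual is \<open>l (d u + q) / (d\<^sup>2 + l)\<close> and the estimation error is \<open>(d q - l u) / (d\<^sup>2 + l)\<close>.
Squaring and splitting \<open>d\<^sup>2 / (d\<^sup>2 + l)\<^sup>2 = 1 / (d\<^sup>2 + l) - l / (d\<^sup>2 + l)\<^sup>2\<close> produces the resolvent
forms.\<close>

lemma
  assumes svd: "is_svd n p x Q D W" and l: "0 < l" and b: "b \<in> carrier_vec p" and e: "e \<in> carrier_vec n"
    and y: "y = x *\<^sub>v b + e"
  shows ridge_train_err: "train_err x y l = l\<^sup>2 * (resolvent_form (transpose_mat x * x) l 1 b - l * resolvent_form (transpose_mat x * x) l 2 b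
      + 2 * cross_form x l b e + resolvent_form (x * transpose_mat x) l 2 e) / real n"
    and ridge_risk: "(ridge x y l - b) \<bullet> (ridge x y l - b) = l\<^sup>2 * resolvent_form (transpose_mat x * x) l 2 b
      - 2 * l * cross_form x l b e
      + (resolvent_form (x * transpose_mat x) l 1 e - l * resolvent_form (x * transpose_mat x) l 2 e)"
proof -
  note c = is_svd_carrier[OF svd]
  define d where "d = diag_entry D"
  define u where "u = coord W p b"
  define q where "q = coord Q n e"
  have s: "0 < (d i)\<^sup>2 + l" for i using l zero_le_power2[of "d i"] by linarith
  have d0: "d i = 0" if "min n p \<le> i" for i using diag_entry_beyond_rank[OF c(4) that] by (simp add: d_def)
  have u0: "u i = 0" if "p \<le> i" for i using that by (simp add: u_def coord_def)
  have q0: "q i = 0" if "n \<le> i" for i using that by (simp add: q_def coord_def)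
  have yc: "y \<in> carrier_vec n" using c b e by (auto simp: y intro!: mult_mat_vec_carrier)
  have Qy: "(Q *\<^sub>v y) $ i = d i * u i + q i" if "i < n" for i
  proof -
    have "Q *\<^sub>v y = Q *\<^sub>v (x *\<^sub>v b) + Q *\<^sub>v e"
      unfolding y using c b e by (intro mult_add_distrib_mat_vec[of _ n n]) (auto intro!: mult_mat_vec_carrier)
    moreover have "(Q *\<^sub>v (x *\<^sub>v b)) $ i = d i * u i"
      using is_svd_apply[OF svd b that] d0[of i] that by (auto simp: d_def u_def coord_def)
    ultimately show ?thesis using c e that by (auto simp: q_def coord_def)
  qed
  note ridge = ridge_svd[OF svd l yc]
  have Wr: "(W *\<^sub>v ridge x y l) $ i = d i * (d i * u i + q i) / ((d i)\<^sup>2 + l)" if "i < p" for i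
    using ridge(3)[OF that] Qy[of i] d0[of i] by (auto simp: d_def)
  have "(ridge x y l - b) \<bullet> (ridge x y l - b) = (W *\<^sub>v (ridge x y l - b)) \<bullet> (W *\<^sub>v (ridge x y l - b))"
    using ridge(2) b by (intro orth_mat_scalar_prod[OF c(6), symmetric]) auto
  also have "W *\<^sub>v (ridge x y l - b) = W *\<^sub>v ridge x y l - W *\<^sub>v b"
    using c ridge(2) b by (intro mult_minus_distrib_mat_vec[of _ p p]) auto
  also have "(W *\<^sub>v ridge x y l - W *\<^sub>v b) \<bullet> (W *\<^sub>v ridge x y l - W *\<^sub>v b)
    = (\<Sum>i<p. (d i * (d i * u i + q i) / ((d i)\<^sup>2 + l) - u i)\<^sup>2)"
    using c Wr by (simp add: scalar_prod_def lessThan_atLeast0 power2_eq_square u_def coord_def)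
  also have "\<dots> = (\<Sum>i<p. l\<^sup>2 * ((u i)\<^sup>2 / ((d i)\<^sup>2 + l)\<^sup>2) - 2 * l * (d i * u i * q i / ((d i)\<^sup>2 + l)\<^sup>2)
      + (d i * q i)\<^sup>2 / ((d i)\<^sup>2 + l)\<^sup>2)"
  proof (intro sum.cong refl)
    fix i
    have "d i * (d i * u i + q i) / ((d i)\<^sup>2 + l) - u i = (d i * q i - l * u i) / ((d i)\<^sup>2 + l)"
      using s[of i] by (simp add: field_simps power2_eq_square)
    then show "(d i * (d i * u i + q i) / ((d i)\<^sup>2 + l) - u i)\<^sup>2 = l\<^sup>2 * ((u i)\<^sup>2 / ((d i)\<^sup>2 + l)\<^sup>2)
      - 2 * l * (d i * u i * q i / ((d i)\<^sup>2 + l)\<^sup>2) + (d i * q i)\<^sup>2 / ((d i)\<^sup>2 + l)\<^sup>2"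
      by (simp add: power_divide power2_diff power_mult_distrib add_divide_distrib diff_divide_distrib mult_ac)
         (simp add: power2_eq_square)
  qed
  also have "\<dots> = l\<^sup>2 * (\<Sum>i<p. (u i)\<^sup>2 / ((d i)\<^sup>2 + l)\<^sup>2) - 2 * l * (\<Sum>i<p. d i * u i * q i / ((d i)\<^sup>2 + l)\<^sup>2)
      + (\<Sum>i<p. (d i * q i)\<^sup>2 / ((d i)\<^sup>2 + l)\<^sup>2)"
    by (simp only: sum.distrib sum_subtractf sum_distrib_left)
  also have "(\<Sum>i<p. d i * u i * q i / ((d i)\<^sup>2 + l)\<^sup>2) = (\<Sum>i<n. d i * u i * q i / ((d i)\<^sup>2 + l)\<^sup>2)"
    by (rule sum_swap_dims) (simp add: d0)
  also have "(\<Sum>i<p. (d i * q i)\<^sup>2 / ((d i)\<^sup>2 + l)\<^sup>2) = (\<Sum>i<n. (d i * q i)\<^sup>2 / ((d i)\<^sup>2 + l)\<^sup>2)"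
    by (rule sum_swap_dims) (simp add: d0)
  also have "\<dots> = (\<Sum>i<n. (q i)\<^sup>2 / ((d i)\<^sup>2 + l) ^ 1 - l * ((q i)\<^sup>2 / ((d i)\<^sup>2 + l)\<^sup>2))"
  proof (intro sum.cong refl)
    fix i
    have "(q i)\<^sup>2 * ((d i)\<^sup>2 / ((d i)\<^sup>2 + l)\<^sup>2) = (q i)\<^sup>2 * (1 / ((d i)\<^sup>2 + l) - l * (1 / ((d i)\<^sup>2 + l)\<^sup>2))"
      by (simp only: inverse_diff_eq[OF s refl])
    then show "(d i * q i)\<^sup>2 / ((d i)\<^sup>2 + l)\<^sup>2 = (q i)\<^sup>2 / ((d i)\<^sup>2 + l) ^ 1 - l * ((q i)\<^sup>2 / ((d i)\<^sup>2 + l)\<^sup>2)"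
      by (simp add: power_mult_distrib right_diff_distrib mult_ac)
  qed
  finally show "(ridge x y l - b) \<bullet> (ridge x y l - b) = l\<^sup>2 * resolvent_form (transpose_mat x * x) l 2 b
      - 2 * l * cross_form x l b e
      + (resolvent_form (x * transpose_mat x) l 1 e - l * resolvent_form (x * transpose_mat x) l 2 e)"
    unfolding resolvent_form_gram_coord[OF svd l b] resolvent_form_cogram_coord[OF svd l e] cross_form_coord[OF svd l b e]
      d_def[symmetric] u_def[symmetric] q_def[symmetric]
    by (simp only: sum_subtractf sum_distrib_left)
  have xr: "x *\<^sub>v ridge x y l \<in> carrier_vec n" using c ridge(2) by (intro mult_mat_vec_carrier) auto
  have "(vnorm (y - x *\<^sub>v ridge x y l))\<^sup>2 = (y - x *\<^sub>v ridge x y l) \<bullet> (y - x *\<^sub>v ridge x y l)"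
    by (simp add: vnorm_def scalar_prod_def sum_nonneg)
  also have "\<dots> = (Q *\<^sub>v (y - x *\<^sub>v ridge x y l)) \<bullet> (Q *\<^sub>v (y - x *\<^sub>v ridge x y l))"
    using yc xr by (intro orth_mat_scalar_prod[OF c(5), symmetric]) auto
  also have "Q *\<^sub>v (y - x *\<^sub>v ridge x y l) = Q *\<^sub>v y - Q *\<^sub>v (x *\<^sub>v ridge x y l)"
    using c yc xr by (intro mult_minus_distrib_mat_vec[of _ n n]) auto
  also have "(Q *\<^sub>v y - Q *\<^sub>v (x *\<^sub>v ridge x y l)) \<bullet> (Q *\<^sub>v y - Q *\<^sub>v (x *\<^sub>v ridge x y l))
    = (\<Sum>i<n. ((Q *\<^sub>v y) $ i - (Q *\<^sub>v (x *\<^sub>v ridge x y l)) $ i)\<^sup>2)"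
    using c by (simp add: scalar_prod_def lessThan_atLeast0 power2_eq_square)
  also have "\<dots> = (\<Sum>i<n. l\<^sup>2 * ((d i * u i)\<^sup>2 / ((d i)\<^sup>2 + l)\<^sup>2 + 2 * (d i * u i * q i / ((d i)\<^sup>2 + l)\<^sup>2)
      + (q i)\<^sup>2 / ((d i)\<^sup>2 + l)\<^sup>2))"
  proof (intro sum.cong refl)
    fix i assume "i \<in> {..<n}"
    then have i: "i < n" by simp
    have "(Q *\<^sub>v (x *\<^sub>v ridge x y l)) $ i = d i * (d i * (d i * u i + q i) / ((d i)\<^sup>2 + l))"
      using is_svd_apply[OF svd ridge(2) i] Wr[of i] d0[of i] by (auto simp: d_def)
    then have "(Q *\<^sub>v y) $ i - (Q *\<^sub>v (x *\<^sub>v ridge x y l)) $ i = l * (d i * u i + q i) / ((d i)\<^sup>2 + l)"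
      using s[of i] unfolding Qy[OF i] by (simp add: field_simps power2_eq_square)
    then show "((Q *\<^sub>v y) $ i - (Q *\<^sub>v (x *\<^sub>v ridge x y l)) $ i)\<^sup>2 = l\<^sup>2 * ((d i * u i)\<^sup>2 / ((d i)\<^sup>2 + l)\<^sup>2
      + 2 * (d i * u i * q i / ((d i)\<^sup>2 + l)\<^sup>2) + (q i)\<^sup>2 / ((d i)\<^sup>2 + l)\<^sup>2)"
    proof -
      have "(l * (d i * u i + q i) / ((d i)\<^sup>2 + l))\<^sup>2 = l\<^sup>2 * ((d i * u i + q i)\<^sup>2 / ((d i)\<^sup>2 + l)\<^sup>2)"
        by (simp only: power_divide power_mult_distrib times_divide_eq_right)
      also have "(d i * u i + q i)\<^sup>2 = (d i * u i)\<^sup>2 + 2 * (d i * u i * q i) + (q i)\<^sup>2"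
        by (simp add: power2_sum)
      finally show ?thesis
        using \<open>(Q *\<^sub>v y) $ i - (Q *\<^sub>v (x *\<^sub>v ridge x y l)) $ i = l * (d i * u i + q i) / ((d i)\<^sup>2 + l)\<close>
        by (simp only: add_divide_distrib times_divide_eq_right)
    qed
  qed
  also have "\<dots> = l\<^sup>2 * ((\<Sum>i<n. (d i * u i)\<^sup>2 / ((d i)\<^sup>2 + l)\<^sup>2) + 2 * (\<Sum>i<n. d i * u i * q i / ((d i)\<^sup>2 + l)\<^sup>2)
      + (\<Sum>i<n. (q i)\<^sup>2 / ((d i)\<^sup>2 + l)\<^sup>2))"
    by (simp only: sum.distrib sum_distrib_left[symmetric])
  also have "(\<Sum>i<n. (d i * u i)\<^sup>2 / ((d i)\<^sup>2 + l)\<^sup>2) = (\<Sum>i<p. (d i * u i)\<^sup>2 / ((d i)\<^sup>2 + l)\<^sup>2)"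
    by (rule sum_swap_dims[symmetric]) (simp add: d0)
  also have "\<dots> = (\<Sum>i<p. (u i)\<^sup>2 / ((d i)\<^sup>2 + l) ^ 1 - l * ((u i)\<^sup>2 / ((d i)\<^sup>2 + l)\<^sup>2))"
  proof (intro sum.cong refl)
    fix i
    have "(u i)\<^sup>2 * ((d i)\<^sup>2 / ((d i)\<^sup>2 + l)\<^sup>2) = (u i)\<^sup>2 * (1 / ((d i)\<^sup>2 + l) - l * (1 / ((d i)\<^sup>2 + l)\<^sup>2))"
      by (simp only: inverse_diff_eq[OF s refl])
    then show "(d i * u i)\<^sup>2 / ((d i)\<^sup>2 + l)\<^sup>2 = (u i)\<^sup>2 / ((d i)\<^sup>2 + l) ^ 1 - l * ((u i)\<^sup>2 / ((d i)\<^sup>2 + l)\<^sup>2)"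
      by (simp add: power_mult_distrib right_diff_distrib mult_ac)
  qed
  finally have "(vnorm (y - x *\<^sub>v ridge x y l))\<^sup>2 = l\<^sup>2 * (resolvent_form (transpose_mat x * x) l 1 b - l * resolvent_form (transpose_mat x * x) l 2 b
      + 2 * cross_form x l b e + resolvent_form (x * transpose_mat x) l 2 e)"
    unfolding resolvent_form_gram_coord[OF svd l b] resolvent_form_cogram_coord[OF svd l e] cross_form_coord[OF svd l b e]
      d_def[symmetric] u_def[symmetric] q_def[symmetric]
    by (simp only: sum_subtractf sum_distrib_left)
  then show "train_err x y l = l\<^sup>2 * (resolvent_form (transpose_mat x * x) l 1 b - l * resolvent_form (transpose_mat x * x) l 2 b
      + 2 * cross_form x l b e + resolvent_form (x * transpose_mat x) l 2 e) / real n"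
    using c by (simp add: train_err_def)
qed

text \<open>The ROTI-GCV expression with free values in place of the two estimates.\<close>

definition risk_profile :: "real \<Rightarrow> real \<Rightarrow> real mat \<Rightarrow> real \<Rightarrow> real" where
  "risk_profile r2 s2 D l = r2 * (l\<^sup>2 / aspect D * v_D' D (- l) + (aspect D - 1) / aspect D)
     + s2 * (v_D D (- l) - l * v_D' D (- l))"

text \<open>The traces over \<open>p\<close> and over \<open>n\<close> dimensions differ by \<open>(p - n) / l ^ k\<close>. These terms
cancel in the training error, where the traces occur as \<open>tr G - l tr G\<^sup>2\<close>, and yield
\<open>(\<gamma> - 1) / \<gamma>\<close> in the risk.\<close>

lemma
  assumes svd: "is_svd n p x Q D W" and l: "0 < l" and b: "b \<in> carrier_vec p" and e: "e \<in> carrier_vec n"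
    and y: "y = x *\<^sub>v b + e" and n: "0 < n" and p: "0 < p"
  shows train_err_dev: "train_err x y l - (r\<^sup>2 * coef_a D l + \<sigma>\<^sup>2 * coef_b D l) =
      l\<^sup>2 * (signal_dev n p r x b 1 l - l * signal_dev n p r x b 2 l
        + 2 * (cross_form x l b e / real n) + noise_dev n \<sigma> x e 2 l)"
    and risk_dev: "((ridge x y l - b) \<bullet> (ridge x y l - b)) / real n - risk_profile (r\<^sup>2) (\<sigma>\<^sup>2) D l =
      l\<^sup>2 * signal_dev n p r x b 2 l - 2 * l * (cross_form x l b e / real n)
        + (noise_dev n \<sigma> x e 1 l - l * noise_dev n \<sigma> x e 2 l)"
proof -
  note c = is_svd_carrier[OF svd]
  have dims: "dim_row D = n" "dim_col D = p" using c by auto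
  define T1 T2 where "T1 = (\<Sum>i<n. 1 / ((diag_entry D i)\<^sup>2 + l))" and "T2 = (\<Sum>i<n. 1 / ((diag_entry D i)\<^sup>2 + l)\<^sup>2)"
  have v: "v_D D (- l) = T1 / n" "v_D' D (- l) = T2 / n" unfolding v_D_neg v_D'_neg[OF l] dims T1_def T2_def by auto
  have tn: "resolvent_trace n (x * transpose_mat x) l 1 = T1" "resolvent_trace n (x * transpose_mat x) l 2 = T2"
    unfolding resolvent_trace_cogram[OF svd l] T1_def T2_def by auto
  have tp: "resolvent_trace p (transpose_mat x * x) l k = (\<Sum>i<n. 1 / ((diag_entry D i)\<^sup>2 + l) ^ k) + (real p - real n) * (1 / l ^ k)" for k
    unfolding resolvent_trace_gram[OF svd l] by (rule sum_beyond_rank) (simp add: diag_entry_beyond_rank[OF c(4)])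
  have tp1: "resolvent_trace p (transpose_mat x * x) l 1 = T1 + (real p - real n) / l"
    and tp2: "resolvent_trace p (transpose_mat x * x) l 2 = T2 + (real p - real n) / l\<^sup>2"
    using tp[of 1] tp[of 2] by (simp_all add: T1_def T2_def)
  have l2: "l\<^sup>2 * ((real p - real n) / l\<^sup>2) = real p - real n" "l * ((real p - real n) / l\<^sup>2) = (real p - real n) / l"
    using l by (simp_all add: power2_eq_square)
  have asp: "aspect D = real p / real n" by (simp add: aspect_def dims)
  show "train_err x y l - (r\<^sup>2 * coef_a D l + \<sigma>\<^sup>2 * coef_b D l) =
      l\<^sup>2 * (signal_dev n p r x b 1 l - l * signal_dev n p r x b 2 l
        + 2 * (cross_form x l b e / real n) + noise_dev n \<sigma> x e 2 l)"
    unfolding ridge_train_err[OF svd l b e y] signal_dev_def noise_dev_def coef_a_def coef_b_def v tn tp1 tp2 asp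
    using n p l by (simp add: field_simps power2_eq_square)
  show "((ridge x y l - b) \<bullet> (ridge x y l - b)) / real n - risk_profile (r\<^sup>2) (\<sigma>\<^sup>2) D l =
      l\<^sup>2 * signal_dev n p r x b 2 l - 2 * l * (cross_form x l b e / real n)
        + (noise_dev n \<sigma> x e 1 l - l * noise_dev n \<sigma> x e 2 l)"
    unfolding ridge_risk[OF svd l b e y] signal_dev_def noise_dev_def risk_profile_def v tn tp1 tp2 asp
    using n p l by (simp add: field_simps power2_eq_square)
qed

section \<open>Consistency of the two estimators\<close>

text \<open>With \<open>e\<close> the error in \<open>t = \<rho> a + s b + e\<close>, division by \<open>a\<close> and subtraction of the first
equation leave \<open>s w + g\<close>, where \<open>w = b/a - b_1/a_1\<close> and \<open>g\<close> stems from \<open>e\<close>: the quotient is the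
least-squares slope, off by at most \<open>\<Sum> |g w| / \<Sum> w\<^sup>2\<close>. The denominator is bounded below by the
summand of index 2, which is the determinant divided by \<open>a_1 a_2\<close>, squared. Exchanging \<open>a\<close> and
\<open>b\<close> covers the estimator of the other coefficient.\<close>

lemma ratio_regression_consistent:
  fixes t a b :: "nat \<Rightarrow> nat \<Rightarrow> real"
  assumes L: "2 \<le> L" and c: "0 < c" and \<delta>: "0 < \<delta>"
    and err: "\<And>i. i \<in> {1..L} \<Longrightarrow> (\<lambda>n. t n i - (\<rho> * a n i + s * b n i)) \<longlonglongrightarrow> 0"
    and bounds: "\<forall>\<^sub>F n in sequentially. \<forall>i\<in>{1..L}. c \<le> a n i \<and> a n i \<le> K \<and> c \<le> b n i \<and> b n i \<le> K"
    and det: "\<forall>\<^sub>F n in sequentially. \<delta> \<le> \<bar>a n 1 * b n 2 - a n 2 * b n 1\<bar>"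
  shows "(\<lambda>n. (\<Sum>i=1..L. (t n i / a n i - t n 1 / a n 1) * (b n i / a n i - b n 1 / a n 1))
      / (\<Sum>i=1..L. (b n i / a n i - b n 1 / a n 1)\<^sup>2)) \<longlonglongrightarrow> s"
proof (rule LIM_zero_cancel, rule Lim_null_comparison)
  define e where "e = (\<lambda>n i. t n i - (\<rho> * a n i + s * b n i))"
  \<comment> \<open>Here \<open>|g i| \<le> (|e i| + |e 1|) / c\<close>, \<open>|w i| \<le> 2 K / c\<close> and \<open>\<Sum> w\<^sup>2 \<ge> (\<delta> / K\<^sup>2)\<^sup>2\<close>.\<close>
  define h where "h = (\<lambda>n. (\<Sum>i=1..L. (\<bar>e n i\<bar> + \<bar>e n 1\<bar>) / c * (2 * K / c)) / (\<delta> / K\<^sup>2)\<^sup>2)"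
  have e: "(\<lambda>n. e n i) \<longlonglongrightarrow> 0" if "i \<in> {1..L}" for i using err[OF that] by (simp add: e_def)
  have "(\<lambda>n. \<Sum>i=1..L. (\<bar>e n i\<bar> + \<bar>e n 1\<bar>) / c * (2 * K / c)) \<longlonglongrightarrow> (\<Sum>i=1..L. (\<bar>0\<bar> + \<bar>0\<bar>) / c * (2 * K / c))"
    using L by (intro tendsto_sum tendsto_mult tendsto_divide tendsto_add tendsto_rabs tendsto_const e) (use c in auto)
  then have "(\<lambda>n. (\<Sum>i=1..L. (\<bar>e n i\<bar> + \<bar>e n 1\<bar>) / c * (2 * K / c)) * (1 / (\<delta> / K\<^sup>2)\<^sup>2)) \<longlonglongrightarrow> 0"
    by (intro tendsto_mult_left_zero) simp
  then show "h \<longlonglongrightarrow> 0" by (simp add: h_def)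
  show "\<forall>\<^sub>F n in sequentially. norm ((\<Sum>i=1..L. (t n i / a n i - t n 1 / a n 1) * (b n i / a n i - b n 1 / a n 1))
      / (\<Sum>i=1..L. (b n i / a n i - b n 1 / a n 1)\<^sup>2) - s) \<le> h n"
    using bounds det
  proof eventually_elim
    case (elim n)
    define w where "w = (\<lambda>i. b n i / a n i - b n 1 / a n 1)"
    define g where "g = (\<lambda>i. e n i / a n i - e n 1 / a n 1)"
    have bd: "c \<le> a n i" "a n i \<le> K" "c \<le> b n i" "b n i \<le> K" if "i \<in> {1..L}" for i using elim(1) that by auto
    have one: "1 \<in> {1..L}" and two: "2 \<in> {1..L}" using L by auto
    have K: "0 < K" using bd[OF one] c by linarith
    have decomp: "t n i / a n i - t n 1 / a n 1 = s * w i + g i" if i: "i \<in> {1..L}" for i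
    proof -
      have "t n j / a n j = \<rho> + s * (b n j / a n j) + e n j / a n j" if "j \<in> {1..L}" for j
        using bd(1)[OF that] c by (simp add: e_def field_simps)
      from this[OF i] this[OF one] show ?thesis by (simp add: w_def g_def algebra_simps)
    qed
    have w_le: "\<bar>w i\<bar> \<le> 2 * K / c" if i: "i \<in> {1..L}" for i
    proof -
      have r: "0 \<le> b n j / a n j" "b n j / a n j \<le> K / c" if "j \<in> {1..L}" for j
        using bd[OF that] c by (auto intro!: frac_le divide_nonneg_pos)
      have "w i \<le> K / c" "- w i \<le> K / c" using r[OF i] r[OF one] by (auto simp: w_def)
      moreover have "0 \<le> K / c" using K c by simp
      ultimately show ?thesis by (simp add: abs_le_iff)
    qed
    have g_le: "\<bar>g i\<bar> \<le> (\<bar>e n i\<bar> + \<bar>e n 1\<bar>) / c" if i: "i \<in> {1..L}" for i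
    proof -
      have r: "\<bar>e n j / a n j\<bar> \<le> \<bar>e n j\<bar> / c" if "j \<in> {1..L}" for j
        using bd(1)[OF that] c by (auto simp: abs_divide intro!: divide_left_mono)
      show ?thesis unfolding g_def
        using r[OF i] r[OF one] abs_triangle_ineq4[of "e n i / a n i" "e n 1 / a n 1"] by (simp add: add_divide_distrib)
    qed
    have w2: "(\<delta> / K\<^sup>2)\<^sup>2 \<le> (\<Sum>i=1..L. (w i)\<^sup>2)"
    proof -
      have a0: "0 < a n 1" "0 < a n 2" using bd(1)[OF one] bd(1)[OF two] c by linarith+
      have "w 2 = (a n 1 * b n 2 - a n 2 * b n 1) / (a n 1 * a n 2)"
        using a0 by (simp add: w_def field_simps)
      then have "\<bar>w 2\<bar> = \<bar>a n 1 * b n 2 - a n 2 * b n 1\<bar> / (a n 1 * a n 2)"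
        using a0 by (simp add: abs_divide)
      also have "\<delta> / K\<^sup>2 \<le> \<bar>a n 1 * b n 2 - a n 2 * b n 1\<bar> / (a n 1 * a n 2)"
        using elim(2) \<delta> a0 bd(2)[OF one] bd(2)[OF two] by (intro frac_le) (auto simp: power2_eq_square intro!: mult_mono)
      finally have "(\<delta> / K\<^sup>2)\<^sup>2 \<le> \<bar>w 2\<bar>\<^sup>2" using \<delta> by (intro power_mono) auto
      also have "\<dots> \<le> (\<Sum>i=1..L. (w i)\<^sup>2)" using two by (simp, intro member_le_sum) auto
      finally show ?thesis .
    qed
    have pos: "0 < (\<delta> / K\<^sup>2)\<^sup>2" using \<delta> K by simp
    have "(\<Sum>i=1..L. (t n i / a n i - t n 1 / a n 1) * w i) = (\<Sum>i=1..L. s * (w i)\<^sup>2 + g i * w i)"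
    proof (rule sum.cong[OF refl])
      fix i assume i: "i \<in> {1..L}"
      show "(t n i / a n i - t n 1 / a n 1) * w i = s * (w i)\<^sup>2 + g i * w i"
        unfolding decomp[OF i] by (simp add: distrib_right power2_eq_square)
    qed
    also have "\<dots> = s * (\<Sum>i=1..L. (w i)\<^sup>2) + (\<Sum>i=1..L. g i * w i)"
      by (simp add: sum.distrib sum_distrib_left)
    finally have num: "(\<Sum>i=1..L. (t n i / a n i - t n 1 / a n 1) * w i) = s * (\<Sum>i=1..L. (w i)\<^sup>2) + (\<Sum>i=1..L. g i * w i)" .
    have "0 < (\<Sum>i=1..L. (w i)\<^sup>2)" using w2 pos by linarith
    then have "(\<Sum>i=1..L. (t n i / a n i - t n 1 / a n 1) * w i) / (\<Sum>i=1..L. (w i)\<^sup>2) - s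
      = (\<Sum>i=1..L. g i * w i) / (\<Sum>i=1..L. (w i)\<^sup>2)"
      unfolding num by (simp add: field_simps)
    moreover have "\<bar>(\<Sum>i=1..L. g i * w i) / (\<Sum>i=1..L. (w i)\<^sup>2)\<bar> \<le> h n"
      unfolding h_def abs_divide
    proof (rule frac_le)
      show "(\<delta> / K\<^sup>2)\<^sup>2 \<le> \<bar>\<Sum>i=1..L. (w i)\<^sup>2\<bar>" using w2 by simp
      have "\<bar>\<Sum>i=1..L. g i * w i\<bar> \<le> (\<Sum>i=1..L. \<bar>g i * w i\<bar>)" by (rule sum_abs)
      also have "\<dots> \<le> (\<Sum>i=1..L. (\<bar>e n i\<bar> + \<bar>e n 1\<bar>) / c * (2 * K / c))"
        unfolding abs_mult using c by (intro sum_mono mult_mono g_le w_le) auto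
      finally show "\<bar>\<Sum>i=1..L. g i * w i\<bar> \<le> (\<Sum>i=1..L. (\<bar>e n i\<bar> + \<bar>e n 1\<bar>) / c * (2 * K / c))" .
      then show "0 \<le> (\<Sum>i=1..L. (\<bar>e n i\<bar> + \<bar>e n 1\<bar>) / c * (2 * K / c))" by linarith
    qed (use pos in auto)
    ultimately show ?case by (simp add: w_def)
  qed
qed

section \<open>Bounds on the coefficients\<close>

text \<open>For \<open>0 \<le> x \<le> C\<^sup>2\<close> one has \<open>Var x \<le> E x\<^sup>2 \<le> C\<^sup>2 E x\<close>. A nondegenerate spectrum thus also keeps
the coefficients \<open>a\<close> away from zero.\<close>

lemma spectral_mean_ge:
  fixes D :: "real mat"
  assumes n: "0 < dim_row D" and C: "0 < C" and bd: "\<And>i. 0 \<le> diag_entry D i \<and> diag_entry D i \<le> C"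
  shows "spectral_var D / C\<^sup>2 \<le> (\<Sum>i<dim_row D. (diag_entry D i)\<^sup>2) / dim_row D"
proof -
  define N where "N = real (dim_row D)"
  define x where "x = (\<lambda>i. (diag_entry D i)\<^sup>2)"
  define m where "m = (\<Sum>i<dim_row D. x i) / N"
  have N: "0 < N" using n by (simp add: N_def)
  have x: "0 \<le> x i" "x i \<le> C\<^sup>2" for i using bd[of i] by (auto simp: x_def intro!: power_mono)
  have "(\<Sum>i<dim_row D. (x i - m)\<^sup>2) = (\<Sum>i<dim_row D. (x i)\<^sup>2 - 2 * m * x i + m\<^sup>2)"
    by (intro sum.cong) (auto simp: power2_diff)
  also have "\<dots> = (\<Sum>i<dim_row D. (x i)\<^sup>2) - 2 * m * (\<Sum>i<dim_row D. x i) + N * m\<^sup>2"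
    by (simp add: sum.distrib sum_subtractf sum_distrib_left N_def)
  also have "(\<Sum>i<dim_row D. x i) = N * m" using N by (simp add: m_def)
  also have "(\<Sum>i<dim_row D. (x i)\<^sup>2) - 2 * m * (N * m) + N * m\<^sup>2 \<le> (\<Sum>i<dim_row D. (x i)\<^sup>2)"
    using N by (simp add: power2_eq_square)
  also have "\<dots> \<le> (\<Sum>i<dim_row D. C\<^sup>2 * x i)"
    using x by (intro sum_mono) (auto simp: power2_eq_square intro!: mult_right_mono)
  finally have "(\<Sum>i<dim_row D. (x i - m)\<^sup>2) \<le> C\<^sup>2 * (\<Sum>i<dim_row D. x i)" by (simp add: sum_distrib_left)
  then have "(\<Sum>i<dim_row D. (x i - m)\<^sup>2) / N \<le> C\<^sup>2 * (\<Sum>i<dim_row D. x i) / N"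
    using N by (intro divide_right_mono) auto
  moreover have "spectral_var D = (\<Sum>i<dim_row D. (x i - m)\<^sup>2) / N"
    by (simp add: spectral_var_def x_def m_def N_def Let_def)
  ultimately have "spectral_var D \<le> (\<Sum>i<dim_row D. x i) / N * C\<^sup>2" by (simp add: mult.commute)
  then have "spectral_var D / C\<^sup>2 \<le> (\<Sum>i<dim_row D. x i) / N"
    using C by (subst pos_divide_le_eq) auto
  then show ?thesis by (simp add: x_def N_def)
qed

lemma coef_a_eq:
  assumes "0 < l"
  shows "coef_a D l = l\<^sup>2 / aspect D * ((\<Sum>i<dim_row D. (diag_entry D i)\<^sup>2 / ((diag_entry D i)\<^sup>2 + l)\<^sup>2) / dim_row D)"
  by (simp add: coef_a_def v_minus_v'[OF assms])

lemma coef_b_eq: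
  assumes "0 < l"
  shows "coef_b D l = l\<^sup>2 * ((\<Sum>i<dim_row D. 1 / ((diag_entry D i)\<^sup>2 + l)\<^sup>2) / dim_row D)"
  by (simp add: coef_b_def v_D'_neg[OF assms])

lemma mean_le:
  fixes f :: "nat \<Rightarrow> real"
  assumes "0 < n" "\<And>i. f i \<le> c"
  shows "(\<Sum>i<n. f i) / real n \<le> c"
  using sum_bounded_above[of "{..<n}" f c] assms by (simp add: divide_le_eq mult.commute)

lemma mean_ge:
  fixes f :: "nat \<Rightarrow> real"
  assumes "0 < n" "\<And>i. c \<le> f i"
  shows "c \<le> (\<Sum>i<n. f i) / real n"
  using sum_bounded_below[of "{..<n}" c f] assms by (simp add: le_divide_eq mult.commute)

lemma resolvent_ratio_le:
  fixes x l :: real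
  assumes "0 \<le> x" "0 < l"
  shows "x / (x + l)\<^sup>2 \<le> 1 / l" "1 / (x + l)\<^sup>2 \<le> 1 / l\<^sup>2"
proof -
  have "x * l \<le> (x + l)\<^sup>2" unfolding power2_eq_square using assms by (intro mult_mono) auto
  moreover have "0 < (x + l)\<^sup>2" using assms by simp
  moreover have "t / v \<le> 1 / u" if "t * u \<le> v" "0 < v" "0 < u" for t u v :: real
    using that by (simp add: field_simps)
  ultimately show "x / (x + l)\<^sup>2 \<le> 1 / l" using assms by blast
  have "l\<^sup>2 \<le> (x + l)\<^sup>2" using assms by (intro power_mono) auto
  then show "1 / (x + l)\<^sup>2 \<le> 1 / l\<^sup>2" using assms by (intro frac_le) auto
qed

lemma coef_b_bounds:
  fixes D :: "real mat"
  assumes n: "0 < dim_row D" and bd: "\<And>i. 0 \<le> diag_entry D i \<and> diag_entry D i \<le> C" and l: "0 < l"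
  shows "l\<^sup>2 / (C\<^sup>2 + l)\<^sup>2 \<le> coef_b D l" "coef_b D l \<le> 1"
proof -
  have "1 / (C\<^sup>2 + l)\<^sup>2 \<le> 1 / ((diag_entry D i)\<^sup>2 + l)\<^sup>2" for i
  proof (rule frac_le)
    show "((diag_entry D i)\<^sup>2 + l)\<^sup>2 \<le> (C\<^sup>2 + l)\<^sup>2" using bd[of i] l by (intro power_mono add_mono) auto
    have "0 < (diag_entry D i)\<^sup>2 + l" using l by (simp add: add_nonneg_pos)
    then show "0 < ((diag_entry D i)\<^sup>2 + l)\<^sup>2" by simp
  qed auto
  from mean_ge[OF n this] have "l\<^sup>2 * (1 / (C\<^sup>2 + l)\<^sup>2) \<le> coef_b D l"
    unfolding coef_b_eq[OF l] by (intro mult_left_mono) auto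
  then show "l\<^sup>2 / (C\<^sup>2 + l)\<^sup>2 \<le> coef_b D l" by simp
  have "coef_b D l \<le> l\<^sup>2 * (1 / l\<^sup>2)"
    unfolding coef_b_eq[OF l] using resolvent_ratio_le(2)[OF _ l] by (intro mult_left_mono mean_le n) auto
  then show "coef_b D l \<le> 1" using l by simp
qed

lemma coef_a_bounds:
  fixes D :: "real mat"
  assumes n: "0 < dim_row D" and C: "0 < C" and bd: "\<And>i. 0 \<le> diag_entry D i \<and> diag_entry D i \<le> C" and l: "0 < l"
    and asp: "0 < g1" "g1 \<le> aspect D" "aspect D \<le> g2" and v0: "0 < v0" "v0 \<le> spectral_var D"
  shows "l\<^sup>2 / g2 * (v0 / C\<^sup>2 / (C\<^sup>2 + l)\<^sup>2) \<le> coef_a D l" "coef_a D l \<le> l\<^sup>2 / g1 * (1 / l)"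
proof -
  let ?m = "(\<Sum>i<dim_row D. (diag_entry D i)\<^sup>2 / ((diag_entry D i)\<^sup>2 + l)\<^sup>2) / dim_row D"
  have "v0 / C\<^sup>2 \<le> spectral_var D / C\<^sup>2" using v0 by (intro divide_right_mono) auto
  also note spectral_mean_ge[OF n C bd]
  finally have "v0 / C\<^sup>2 / (C\<^sup>2 + l)\<^sup>2 \<le> (\<Sum>i<dim_row D. (diag_entry D i)\<^sup>2) / dim_row D / (C\<^sup>2 + l)\<^sup>2"
    by (intro divide_right_mono) auto
  also have "\<dots> = (\<Sum>i<dim_row D. (diag_entry D i)\<^sup>2 / (C\<^sup>2 + l)\<^sup>2) / dim_row D"
    by (simp add: sum_divide_distrib mult.commute)
  also have "\<dots> \<le> ?m"
  proof (intro divide_right_mono sum_mono divide_left_mono)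
    fix i
    show "((diag_entry D i)\<^sup>2 + l)\<^sup>2 \<le> (C\<^sup>2 + l)\<^sup>2" using bd[of i] l by (intro power_mono add_mono) auto
    have "0 < (diag_entry D i)\<^sup>2 + l" "0 < C\<^sup>2 + l" using l by (simp_all add: add_nonneg_pos)
    then show "0 < (C\<^sup>2 + l)\<^sup>2 * ((diag_entry D i)\<^sup>2 + l)\<^sup>2" by simp
  qed auto
  finally have m: "v0 / C\<^sup>2 / (C\<^sup>2 + l)\<^sup>2 \<le> ?m" .
  have pos: "0 < v0 / C\<^sup>2 / (C\<^sup>2 + l)\<^sup>2" using v0 C l by (intro divide_pos_pos zero_less_power add_nonneg_pos) auto
  show "l\<^sup>2 / g2 * (v0 / C\<^sup>2 / (C\<^sup>2 + l)\<^sup>2) \<le> coef_a D l"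
    unfolding coef_a_eq[OF l]
  proof (rule mult_mono[OF _ m])
    show "l\<^sup>2 / g2 \<le> l\<^sup>2 / aspect D" using asp by (intro frac_le) auto
  qed (use asp pos in auto)
  have m2: "?m \<le> 1 / l" using resolvent_ratio_le(1)[OF _ l] by (intro mean_le n) auto
  show "coef_a D l \<le> l\<^sup>2 / g1 * (1 / l)"
    unfolding coef_a_eq[OF l]
  proof (rule mult_mono[OF _ m2])
    show "l\<^sup>2 / aspect D \<le> l\<^sup>2 / g1" using asp by (intro frac_le) auto
    show "0 \<le> ?m" using m pos by linarith
  qed (use asp in auto)
qed

text \<open>The symmetrization behind Chebyshev's sum inequality. The determinant is a double sum over
pairs; after exchange of \<open>i\<close> and \<open>j\<close> each pair contributes
\<open>(x_i - x_j) (1 / P_ij\<^sup>2 - 1 / P_ji\<^sup>2)\<close>, where \<open>P_ji - P_ij = (l2 - l1) (x_i - x_j)\<close>, hence at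
least a multiple of \<open>(x_i - x_j)\<^sup>2\<close>. The mean of these squares over all pairs is twice the
variance.\<close>

lemma resolvent_moment_determinant:
  fixes x :: "nat \<Rightarrow> real"
  assumes n: "0 < n" and x: "\<And>i. 0 \<le> x i \<and> x i \<le> B" and l: "0 < l1" "l1 < l2"
  defines "m \<equiv> (\<Sum>i<n. x i) / real n"
  shows "2 * l1 * l2 * (l2 - l1) / (B + l2) ^ 8 * ((\<Sum>i<n. (x i - m)\<^sup>2) / real n) \<le>
    (\<Sum>i<n. x i / (x i + l2)\<^sup>2) / real n * ((\<Sum>i<n. 1 / (x i + l1)\<^sup>2) / real n)
    - (\<Sum>i<n. x i / (x i + l1)\<^sup>2) / real n * ((\<Sum>i<n. 1 / (x i + l2)\<^sup>2) / real n)"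
proof -
  \<comment> \<open>The squared entries of \<open>P\<close> are the common denominators in the products of the two sums.\<close>
  define P where "P = (\<lambda>i j. (x i + l2) * (x j + l1))"
  define k where "k = 2 * l1 * l2 * (l2 - l1) / (B + l2) ^ 8"
  have B: "0 \<le> B" using x[of 0] by linarith
  have P: "l2 * l1 \<le> P i j" "P i j \<le> (B + l2) * (B + l2)" for i j
    unfolding P_def using x[of i] x[of j] l by (auto intro!: mult_mono)
  have l12: "0 < l2 * l1" using l by simp
  have P0: "0 < P i j" for i j using P(1)[of i j] l12 by linarith
  have pair_ge: "k * (x i - x j)\<^sup>2 \<le> (x i - x j) * (1 / (P i j)\<^sup>2 - 1 / (P j i)\<^sup>2)" for i j
  proof -
    have diff: "P j i - P i j = (l2 - l1) * (x i - x j)" by (simp add: P_def algebra_simps)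
    have "1 / (P i j)\<^sup>2 - 1 / (P j i)\<^sup>2 = ((P j i)\<^sup>2 - (P i j)\<^sup>2) / ((P i j)\<^sup>2 * (P j i)\<^sup>2)"
      using P0[of i j] P0[of j i] by (simp add: field_simps)
    also have "(P j i)\<^sup>2 - (P i j)\<^sup>2 = (P j i - P i j) * (P j i + P i j)" by (simp add: power2_eq_square algebra_simps)
    finally have eq: "(x i - x j) * (1 / (P i j)\<^sup>2 - 1 / (P j i)\<^sup>2)
      = (x i - x j)\<^sup>2 * ((l2 - l1) * (P j i + P i j) / ((P i j)\<^sup>2 * (P j i)\<^sup>2))"
      unfolding diff by (simp add: power2_eq_square mult_ac)
    have "k \<le> (l2 - l1) * (P j i + P i j) / ((P i j)\<^sup>2 * (P j i)\<^sup>2)"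
      unfolding k_def
    proof (rule frac_le)
      have "(l2 - l1) * (2 * (l2 * l1)) \<le> (l2 - l1) * (P j i + P i j)"
        using P(1)[of i j] P(1)[of j i] l by (intro mult_left_mono) auto
      then show "2 * l1 * l2 * (l2 - l1) \<le> (l2 - l1) * (P j i + P i j)" by (simp add: mult_ac)
      show "0 \<le> (l2 - l1) * (P j i + P i j)" using P0[of i j] P0[of j i] l by simp
      show "0 < (P i j)\<^sup>2 * (P j i)\<^sup>2" using P0[of i j] P0[of j i] by simp
      have "(P i j)\<^sup>2 * (P j i)\<^sup>2 \<le> ((B + l2) * (B + l2))\<^sup>2 * ((B + l2) * (B + l2))\<^sup>2"
        using P P0[THEN less_imp_le] by (intro mult_mono power_mono) auto
      also have "\<dots> = (B + l2) ^ 8" by (simp add: power_mult_distrib power_add[symmetric])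
      finally show "(P i j)\<^sup>2 * (P j i)\<^sup>2 \<le> (B + l2) ^ 8" .
    qed
    then have "(x i - x j)\<^sup>2 * k \<le> (x i - x j)\<^sup>2 * ((l2 - l1) * (P j i + P i j) / ((P i j)\<^sup>2 * (P j i)\<^sup>2))"
      by (rule mult_left_mono) simp
    then show ?thesis unfolding eq by (simp add: mult.commute)
  qed
  define Z where "Z = (\<Sum>i<n. \<Sum>j<n. (x i - x j) / (P i j)\<^sup>2)"
  have Z: "(\<Sum>i<n. x i / (x i + l2)\<^sup>2) * (\<Sum>i<n. 1 / (x i + l1)\<^sup>2) - (\<Sum>i<n. x i / (x i + l1)\<^sup>2) * (\<Sum>i<n. 1 / (x i + l2)\<^sup>2) = Z"
  proof -
    have "(\<Sum>i<n. x i / (x i + l2)\<^sup>2) * (\<Sum>i<n. 1 / (x i + l1)\<^sup>2) = (\<Sum>i<n. \<Sum>j<n. x i / (P i j)\<^sup>2)"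
      by (simp add: sum_product P_def power_mult_distrib)
    moreover have "(\<Sum>i<n. x i / (x i + l1)\<^sup>2) * (\<Sum>i<n. 1 / (x i + l2)\<^sup>2) = (\<Sum>i<n. \<Sum>j<n. x j / (P i j)\<^sup>2)"
      by (subst mult.commute) (simp add: sum_product P_def power_mult_distrib)
    ultimately show ?thesis by (simp add: Z_def sum_subtractf diff_divide_distrib)
  qed
  have "2 * Z = Z + (\<Sum>i<n. \<Sum>j<n. (x j - x i) / (P j i)\<^sup>2)"
    unfolding Z_def by (subst (3) sum.swap) simp
  also have "\<dots> = (\<Sum>i<n. \<Sum>j<n. (x i - x j) * (1 / (P i j)\<^sup>2 - 1 / (P j i)\<^sup>2))"
    unfolding Z_def sum.distrib[symmetric] by (intro sum.cong refl) (simp add: algebra_simps diff_divide_distrib)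
  also have "(\<Sum>i<n. \<Sum>j<n. k * (x i - x j)\<^sup>2) \<le> \<dots>" by (intro sum_mono pair_ge)
  finally have Z_ge: "(\<Sum>i<n. \<Sum>j<n. k * (x i - x j)\<^sup>2) \<le> 2 * Z" .
  define N where "N = real n"
  have N: "0 < N" using n by (simp add: N_def)
  have mN: "(\<Sum>i<n. x i) = N * m" using n by (simp add: m_def N_def)
  have var: "(\<Sum>i<n. (x i - m)\<^sup>2) = (\<Sum>i<n. (x i)\<^sup>2) - N * m\<^sup>2"
  proof -
    have "(\<Sum>i<n. (x i - m)\<^sup>2) = (\<Sum>i<n. (x i)\<^sup>2 - 2 * m * x i + m\<^sup>2)"
      by (intro sum.cong) (auto simp: power2_diff)
    also have "\<dots> = (\<Sum>i<n. (x i)\<^sup>2) - 2 * m * (\<Sum>i<n. x i) + N * m\<^sup>2"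
      by (simp add: sum.distrib sum_subtractf sum_distrib_left N_def)
    finally show ?thesis unfolding mN by (simp add: power2_eq_square)
  qed
  have "(\<Sum>i<n. \<Sum>j<n. (x i - x j)\<^sup>2) = (\<Sum>i<n. \<Sum>j<n. (x i)\<^sup>2 - 2 * x i * x j + (x j)\<^sup>2)"
    by (intro sum.cong refl) (simp add: power2_diff)
  also have "\<dots> = (\<Sum>i<n. N * (x i)\<^sup>2 - 2 * (\<Sum>j<n. x j) * x i + (\<Sum>j<n. (x j)\<^sup>2))"
    by (intro sum.cong refl) (simp add: sum.distrib sum_subtractf sum_distrib_left[symmetric] N_def)
  also have "\<dots> = N * (\<Sum>i<n. (x i)\<^sup>2) - 2 * ((\<Sum>i<n. x i) * (\<Sum>j<n. x j)) + N * (\<Sum>j<n. (x j)\<^sup>2)"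
    by (simp add: sum.distrib sum_subtractf sum_distrib_left[symmetric] N_def)
  also have "\<dots> = 2 * N * (\<Sum>i<n. (x i - m)\<^sup>2)"
    unfolding var mN by (simp add: algebra_simps power2_eq_square)
  finally have pairs: "(\<Sum>i<n. \<Sum>j<n. (x i - x j)\<^sup>2) = 2 * N * (\<Sum>i<n. (x i - m)\<^sup>2)" .
  have "k * (2 * N * (\<Sum>i<n. (x i - m)\<^sup>2)) \<le> 2 * Z"
    using Z_ge unfolding pairs[symmetric] by (simp add: sum_distrib_left)
  then have "k * (\<Sum>i<n. (x i - m)\<^sup>2) * N \<le> Z" by (simp add: mult_ac)
  then have "k * (\<Sum>i<n. (x i - m)\<^sup>2) * N / (N * N) \<le> Z / (N * N)"
    using N by (intro divide_right_mono) auto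
  moreover have "k * (\<Sum>i<n. (x i - m)\<^sup>2) * N / (N * N) = k * ((\<Sum>i<n. (x i - m)\<^sup>2) / N)"
    using N by simp
  ultimately show ?thesis
    unfolding k_def[symmetric] N_def[symmetric] Z[symmetric] by (simp add: diff_divide_distrib)
qed

lemma coef_determinant_ge:
  fixes D :: "real mat"
  assumes n: "0 < dim_row D" and bd: "\<And>i. 0 \<le> diag_entry D i \<and> diag_entry D i \<le> C" and l: "0 < l1" "l1 < l2"
    and asp: "0 < aspect D" "aspect D \<le> g2" and v0: "0 < v0" "v0 \<le> spectral_var D"
  shows "l1\<^sup>2 * l2\<^sup>2 / g2 * (2 * l1 * l2 * (l2 - l1) / (C\<^sup>2 + l2) ^ 8 * v0)
    \<le> \<bar>coef_a D l1 * coef_b D l2 - coef_a D l2 * coef_b D l1\<bar>"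
proof -
  let ?x = "\<lambda>i. (diag_entry D i)\<^sup>2"
  define A where "A = (\<lambda>l. (\<Sum>i<dim_row D. ?x i / (?x i + l)\<^sup>2) / dim_row D)"
  define T where "T = (\<lambda>l. (\<Sum>i<dim_row D. 1 / (?x i + l)\<^sup>2) / dim_row D)"
  have l2: "0 < l2" using l by simp
  define k where "k = 2 * l1 * l2 * (l2 - l1) / (C\<^sup>2 + l2) ^ 8"
  have k: "0 \<le> k" using l by (simp add: k_def)
  have "k * spectral_var D \<le> A l2 * T l1 - A l1 * T l2"
    using resolvent_moment_determinant[OF n, of ?x "C\<^sup>2" l1 l2] bd l
    by (simp add: A_def T_def k_def spectral_var_def Let_def power_mono)
  moreover have "k * v0 \<le> k * spectral_var D" using v0 k by (intro mult_left_mono) auto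
  ultimately have kv: "k * v0 \<le> A l2 * T l1 - A l1 * T l2" by linarith
  have "coef_a D l2 * coef_b D l1 - coef_a D l1 * coef_b D l2 = l1\<^sup>2 * l2\<^sup>2 / aspect D * (A l2 * T l1 - A l1 * T l2)"
  proof -
    have "coef_a D l = l\<^sup>2 / aspect D * A l" "coef_b D l = l\<^sup>2 * T l" if "0 < l" for l
      using coef_a_eq[OF that] coef_b_eq[OF that] by (simp_all add: A_def T_def)
    then show ?thesis using l l2 by (simp add: algebra_simps diff_divide_distrib)
  qed
  moreover have "l1\<^sup>2 * l2\<^sup>2 / g2 * (k * v0) \<le> l1\<^sup>2 * l2\<^sup>2 / aspect D * (A l2 * T l1 - A l1 * T l2)"
  proof (rule mult_mono[OF _ kv])
    show "l1\<^sup>2 * l2\<^sup>2 / g2 \<le> l1\<^sup>2 * l2\<^sup>2 / aspect D" using asp by (intro frac_le) auto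
  qed (use k v0 asp in auto)
  ultimately show ?thesis unfolding k_def[symmetric] by linarith
qed

section \<open>Uniformity in the penalty\<close>

text \<open>The Lipschitz constants of \<open>1 / z\<close> and \<open>1 / z\<^sup>2\<close> on \<open>[a, \<infinity>)\<close>, added up so that one constant
serves both exponents.\<close>

definition resolvent_lip :: "real \<Rightarrow> real" where "resolvent_lip a = 1 / a\<^sup>2 + 2 / a ^ 3"

lemma resolvent_power_Lipschitz:
  fixes x a l l' :: real
  assumes "0 \<le> x" "0 < a" "a \<le> l" "a \<le> l'" and k: "k = 1 \<or> k = 2"
  shows "\<bar>1 / (x + l) ^ k - 1 / (x + l') ^ k\<bar> \<le> resolvent_lip a * \<bar>l - l'\<bar>"
proof -
  define s s' where "s = x + l" and "s' = x + l'"
  have s: "a \<le> s" "a \<le> s'" "0 < s" "0 < s'" using assms by (auto simp: s_def s'_def)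
  have "1 / s - 1 / s' = (l' - l) / (s * s')" using s by (simp add: field_simps s_def s'_def)
  then have "\<bar>1 / s - 1 / s'\<bar> = \<bar>l - l'\<bar> / (s * s')" using s by (simp add: abs_divide abs_minus_commute)
  also have "\<dots> \<le> \<bar>l - l'\<bar> / (a * a)" using s assms by (intro divide_left_mono mult_mono mult_pos_pos) auto
  finally have d1: "\<bar>1 / s - 1 / s'\<bar> \<le> 1 / a\<^sup>2 * \<bar>l - l'\<bar>" by (simp add: power2_eq_square)
  have "1 / s \<le> 1 / a" "1 / s' \<le> 1 / a" using s assms by (auto intro!: divide_left_mono)
  then have "\<bar>1 / s + 1 / s'\<bar> \<le> 2 / a" using s by (simp add: abs_of_nonneg)
  then have "\<bar>1 / s - 1 / s'\<bar> * \<bar>1 / s + 1 / s'\<bar> \<le> (1 / a\<^sup>2 * \<bar>l - l'\<bar>) * (2 / a)"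
    using d1 by (intro mult_mono) auto
  also have "\<dots> = 2 / a ^ 3 * \<bar>l - l'\<bar>" by (simp add: power2_eq_square power3_eq_cube)
  also have "\<bar>1 / s - 1 / s'\<bar> * \<bar>1 / s + 1 / s'\<bar> = \<bar>1 / s\<^sup>2 - 1 / s'\<^sup>2\<bar>"
    by (simp add: abs_mult[symmetric] algebra_simps power2_eq_square)
  finally have d2: "\<bar>1 / s\<^sup>2 - 1 / s'\<^sup>2\<bar> \<le> 2 / a ^ 3 * \<bar>l - l'\<bar>" .
  have "0 \<le> 1 / a\<^sup>2 * \<bar>l - l'\<bar>" "0 \<le> 2 / a ^ 3 * \<bar>l - l'\<bar>" using assms by auto
  then show ?thesis using d1 d2 k unfolding s_def[symmetric] s'_def[symmetric] resolvent_lip_def distrib_right by auto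
qed

lemma weighted_resolvent_Lipschitz:
  fixes w x :: "nat \<Rightarrow> real"
  assumes "\<And>i. 0 \<le> x i" "0 < a" "a \<le> l" "a \<le> l'" "k = 1 \<or> k = 2" and w: "(\<Sum>i\<in>I. \<bar>w i\<bar>) \<le> B"
  shows "\<bar>(\<Sum>i\<in>I. w i / (x i + l) ^ k) - (\<Sum>i\<in>I. w i / (x i + l') ^ k)\<bar> \<le> B * (resolvent_lip a * \<bar>l - l'\<bar>)"
proof -
  have L: "0 \<le> resolvent_lip a * \<bar>l - l'\<bar>" using assms(2) by (simp add: resolvent_lip_def)
  have "(\<Sum>i\<in>I. w i / (x i + l) ^ k) - (\<Sum>i\<in>I. w i / (x i + l') ^ k) = (\<Sum>i\<in>I. w i * (1 / (x i + l) ^ k - 1 / (x i + l') ^ k))"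
    by (simp add: sum_subtractf[symmetric] right_diff_distrib)
  also have "\<bar>\<dots>\<bar> \<le> (\<Sum>i\<in>I. \<bar>w i * (1 / (x i + l) ^ k - 1 / (x i + l') ^ k)\<bar>)" by (rule sum_abs)
  also have "\<dots> \<le> (\<Sum>i\<in>I. \<bar>w i\<bar> * (resolvent_lip a * \<bar>l - l'\<bar>))"
    unfolding abs_mult using assms by (intro sum_mono mult_left_mono resolvent_power_Lipschitz) auto
  also have "\<dots> = (\<Sum>i\<in>I. \<bar>w i\<bar>) * (resolvent_lip a * \<bar>l - l'\<bar>)" by (simp add: sum_distrib_right)
  also have "\<dots> \<le> B * (resolvent_lip a * \<bar>l - l'\<bar>)" using w L by (rule mult_right_mono)
  finally show ?thesis .
qed

lemma sum_coord_squares: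
  assumes "orth_mat k V" "b \<in> carrier_vec k"
  shows "(\<Sum>i<k. (coord V k b i)\<^sup>2) = b \<bullet> b"
proof -
  have "(\<Sum>i<k. (coord V k b i)\<^sup>2) = (V *\<^sub>v b) \<bullet> (V *\<^sub>v b)"
    using orth_mat_carrier[OF assms(1)] by (simp add: coord_def scalar_prod_def lessThan_atLeast0 power2_eq_square)
  then show ?thesis using orth_mat_scalar_prod[OF assms(1,2,2)] by simp
qed

text \<open>The weights of the resolvent sums have total mass \<open>r\<^sup>2 n\<close> for the signal and \<open>|e|\<^sup>2\<close> for the
noise, and at most \<open>C\<close> times their sum for the cross form. After division by \<open>n\<close> the constants
stay bounded as long as \<open>|e|\<^sup>2 / n\<close> does.\<close>

lemma
  assumes svd: "is_svd n p x Q D W" and b: "b \<in> carrier_vec p" and e: "e \<in> carrier_vec n"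
    and n: "0 < n" and p: "0 < p" and a: "0 < a" "a \<le> l" "a \<le> l'" and norm_b: "b \<bullet> b = r\<^sup>2 * real n"
  shows signal_dev_Lipschitz: "k = 1 \<or> k = 2 \<Longrightarrow>
      \<bar>signal_dev n p r x b k l - signal_dev n p r x b k l'\<bar> \<le> 2 * r\<^sup>2 * resolvent_lip a * \<bar>l - l'\<bar>"
    and noise_dev_Lipschitz: "k = 1 \<or> k = 2 \<Longrightarrow>
      \<bar>noise_dev n \<sigma> x e k l - noise_dev n \<sigma> x e k l'\<bar> \<le> (e \<bullet> e / real n + \<sigma>\<^sup>2) * resolvent_lip a * \<bar>l - l'\<bar>"
    and cross_form_Lipschitz: "(\<And>i. 0 \<le> diag_entry D i \<and> diag_entry D i \<le> C) \<Longrightarrow>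
      \<bar>cross_form x l b e / real n - cross_form x l' b e / real n\<bar> \<le> C * (r\<^sup>2 + e \<bullet> e / real n) * resolvent_lip a * \<bar>l - l'\<bar>"
proof -
  note c = is_svd_carrier[OF svd]
  have l: "0 < l" "0 < l'" using a by auto
  define \<Delta> where "\<Delta> = resolvent_lip a * \<bar>l - l'\<bar>"
  have scale: "\<bar>z\<^sup>2 * t\<bar> \<le> z\<^sup>2 * \<Delta>" if "\<bar>t\<bar> \<le> \<Delta>" for z t :: real
    using mult_left_mono[OF that, of "z\<^sup>2"] by (simp add: abs_mult)
  let ?x = "\<lambda>i. (diag_entry D i)\<^sup>2"
  have ub: "(\<Sum>i<p. \<bar>(coord W p b i)\<^sup>2\<bar>) \<le> r\<^sup>2 * real n"
    using sum_coord_squares[OF c(6) b] norm_b by simp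
  have qe: "(\<Sum>i<n. \<bar>(coord Q n e i)\<^sup>2\<bar>) \<le> e \<bullet> e"
    using sum_coord_squares[OF c(5) e] by simp
  have ee: "0 \<le> e \<bullet> e" by (simp add: scalar_prod_def sum_nonneg)
  show "\<bar>signal_dev n p r x b k l - signal_dev n p r x b k l'\<bar> \<le> 2 * r\<^sup>2 * resolvent_lip a * \<bar>l - l'\<bar>" if k: "k = 1 \<or> k = 2"
  proof -
    let ?F = "\<lambda>l. (\<Sum>i<p. (coord W p b i)\<^sup>2 / (?x i + l) ^ k)" and ?T = "\<lambda>l. (\<Sum>i<p. 1 / (?x i + l) ^ k)"
    have F: "\<bar>?F l - ?F l'\<bar> \<le> (r\<^sup>2 * real n) * \<Delta>"
      unfolding \<Delta>_def using a k by (intro weighted_resolvent_Lipschitz ub) auto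
    have T: "\<bar>?T l - ?T l'\<bar> \<le> real p * \<Delta>"
      unfolding \<Delta>_def using a k by (intro weighted_resolvent_Lipschitz) auto
    have "signal_dev n p r x b k l - signal_dev n p r x b k l' = (?F l - ?F l') / real n - r\<^sup>2 * ((?T l - ?T l') / real p)"
      unfolding signal_dev_def resolvent_form_gram_coord[OF svd l(1) b] resolvent_form_gram_coord[OF svd l(2) b]
        resolvent_trace_gram[OF svd l(1)] resolvent_trace_gram[OF svd l(2)]
      by (simp add: diff_divide_distrib right_diff_distrib)
    moreover have "\<bar>(?F l - ?F l') / real n\<bar> \<le> r\<^sup>2 * \<Delta>"
      using F n by (simp add: abs_divide divide_le_eq mult_ac)
    moreover have "\<bar>(?T l - ?T l') / real p\<bar> \<le> \<Delta>"
      using T p by (simp add: abs_divide divide_le_eq mult_ac)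
    then have "\<bar>r\<^sup>2 * ((?T l - ?T l') / real p)\<bar> \<le> r\<^sup>2 * \<Delta>"
      by (rule scale)
    ultimately have "\<bar>signal_dev n p r x b k l - signal_dev n p r x b k l'\<bar> \<le> 2 * (r\<^sup>2 * \<Delta>)" by linarith
    then show ?thesis by (simp add: \<Delta>_def mult_ac)
  qed
  show "\<bar>noise_dev n \<sigma> x e k l - noise_dev n \<sigma> x e k l'\<bar> \<le> (e \<bullet> e / real n + \<sigma>\<^sup>2) * resolvent_lip a * \<bar>l - l'\<bar>" if k: "k = 1 \<or> k = 2"
  proof -
    let ?F = "\<lambda>l. (\<Sum>i<n. (coord Q n e i)\<^sup>2 / (?x i + l) ^ k)" and ?T = "\<lambda>l. (\<Sum>i<n. 1 / (?x i + l) ^ k)"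
    have F: "\<bar>?F l - ?F l'\<bar> \<le> (e \<bullet> e) * \<Delta>"
      unfolding \<Delta>_def using a k by (intro weighted_resolvent_Lipschitz qe) auto
    have T: "\<bar>?T l - ?T l'\<bar> \<le> real n * \<Delta>"
      unfolding \<Delta>_def using a k by (intro weighted_resolvent_Lipschitz) auto
    have "noise_dev n \<sigma> x e k l - noise_dev n \<sigma> x e k l' = (?F l - ?F l') / real n - \<sigma>\<^sup>2 * ((?T l - ?T l') / real n)"
      unfolding noise_dev_def resolvent_form_cogram_coord[OF svd l(1) e] resolvent_form_cogram_coord[OF svd l(2) e]
        resolvent_trace_cogram[OF svd l(1)] resolvent_trace_cogram[OF svd l(2)]
      by (simp add: diff_divide_distrib right_diff_distrib)
    moreover have "\<bar>(?F l - ?F l') / real n\<bar> \<le> (e \<bullet> e / real n) * \<Delta>"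
      using F n by (simp add: abs_divide divide_right_mono)
    moreover have "\<bar>(?T l - ?T l') / real n\<bar> \<le> \<Delta>"
      using T n by (simp add: abs_divide divide_le_eq mult_ac)
    then have "\<bar>\<sigma>\<^sup>2 * ((?T l - ?T l') / real n)\<bar> \<le> \<sigma>\<^sup>2 * \<Delta>"
      by (rule scale)
    ultimately have "\<bar>noise_dev n \<sigma> x e k l - noise_dev n \<sigma> x e k l'\<bar> \<le> (e \<bullet> e / real n) * \<Delta> + \<sigma>\<^sup>2 * \<Delta>" by linarith
    then show ?thesis by (simp add: \<Delta>_def algebra_simps)
  qed
  show "\<bar>cross_form x l b e / real n - cross_form x l' b e / real n\<bar> \<le> C * (r\<^sup>2 + e \<bullet> e / real n) * resolvent_lip a * \<bar>l - l'\<bar>"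
    if C: "\<And>i. 0 \<le> diag_entry D i \<and> diag_entry D i \<le> C"
  proof -
    let ?w = "\<lambda>i. diag_entry D i * coord W p b i * coord Q n e i"
    let ?F = "\<lambda>l. (\<Sum>i<n. ?w i / (?x i + l)\<^sup>2)"
    have C0: "0 \<le> C" using C[of 0] by linarith
    have "(\<Sum>i<n. \<bar>?w i\<bar>) \<le> (\<Sum>i<n. C * ((coord W p b i)\<^sup>2 + (coord Q n e i)\<^sup>2))"
    proof (rule sum_mono)
      fix i
      have "\<bar>?w i\<bar> = diag_entry D i * (\<bar>coord W p b i\<bar> * \<bar>coord Q n e i\<bar>)" using C[of i] by (simp add: abs_mult)
      also have "\<dots> \<le> C * ((coord W p b i)\<^sup>2 + (coord Q n e i)\<^sup>2)"
      proof (rule mult_mono)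
        have "0 \<le> \<bar>coord W p b i\<bar> * \<bar>coord Q n e i\<bar>" by simp
        moreover have "2 * (\<bar>coord W p b i\<bar> * \<bar>coord Q n e i\<bar>) \<le> (coord W p b i)\<^sup>2 + (coord Q n e i)\<^sup>2"
          using sum_squares_bound[of "\<bar>coord W p b i\<bar>" "\<bar>coord Q n e i\<bar>"] by (simp add: mult.assoc)
        ultimately show "\<bar>coord W p b i\<bar> * \<bar>coord Q n e i\<bar> \<le> (coord W p b i)\<^sup>2 + (coord Q n e i)\<^sup>2" by linarith
      qed (use C[of i] C0 in auto)
      finally show "\<bar>?w i\<bar> \<le> C * ((coord W p b i)\<^sup>2 + (coord Q n e i)\<^sup>2)" .
    qed
    also have "\<dots> = C * ((\<Sum>i<n. (coord W p b i)\<^sup>2) + (\<Sum>i<n. (coord Q n e i)\<^sup>2))"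
      by (simp add: sum.distrib sum_distrib_left[symmetric])
    also have "\<dots> \<le> C * (r\<^sup>2 * real n + e \<bullet> e)"
    proof (intro mult_left_mono add_mono C0)
      have "(\<Sum>i<n. (coord W p b i)\<^sup>2) \<le> (\<Sum>i<max n p. (coord W p b i)\<^sup>2)" by (intro sum_mono2) auto
      also have "\<dots> = (\<Sum>i<p. (coord W p b i)\<^sup>2)" by (intro sum.mono_neutral_right) (auto simp: coord_def)
      finally show "(\<Sum>i<n. (coord W p b i)\<^sup>2) \<le> r\<^sup>2 * real n" using ub by simp
    qed (use qe in simp)
    finally have w: "(\<Sum>i<n. \<bar>?w i\<bar>) \<le> C * (r\<^sup>2 * real n + e \<bullet> e)" .
    have "\<bar>?F l - ?F l'\<bar> \<le> (C * (r\<^sup>2 * real n + e \<bullet> e)) * \<Delta>"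
      unfolding \<Delta>_def using a by (intro weighted_resolvent_Lipschitz w) auto
    then have "\<bar>(?F l - ?F l') / real n\<bar> \<le> (C * (r\<^sup>2 * real n + e \<bullet> e)) * \<Delta> / real n"
      by (simp add: abs_divide divide_right_mono)
    also have "\<dots> = C * (r\<^sup>2 + e \<bullet> e / real n) * \<Delta>" using n by (simp add: field_simps)
    finally show ?thesis
      unfolding cross_form_coord[OF svd l(1) b e] cross_form_coord[OF svd l(2) b e] \<Delta>_def
      by (simp add: diff_divide_distrib mult_ac)
  qed
qed

text \<open>A finite net of rational points suffices for each accuracy.\<close>

lemma uniform_limit_of_equi_Lipschitz:
  fixes f :: "nat \<Rightarrow> real \<Rightarrow> real"
  assumes ab: "a < b"
    and lip: "\<forall>\<^sub>F n in sequentially. \<forall>l\<in>{a..b}. \<forall>l'\<in>{a..b}. \<bar>f n l - f n l'\<bar> \<le> K * \<bar>l - l'\<bar>"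
    and conv: "\<And>l. l \<in> \<rat> \<Longrightarrow> l \<in> {a..b} \<Longrightarrow> (\<lambda>n. f n l) \<longlonglongrightarrow> 0"
  shows "uniform_limit {a..b} f (\<lambda>_. 0) sequentially"
proof (rule uniform_limitI)
  fix e :: real assume e: "0 < e"
  define B where "B = \<bar>K\<bar> + 1"
  have B: "0 < B" "K \<le> B" by (auto simp: B_def)
  define d where "d = e / (2 * B)"
  have d: "0 < d" using e B by (simp add: d_def)
  have "{a..b} \<subseteq> (\<Union>q\<in>\<rat> \<inter> {a..b}. ball q d)"
  proof
    fix l assume l: "l \<in> {a..b}"
    then have "max a (l - d) < min b (l + d)" using ab d by auto
    then obtain q where "q \<in> \<rat>" "max a (l - d) < q" "q < min b (l + d)" using Rats_dense_in_real by blast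
    then show "l \<in> (\<Union>q\<in>\<rat> \<inter> {a..b}. ball q d)" by (intro UN_I[of q]) (auto simp: dist_real_def)
  qed
  then obtain F where F: "F \<subseteq> \<rat> \<inter> {a..b}" "finite F" "{a..b} \<subseteq> (\<Union>q\<in>F. ball q d)"
    by (rule compactE_image[OF compact_Icc, rotated]) auto
  have "\<forall>\<^sub>F n in sequentially. \<forall>q\<in>F. \<bar>f n q\<bar> < e / 2"
  proof (rule eventually_ball_finite[OF F(2)], rule)
    fix q assume "q \<in> F"
    then have "q \<in> \<rat>" "q \<in> {a..b}" using F(1) by blast+
    then have "(\<lambda>n. f n q) \<longlonglongrightarrow> 0" by (rule conv)
    then show "\<forall>\<^sub>F n in sequentially. \<bar>f n q\<bar> < e / 2"
      using e tendstoD[of "\<lambda>n. f n q" 0 sequentially "e / 2"] by (simp add: dist_real_def)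
  qed
  then show "\<forall>\<^sub>F n in sequentially. \<forall>l\<in>{a..b}. dist (f n l) 0 < e"
    using lip
  proof eventually_elim
    case (elim n)
    show ?case
    proof
      fix l assume l: "l \<in> {a..b}"
      then obtain q where q: "q \<in> F" "dist q l < d" using F(3) by auto
      then have "q \<in> {a..b}" using F(1) by blast
      then have "\<bar>f n l - f n q\<bar> \<le> K * \<bar>l - q\<bar>" using elim(2) l by blast
      also have "\<dots> \<le> B * d"
        using q(2) B by (intro mult_mono) (auto simp: dist_real_def)
      also have "\<dots> = e / 2" using B by (simp add: d_def)
      finally show "dist (f n l) 0 < e"
        using bspec[OF elim(1) q(1)] unfolding dist_real_def by linarith
    qed
  qed
qed

lemma uniform_limit_const_in_space:
  assumes "c \<longlonglongrightarrow> (0::real)"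
  shows "uniform_limit S (\<lambda>n _. c n) (\<lambda>_. 0) sequentially"
  unfolding uniform_limit_iff
proof (intro allI impI)
  fix e :: real assume "0 < e"
  from tendstoD[OF assms this] show "\<forall>\<^sub>F n in sequentially. \<forall>x\<in>S. dist (c n) 0 < e"
    by (auto elim!: eventually_mono)
qed

lemma uniform_limit_zero_mult_bounded:
  fixes f :: "nat \<Rightarrow> real \<Rightarrow> real"
  assumes f: "uniform_limit S f (\<lambda>_. 0) sequentially" and g: "\<And>x. x \<in> S \<Longrightarrow> \<bar>g x\<bar> \<le> B"
  shows "uniform_limit S (\<lambda>n x. g x * f n x) (\<lambda>_. 0) sequentially"
proof (rule uniform_limitI)
  fix e :: real assume e: "0 < e"
  have "0 < e / (\<bar>B\<bar> + 1)" using e by simp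
  from uniform_limitD[OF f this]
  show "\<forall>\<^sub>F n in sequentially. \<forall>x\<in>S. dist (g x * f n x) 0 < e"
  proof eventually_elim
    case (elim n)
    show ?case
    proof
      fix x assume x: "x \<in> S"
      have "\<bar>g x\<bar> * \<bar>f n x\<bar> \<le> \<bar>B\<bar> * \<bar>f n x\<bar>" using g[OF x] by (intro mult_right_mono) auto
      also have "\<dots> \<le> (\<bar>B\<bar> + 1) * \<bar>f n x\<bar>" by (intro mult_right_mono) auto
      also have "\<dots> < (\<bar>B\<bar> + 1) * (e / (\<bar>B\<bar> + 1))"
        using elim x by (intro mult_strict_left_mono) (auto simp: dist_real_def)
      also have "\<dots> = e" by simp
      finally show "dist (g x * f n x) 0 < e" by (simp add: dist_real_def abs_mult)
    qed
  qed
qed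

section \<open>Convergence along a fixed realization\<close>

text \<open>One realization of the whole sequence of data, on which everything is deterministic. The
set \<open>\<Lambda>\<close> holds the penalties at which convergence may be assumed, countably many in the
application: the positive rational ones serve as a dense set, any others as grid points.\<close>

locale ridge_path =
  fixes p :: "nat \<Rightarrow> nat" and X Q D W :: "nat \<Rightarrow> real mat" and \<beta> \<epsilon> y :: "nat \<Rightarrow> real Matrix.vec"
    and \<gamma> C r \<sigma> v0 :: real and \<Lambda> :: "real set"
  assumes p: "\<And>n. 0 < p n"
    and ratio: "(\<lambda>n. real (p n) / real n) \<longlonglongrightarrow> \<gamma>" and \<gamma>: "0 < \<gamma>"
    and svd: "\<And>n. is_svd n (p n) (X n) (Q n) (D n) (W n)"
    and \<beta>: "\<And>n. \<beta> n \<in> carrier_vec (p n)" and \<epsilon>: "\<And>n. \<epsilon> n \<in> carrier_vec n"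
    and norm_\<beta>: "\<And>n. \<beta> n \<bullet> \<beta> n = r\<^sup>2 * real n"
    and y: "\<And>n. y n = X n *\<^sub>v \<beta> n + \<epsilon> n"
    and C: "0 < C" and bounded: "\<forall>\<^sub>F n in sequentially. \<forall>i. diag_entry (D n) i \<le> C"
    and v0: "0 < v0" and nondegenerate: "\<forall>\<^sub>F n in sequentially. v0 \<le> spectral_var (D n)"
    and \<Lambda>: "\<And>l. l \<in> \<Lambda> \<Longrightarrow> 0 < l" "\<And>l. l \<in> \<rat> \<Longrightarrow> 0 < l \<Longrightarrow> l \<in> \<Lambda>"
    and signal: "\<And>l k. l \<in> \<Lambda> \<Longrightarrow> (\<lambda>n. signal_dev n (p n) r (X n) (\<beta> n) k l) \<longlonglongrightarrow> 0"
    and noise: "\<And>l k. l \<in> \<Lambda> \<Longrightarrow> (\<lambda>n. noise_dev n \<sigma> (X n) (\<epsilon> n) k l) \<longlonglongrightarrow> 0"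
    and cross: "\<And>l. l \<in> \<Lambda> \<Longrightarrow> (\<lambda>n. cross_form (X n) l (\<beta> n) (\<epsilon> n) / real n) \<longlonglongrightarrow> 0"
begin

abbreviation "signal_err n \<equiv> signal_dev n (p n) r (X n) (\<beta> n)"
abbreviation "noise_err n \<equiv> noise_dev n \<sigma> (X n) (\<epsilon> n)"
abbreviation "cross_err n l \<equiv> cross_form (X n) l (\<beta> n) (\<epsilon> n) / real n"
abbreviation "risk n l \<equiv> ((ridge (X n) (y n) l - \<beta> n) \<bullet> (ridge (X n) (y n) l - \<beta> n)) / real n"
abbreviation "limit_risk n \<equiv> risk_profile (r\<^sup>2) (\<sigma>\<^sup>2) (D n)"

lemma dims: "dim_row (D n) = n" "dim_col (D n) = p n"
  using is_svd_carrier(4)[OF svd[of n]] by auto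

lemma aspect_eq: "aspect (D n) = real (p n) / real n"
  by (simp add: aspect_def dims)

lemma diag_entry_nonneg: "0 \<le> diag_entry (D n) i"
  using svd[of n] dims[of n] by (auto simp: is_svd_def diag_entry_def)

lemma eventually_regular:
  "\<forall>\<^sub>F n in sequentially. 0 < n \<and> \<gamma> / 2 \<le> aspect (D n) \<and> aspect (D n) \<le> 2 * \<gamma>
    \<and> (\<forall>i. 0 \<le> diag_entry (D n) i \<and> diag_entry (D n) i \<le> C) \<and> v0 \<le> spectral_var (D n)"
proof -
  have "\<forall>\<^sub>F n in sequentially. \<gamma> / 2 < aspect (D n)" "\<forall>\<^sub>F n in sequentially. aspect (D n) < 2 * \<gamma>"
    unfolding aspect_eq using \<gamma> by (intro order_tendstoD[OF ratio]; simp)+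
  then show ?thesis
    using eventually_gt_at_top[of 0] bounded nondegenerate
    by eventually_elim (simp add: diag_entry_nonneg)
qed

text \<open>For exponent \<open>k = 0\<close> the centred noise form is \<open>|\<epsilon>|\<^sup>2 / n - \<sigma>\<^sup>2\<close>, so the law of large
numbers for the squared noise is among the assumed limits.\<close>

lemma noise_norm_bounded: "\<forall>\<^sub>F n in sequentially. \<epsilon> n \<bullet> \<epsilon> n / real n \<le> \<sigma>\<^sup>2 + 1"
proof -
  have one: "1 \<in> \<Lambda>" by (rule \<Lambda>(2)) auto
  have "\<forall>\<^sub>F n in sequentially. noise_err n 0 1 < 1"
    by (rule order_tendstoD(2)[OF noise[OF one]]) simp
  then show ?thesis
    using eventually_gt_at_top[of 0]
  proof eventually_elim
    case (elim n)
    have one: "0 < (1::real)" by simp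
    have "noise_err n 0 1 = \<epsilon> n \<bullet> \<epsilon> n / real n - \<sigma>\<^sup>2"
      unfolding noise_dev_def resolvent_form_cogram_coord[OF svd[of n] one \<epsilon>[of n]] resolvent_trace_cogram[OF svd[of n] one]
      using sum_coord_squares[OF is_svd_carrier(5)[OF svd[of n]] \<epsilon>[of n]] elim(2) by simp
    then show ?case using elim(1) by simp
  qed
qed

lemma uniform_limit_devs:
  assumes a: "0 < a" "a < b" and k: "k = 1 \<or> k = 2"
  shows "uniform_limit {a..b} (\<lambda>n. signal_err n k) (\<lambda>_. 0) sequentially"
    and "uniform_limit {a..b} (\<lambda>n. noise_err n k) (\<lambda>_. 0) sequentially"
    and "uniform_limit {a..b} (\<lambda>n l. cross_err n l) (\<lambda>_. 0) sequentially"
proof -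
  have lip: "0 \<le> resolvent_lip a" using a by (simp add: resolvent_lip_def)
  have in_\<Lambda>: "l \<in> \<Lambda>" if "l \<in> \<rat>" "l \<in> {a..b}" for l using that a by (intro \<Lambda>(2)) auto
  show "uniform_limit {a..b} (\<lambda>n. signal_err n k) (\<lambda>_. 0) sequentially"
  proof (rule uniform_limit_of_equi_Lipschitz[OF a(2)])
    show "\<forall>\<^sub>F n in sequentially. \<forall>l\<in>{a..b}. \<forall>l'\<in>{a..b}.
      \<bar>signal_err n k l - signal_err n k l'\<bar> \<le> 2 * r\<^sup>2 * resolvent_lip a * \<bar>l - l'\<bar>"
      using eventually_gt_at_top[of 0]
    proof eventually_elim
      case (elim n)
      show ?case
        using a by (auto intro!: signal_dev_Lipschitz[OF svd[of n] \<beta>[of n] \<epsilon>[of n] elim p[of n] _ _ _ norm_\<beta>[of n] k])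
    qed
  qed (rule signal[OF in_\<Lambda>])
  show "uniform_limit {a..b} (\<lambda>n. noise_err n k) (\<lambda>_. 0) sequentially"
  proof (rule uniform_limit_of_equi_Lipschitz[OF a(2)])
    show "\<forall>\<^sub>F n in sequentially. \<forall>l\<in>{a..b}. \<forall>l'\<in>{a..b}.
      \<bar>noise_err n k l - noise_err n k l'\<bar> \<le> (\<sigma>\<^sup>2 + 1 + \<sigma>\<^sup>2) * resolvent_lip a * \<bar>l - l'\<bar>"
      using eventually_gt_at_top[of 0] noise_norm_bounded
    proof eventually_elim
      case (elim n)
      show ?case
      proof (intro ballI)
        fix l l' assume l: "l \<in> {a..b}" "l' \<in> {a..b}"
        have "\<bar>noise_err n k l - noise_err n k l'\<bar> \<le> (\<epsilon> n \<bullet> \<epsilon> n / real n + \<sigma>\<^sup>2) * resolvent_lip a * \<bar>l - l'\<bar>"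
          using l a by (intro noise_dev_Lipschitz[OF svd[of n] \<beta>[of n] \<epsilon>[of n] elim(1) p[of n] _ _ _ norm_\<beta>[of n] k]) auto
        also have "\<dots> \<le> (\<sigma>\<^sup>2 + 1 + \<sigma>\<^sup>2) * resolvent_lip a * \<bar>l - l'\<bar>"
          using elim(2) lip by (intro mult_right_mono) auto
        finally show "\<bar>noise_err n k l - noise_err n k l'\<bar> \<le> (\<sigma>\<^sup>2 + 1 + \<sigma>\<^sup>2) * resolvent_lip a * \<bar>l - l'\<bar>" .
      qed
    qed
  qed (rule noise[OF in_\<Lambda>])
  show "uniform_limit {a..b} (\<lambda>n l. cross_err n l) (\<lambda>_. 0) sequentially"
  proof (rule uniform_limit_of_equi_Lipschitz[OF a(2)])
    show "\<forall>\<^sub>F n in sequentially. \<forall>l\<in>{a..b}. \<forall>l'\<in>{a..b}.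
      \<bar>cross_err n l - cross_err n l'\<bar>
        \<le> C * (r\<^sup>2 + (\<sigma>\<^sup>2 + 1)) * resolvent_lip a * \<bar>l - l'\<bar>"
      using eventually_regular noise_norm_bounded
    proof eventually_elim
      case (elim n)
      show ?case
      proof (intro ballI)
        fix l l' assume l: "l \<in> {a..b}" "l' \<in> {a..b}"
        have "\<bar>cross_err n l - cross_err n l'\<bar>
          \<le> C * (r\<^sup>2 + \<epsilon> n \<bullet> \<epsilon> n / real n) * resolvent_lip a * \<bar>l - l'\<bar>"
          using l a elim(1) by (intro cross_form_Lipschitz[OF svd[of n] \<beta>[of n] \<epsilon>[of n] _ p[of n] _ _ _ norm_\<beta>[of n]]) auto
        also have "\<dots> \<le> C * (r\<^sup>2 + (\<sigma>\<^sup>2 + 1)) * resolvent_lip a * \<bar>l - l'\<bar>"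
          using elim(2) lip C by (intro mult_right_mono mult_left_mono add_mono) auto
        finally show "\<bar>cross_err n l - cross_err n l'\<bar>
          \<le> C * (r\<^sup>2 + (\<sigma>\<^sup>2 + 1)) * resolvent_lip a * \<bar>l - l'\<bar>" .
      qed
    qed
  qed (rule cross[OF in_\<Lambda>])
qed

lemma uniform_risk_limit:
  assumes a: "0 < a" "a < b"
  shows "uniform_limit {a..b}
    (\<lambda>n l. risk n l - limit_risk n l)
    (\<lambda>_. 0) sequentially"
proof -
  have sq: "\<bar>l\<^sup>2\<bar> \<le> b\<^sup>2" "\<bar>- (2 * l)\<bar> \<le> 2 * b" "\<bar>- l\<bar> \<le> b" if "l \<in> {a..b}" for l
    using that a by (auto intro: power_mono)
  have "uniform_limit {a..b} (\<lambda>n l. l\<^sup>2 * signal_err n 2 l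
      + - (2 * l) * cross_err n l
      + (noise_err n 1 l + - l * noise_err n 2 l)) (\<lambda>_. 0 + 0 + (0 + 0)) sequentially"
    using sq
    by (intro uniform_limit_add uniform_limit_zero_mult_bounded uniform_limit_devs[OF a]) auto
  then have lim: "uniform_limit {a..b} (\<lambda>n l. l\<^sup>2 * signal_err n 2 l
      + - (2 * l) * cross_err n l
      + (noise_err n 1 l + - l * noise_err n 2 l)) (\<lambda>_. 0) sequentially" by simp
  show ?thesis
  proof (rule uniform_limit_cong[THEN iffD1, OF _ _ lim])
    show "\<forall>\<^sub>F n in sequentially. \<forall>l\<in>{a..b}. l\<^sup>2 * signal_err n 2 l
      + - (2 * l) * cross_err n l
      + (noise_err n 1 l + - l * noise_err n 2 l)
      = risk n l - limit_risk n l"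
      using eventually_gt_at_top[of 0]
    proof eventually_elim
      case (elim n)
      show ?case
      proof
        fix l assume "l \<in> {a..b}"
        then have l: "0 < l" using a by auto
        show "l\<^sup>2 * signal_err n 2 l
      + - (2 * l) * cross_err n l
      + (noise_err n 1 l + - l * noise_err n 2 l)
      = risk n l - limit_risk n l"
          unfolding risk_dev[OF svd[of n] l \<beta>[of n] \<epsilon>[of n] y[of n] elim p[of n]] by simp
      qed
    qed
  qed simp
qed

context
  fixes L :: nat and ell :: "nat \<Rightarrow> real"
  assumes L: "2 \<le> L" and ell: "\<And>i. i \<in> {1..L} \<Longrightarrow> ell i \<in> \<Lambda>" and ell12: "ell 1 < ell 2"
begin

abbreviation "a_coef n i \<equiv> coef_a (D n) (ell i)"
abbreviation "b_coef n i \<equiv> coef_b (D n) (ell i)"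
abbreviation "gcv n l \<equiv> roti_gcv L ell (X n) (y n) (D n) l"

lemma train_err_limit:
  assumes i: "i \<in> {1..L}"
  shows "(\<lambda>n. train_err (X n) (y n) (ell i) - (r\<^sup>2 * a_coef n i + \<sigma>\<^sup>2 * b_coef n i)) \<longlonglongrightarrow> 0"
proof -
  define l where "l = ell i"
  have l: "l \<in> \<Lambda>" "0 < l" using ell[OF i] \<Lambda>(1) by (auto simp: l_def)
  have "(\<lambda>n. l\<^sup>2 * (signal_err n 1 l - l * signal_err n 2 l
      + 2 * cross_err n l + noise_err n 2 l)) \<longlonglongrightarrow> l\<^sup>2 * (0 - l * 0 + 2 * 0 + 0)"
    using l by (intro tendsto_intros signal noise cross)
  then have lim: "(\<lambda>n. l\<^sup>2 * (signal_err n 1 l - l * signal_err n 2 l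
      + 2 * cross_err n l + noise_err n 2 l)) \<longlonglongrightarrow> 0" by simp
  show ?thesis
  proof (rule Lim_transform_eventually[OF lim])
    show "\<forall>\<^sub>F n in sequentially. l\<^sup>2 * (signal_err n 1 l - l * signal_err n 2 l
      + 2 * cross_err n l + noise_err n 2 l)
      = train_err (X n) (y n) (ell i) - (r\<^sup>2 * a_coef n i + \<sigma>\<^sup>2 * b_coef n i)"
      using eventually_gt_at_top[of 0]
    proof eventually_elim
      case (elim n)
      show ?case
        unfolding l_def[symmetric] by (rule train_err_dev[OF svd[of n] l(2) \<beta>[of n] \<epsilon>[of n] y[of n] elim p[of n], symmetric])
    qed
  qed
qed

lemma coef_bounds:
  obtains c K where "0 < c" "\<forall>\<^sub>F n in sequentially. \<forall>i\<in>{1..L}. c \<le> a_coef n i \<and> a_coef n i \<le> K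
      \<and> c \<le> b_coef n i \<and> b_coef n i \<le> K"
proof -
  define lo where "lo = (\<lambda>l. l\<^sup>2 / (2 * \<gamma>) * (v0 / C\<^sup>2 / (C\<^sup>2 + l)\<^sup>2))"
  define lo' where "lo' = (\<lambda>l. l\<^sup>2 / (C\<^sup>2 + l)\<^sup>2)"
  define hi where "hi = (\<lambda>l. l\<^sup>2 / (\<gamma> / 2) * (1 / l))"
  define c where "c = Min ((\<lambda>i. min (lo (ell i)) (lo' (ell i))) ` {1..L})"
  define K where "K = Max ((\<lambda>i. max (hi (ell i)) 1) ` {1..L})"
  have pos: "0 < lo (ell i)" "0 < lo' (ell i)" if "i \<in> {1..L}" for i
  proof -
    have "0 < ell i" using \<Lambda>(1)[OF ell[OF that]] .
    moreover from this have "0 < C\<^sup>2 + ell i" by (simp add: add_nonneg_pos)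
    ultimately show "0 < lo (ell i)" "0 < lo' (ell i)" using \<gamma> v0 C by (auto simp: lo_def lo'_def)
  qed
  have ne: "{1..L} \<noteq> {}" using L by auto
  have "0 < c" unfolding c_def using pos ne by (subst Min_gr_iff) auto
  moreover have c_le: "c \<le> lo (ell i)" "c \<le> lo' (ell i)" if "i \<in> {1..L}" for i
  proof -
    have "c \<le> min (lo (ell i)) (lo' (ell i))" unfolding c_def using that by (intro Min_le) auto
    then show "c \<le> lo (ell i)" "c \<le> lo' (ell i)" by auto
  qed
  moreover have K_ge: "hi (ell i) \<le> K" "1 \<le> K" if "i \<in> {1..L}" for i
  proof -
    have "max (hi (ell i)) 1 \<le> K" unfolding K_def using that by (intro Max_ge) auto
    then show "hi (ell i) \<le> K" "1 \<le> K" by auto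
  qed
  have "\<forall>\<^sub>F n in sequentially. \<forall>i\<in>{1..L}. c \<le> a_coef n i \<and> a_coef n i \<le> K
      \<and> c \<le> b_coef n i \<and> b_coef n i \<le> K"
    using eventually_regular
  proof eventually_elim
    case (elim n)
    show ?case
    proof
      fix i assume i: "i \<in> {1..L}"
      have l: "0 < ell i" using \<Lambda>(1)[OF ell[OF i]] .
      have n: "0 < dim_row (D n)" using elim by (simp add: dims)
      have bd: "\<And>j. 0 \<le> diag_entry (D n) j \<and> diag_entry (D n) j \<le> C" using elim by blast
      have asp: "0 < \<gamma> / 2" "\<gamma> / 2 \<le> aspect (D n)" "aspect (D n) \<le> 2 * \<gamma>" "v0 \<le> spectral_var (D n)" using elim \<gamma> by auto
      note A = coef_a_bounds[OF n C bd l asp(1-3) v0 asp(4)]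
      note B = coef_b_bounds[OF n bd l]
      show "c \<le> a_coef n i \<and> a_coef n i \<le> K \<and> c \<le> b_coef n i \<and> b_coef n i \<le> K"
        using A B c_le[OF i] K_ge[OF i] unfolding lo_def lo'_def hi_def by linarith
    qed
  qed
  ultimately show ?thesis using that by blast
qed

lemma determinant_bound:
  obtains \<delta> where "0 < \<delta>" "\<forall>\<^sub>F n in sequentially.
    \<delta> \<le> \<bar>a_coef n 1 * b_coef n 2 - a_coef n 2 * b_coef n 1\<bar>"
proof -
  define \<delta> where "\<delta> = (ell 1)\<^sup>2 * (ell 2)\<^sup>2 / (2 * \<gamma>) * (2 * ell 1 * ell 2 * (ell 2 - ell 1) / (C\<^sup>2 + ell 2) ^ 8 * v0)"
  have l: "0 < ell 1" "0 < ell 2" using \<Lambda>(1)[OF ell[of 1]] \<Lambda>(1)[OF ell[of 2]] L by auto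
  have "0 < C\<^sup>2 + ell 2" using l by (simp add: add_nonneg_pos)
  then have "0 < \<delta>" unfolding \<delta>_def using l ell12 \<gamma> v0 by (intro mult_pos_pos divide_pos_pos zero_less_power) auto
  moreover have "\<forall>\<^sub>F n in sequentially.
    \<delta> \<le> \<bar>a_coef n 1 * b_coef n 2 - a_coef n 2 * b_coef n 1\<bar>"
    using eventually_regular
  proof eventually_elim
    case (elim n)
    have n: "0 < dim_row (D n)" using elim by (simp add: dims)
    have bd: "\<And>j. 0 \<le> diag_entry (D n) j \<and> diag_entry (D n) j \<le> C" using elim by blast
    have asp: "0 < aspect (D n)" "aspect (D n) \<le> 2 * \<gamma>" "v0 \<le> spectral_var (D n)" using elim \<gamma> by auto
    show ?case unfolding \<delta>_def by (rule coef_determinant_ge[OF n bd l(1) ell12 asp(1,2) v0 asp(3)])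
  qed
  ultimately show ?thesis using that by blast
qed

lemma estimators_consistent:
  shows "(\<lambda>n. sigma2_hat L ell (X n) (y n) (D n)) \<longlonglongrightarrow> \<sigma>\<^sup>2"
    and "(\<lambda>n. r2_hat L ell (X n) (y n) (D n)) \<longlonglongrightarrow> r\<^sup>2"
proof -
  obtain c K where c: "0 < c" and bd: "\<forall>\<^sub>F n in sequentially. \<forall>i\<in>{1..L}. c \<le> a_coef n i \<and> a_coef n i \<le> K
      \<and> c \<le> b_coef n i \<and> b_coef n i \<le> K" by (rule coef_bounds)
  obtain \<delta> where \<delta>: "0 < \<delta>" and det: "\<forall>\<^sub>F n in sequentially.
    \<delta> \<le> \<bar>a_coef n 1 * b_coef n 2 - a_coef n 2 * b_coef n 1\<bar>"
    by (rule determinant_bound)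
  show "(\<lambda>n. sigma2_hat L ell (X n) (y n) (D n)) \<longlonglongrightarrow> \<sigma>\<^sup>2"
    unfolding sigma2_hat_def Let_def
    by (rule ratio_regression_consistent[OF L c \<delta> train_err_limit bd det])
  have bd': "\<forall>\<^sub>F n in sequentially. \<forall>i\<in>{1..L}. c \<le> b_coef n i \<and> b_coef n i \<le> K
      \<and> c \<le> a_coef n i \<and> a_coef n i \<le> K"
    using bd by eventually_elim blast
  have det': "\<forall>\<^sub>F n in sequentially.
    \<delta> \<le> \<bar>b_coef n 1 * a_coef n 2 - b_coef n 2 * a_coef n 1\<bar>"
    using det by eventually_elim (simp add: abs_minus_commute mult.commute)
  have err': "(\<lambda>n. train_err (X n) (y n) (ell i) - (\<sigma>\<^sup>2 * b_coef n i + r\<^sup>2 * a_coef n i)) \<longlonglongrightarrow> 0"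
    if "i \<in> {1..L}" for i using train_err_limit[OF that] by (simp add: add.commute)
  show "(\<lambda>n. r2_hat L ell (X n) (y n) (D n)) \<longlonglongrightarrow> r\<^sup>2"
    unfolding r2_hat_def Let_def
    by (rule ratio_regression_consistent[OF L c \<delta> err' bd' det'])
qed

text \<open>The difference is the sum of the two estimation errors, each times a factor that is
bounded on \<open>[a, b]\<close>.\<close>

lemma uniform_gcv_limit:
  assumes a: "0 < a" "a < b"
  shows "uniform_limit {a..b} (\<lambda>n l. gcv n l - limit_risk n l) (\<lambda>_. 0) sequentially"
proof (rule uniform_limit_null_comparison)
  let ?dr = "\<lambda>n. r2_hat L ell (X n) (y n) (D n) - r\<^sup>2" and ?ds = "\<lambda>n. sigma2_hat L ell (X n) (y n) (D n) - \<sigma>\<^sup>2"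
  have "(\<lambda>n. \<bar>?dr n\<bar> * (1 + 4 / \<gamma>) + \<bar>?ds n\<bar> * (1 / a)) \<longlonglongrightarrow> \<bar>r\<^sup>2 - r\<^sup>2\<bar> * (1 + 4 / \<gamma>) + \<bar>\<sigma>\<^sup>2 - \<sigma>\<^sup>2\<bar> * (1 / a)"
    by (intro tendsto_intros estimators_consistent)
  then show "uniform_limit {a..b} (\<lambda>n _. \<bar>?dr n\<bar> * (1 + 4 / \<gamma>) + \<bar>?ds n\<bar> * (1 / a)) (\<lambda>_. 0) sequentially"
    by (intro uniform_limit_const_in_space) simp
  show "\<forall>\<^sub>F n in sequentially. \<forall>l\<in>{a..b}. norm (gcv n l - limit_risk n l)
      \<le> \<bar>?dr n\<bar> * (1 + 4 / \<gamma>) + \<bar>?ds n\<bar> * (1 / a)"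
    using eventually_regular
  proof eventually_elim
    case (elim n)
    show ?case
    proof
      fix l assume "l \<in> {a..b}"
      then have l: "0 < l" "a \<le> l" using a by auto
      have n: "0 < dim_row (D n)" using elim by (simp add: dims)
      have bd: "\<And>j. 0 \<le> diag_entry (D n) j \<and> diag_entry (D n) j \<le> C" using elim by blast
      have asp: "0 < aspect (D n)" "\<gamma> / 2 \<le> aspect (D n)" using elim \<gamma> by auto
      let ?P = "l\<^sup>2 / aspect (D n) * v_D' (D n) (- l) + (aspect (D n) - 1) / aspect (D n)"
      let ?V = "v_D (D n) (- l) - l * v_D' (D n) (- l)"
      have b: "0 \<le> coef_b (D n) l" "coef_b (D n) l \<le> 1"
      proof -
        have "0 \<le> l\<^sup>2 / (C\<^sup>2 + l)\<^sup>2" by simp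
        then show "0 \<le> coef_b (D n) l" using coef_b_bounds(1)[OF n bd l(1)] by linarith
      qed (rule coef_b_bounds(2)[OF n bd l(1)])
      have "?P = 1 + (coef_b (D n) l - 1) / aspect (D n)"
        using asp by (simp add: coef_b_def field_simps)
      then have "\<bar>?P\<bar> \<le> 1 + \<bar>(coef_b (D n) l - 1) / aspect (D n)\<bar>"
        using abs_triangle_ineq[of 1 "(coef_b (D n) l - 1) / aspect (D n)"] by simp
      also have "\<bar>(coef_b (D n) l - 1) / aspect (D n)\<bar> \<le> 1 / (\<gamma> / 2)"
        unfolding abs_divide using asp b \<gamma> by (intro frac_le) auto
      also have "1 / (\<gamma> / 2) \<le> 4 / \<gamma>" using \<gamma> by (simp add: field_simps)
      finally have P: "\<bar>?P\<bar> \<le> 1 + 4 / \<gamma>" by simp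
      have V_eq: "?V = (\<Sum>i<dim_row (D n). (diag_entry (D n) i)\<^sup>2 / ((diag_entry (D n) i)\<^sup>2 + l)\<^sup>2) / dim_row (D n)"
        by (rule v_minus_v'[OF l(1)])
      have "?V \<le> 1 / l" unfolding V_eq using resolvent_ratio_le(1)[OF _ l(1)] by (intro mean_le n) auto
      also have "\<dots> \<le> 1 / a" using a l by (intro divide_left_mono) auto
      finally have "?V \<le> 1 / a" .
      moreover have "0 \<le> ?V" unfolding V_eq by (intro divide_nonneg_nonneg sum_nonneg) auto
      ultimately have V: "\<bar>?V\<bar> \<le> 1 / a" by simp
      have eq: "gcv n l - limit_risk n l = ?dr n * ?P + ?ds n * ?V"
        unfolding roti_gcv_def risk_profile_def by (simp only: left_diff_distrib)
      have "\<bar>?dr n * ?P + ?ds n * ?V\<bar> \<le> \<bar>?dr n\<bar> * \<bar>?P\<bar> + \<bar>?ds n\<bar> * \<bar>?V\<bar>"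
        unfolding abs_mult[symmetric] by (rule abs_triangle_ineq)
      also have "\<dots> \<le> \<bar>?dr n\<bar> * (1 + 4 / \<gamma>) + \<bar>?ds n\<bar> * (1 / a)"
        using P V by (intro add_mono mult_left_mono) auto
      finally show "norm (gcv n l - limit_risk n l)
        \<le> \<bar>?dr n\<bar> * (1 + 4 / \<gamma>) + \<bar>?ds n\<bar> * (1 / a)" unfolding eq real_norm_def .
    qed
  qed
qed

lemma uniform_gcv_risk:
  assumes a: "0 < a" "a < b"
  shows "uniform_limit {a..b} (\<lambda>n l. gcv n l
    - risk n l) (\<lambda>_. 0) sequentially"
proof -
  from uniform_limit_minus[OF uniform_gcv_limit[OF a] uniform_risk_limit[OF a]]
  show ?thesis by simp
qed

end

end

section \<open>Almost sure convergence of ROTI-GCV\<close>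

theorem corollary3:
  fixes M :: "'w measure"
    and p m :: "nat \<Rightarrow> nat"
    and X Q D W Xt Qt Dt Wt :: "nat \<Rightarrow> 'w \<Rightarrow> real mat"
    and \<beta> \<epsilon> y :: "nat \<Rightarrow> 'w \<Rightarrow> real Matrix.vec"
    and \<gamma> C r \<sigma> \<eta> K lam1 lam2 :: real
    and L :: nat and ell :: "nat \<Rightarrow> real"
  assumes "prob_space M"
    and "\<And>n. 0 < p n" and "\<And>n. 0 < m n"
    and "(\<lambda>n. real (p n) / real n) \<longlonglongrightarrow> \<gamma>" and "0 < \<gamma>"
    \<comment> \<open>training design\<close>
    and "\<And>n. right_rot_invariant M n (p n) (X n)"
    and "\<And>n \<omega>. \<omega> \<in> space M \<Longrightarrow> is_svd n (p n) (X n \<omega>) (Q n \<omega>) (D n \<omega>) (W n \<omega>)"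
    and "AE \<omega> in M. limsup (\<lambda>n. ereal (Max ((\<lambda>i. D n \<omega> $$ (i, i)) ` {..<min n (p n)}))) < ereal C"
    \<comment> \<open>tacit in the formulas for the two estimators: without it their denominators may vanish or
      tend to 0, as for an orthogonal \<open>X\<close>\<close>
    and nondegenerate: "AE \<omega> in M. 0 < liminf (\<lambda>n. ereal (spectral_var (D n \<omega>)))"
    \<comment> \<open>signal\<close>
    and "0 \<le> r"
    and "\<And>n. \<beta> n \<in> M \<rightarrow>\<^sub>M vec_borel (p n)"
    and "\<And>n \<omega>. \<omega> \<in> space M \<Longrightarrow> vnorm (\<beta> n \<omega>) = r * sqrt (real n)"
    \<comment> \<open>noise\<close>
    and "\<And>n. \<epsilon> n \<in> M \<rightarrow>\<^sub>M vec_borel n"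
    and "\<And>n. prob_space.indep_vars M (\<lambda>_. borel) (\<lambda>i \<omega>. \<epsilon> n \<omega> $ i) {..<n}"
    and "\<And>n i. i < n \<Longrightarrow> (\<integral>\<omega>. \<epsilon> n \<omega> $ i \<partial>M) = 0"
    and "\<And>n i. i < n \<Longrightarrow> (\<integral>\<omega>. (\<epsilon> n \<omega> $ i)\<^sup>2 \<partial>M) = \<sigma>\<^sup>2"
    and "0 < \<eta>"
    and "\<And>n i. i < n \<Longrightarrow> integrable M (\<lambda>\<omega>. \<bar>\<epsilon> n \<omega> $ i\<bar> powr (4 + \<eta>))"
    and "\<And>n i. i < n \<Longrightarrow> (\<integral>\<omega>. \<bar>\<epsilon> n \<omega> $ i\<bar> powr (4 + \<eta>) \<partial>M) \<le> K"
    \<comment> \<open>linear model\<close>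
    and "\<And>n \<omega>. \<omega> \<in> space M \<Longrightarrow> y n \<omega> = X n \<omega> *\<^sub>v \<beta> n \<omega> + \<epsilon> n \<omega>"
    and "\<And>n. indep_rv M (mat_borel n (p n)) (X n) (vec_borel n) (\<epsilon> n)"
    and "\<And>n. indep_rv M (vec_borel (p n)) (\<beta> n)
                (mat_borel n (p n) \<Otimes>\<^sub>M vec_borel n) (\<lambda>\<omega>. (X n \<omega>, \<epsilon> n \<omega>))"
    \<comment> \<open>test design\<close>
    and "\<And>n. right_rot_invariant M (m n) (p n) (Xt n)"
    and "\<And>n \<omega>. \<omega> \<in> space M \<Longrightarrow> is_svd (m n) (p n) (Xt n \<omega>) (Qt n \<omega>) (Dt n \<omega>) (Wt n \<omega>)"
    and "\<And>n. indep_rv M (mat_borel (m n) (p n)) (Xt n)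
                (mat_borel n (p n) \<Otimes>\<^sub>M vec_borel n \<Otimes>\<^sub>M vec_borel (p n)) (\<lambda>\<omega>. (X n \<omega>, y n \<omega>, \<beta> n \<omega>))"
    and "\<And>n. 0 < n \<Longrightarrow>
           real n * (\<integral>\<omega>. mat_trace (transpose_mat (Dt n \<omega>) * Dt n \<omega>) \<partial>M) / (real (m n) * real (p n)) = 1"
    \<comment> \<open>tuning grid\<close>
    and "2 \<le> L" and "0 < ell 1" and "strict_mono_on {1..L} ell"
    and "0 < lam1" and "lam1 < lam2"
  shows "AE \<omega> in M.
           (\<lambda>n. SUP lam\<in>{lam1..lam2}.
              ereal \<bar>roti_gcv L ell (X n \<omega>) (y n \<omega>) (D n \<omega>) lam
                     - oos_risk M (m n) (Xt n) (ridge (X n \<omega>) (y n \<omega>) lam) (\<beta> n \<omega>)\<bar>)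
           \<longlonglongrightarrow> 0"
proof -
  note M = assms(1) and p = assms(2) and m = assms(3) and ratio = assms(4,5) and inv = assms(6) and svd = assms(7)
    and bounded = assms(8) and r = assms(10) and \<beta> = assms(11) and norm = assms(12) and \<epsilon> = assms(13)
    and y = assms(20) and X\<epsilon> = assms(21) and \<beta>X\<epsilon> = assms(22) and test = assms(23,24,26) and grid = assms(27,28,29)
    and lam = assms(30,31)
  interpret prob_space M by (rule M)
  \<comment> \<open>At most 1 for the Taylor bound, and at most \<open>\<eta> / 2\<close> for the moments to exist.\<close>
  define \<kappa> where "\<kappa> = min 1 (\<eta> / 2)"
  have \<kappa>: "0 < \<kappa>" "\<kappa> \<le> 1" "2 * \<kappa> \<le> \<eta>" using \<open>0 < \<eta>\<close> by (auto simp: \<kappa>_def)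
  have noise: "noise M n (\<epsilon> n) \<sigma> \<eta> \<kappa> K" if "1 \<le> n" for n
    by (rule noise.intro) (use assms(1,13-16,18,19) \<kappa> that in auto)
  have \<beta>X: "indep_rv M (vec_borel (p n)) (\<beta> n) (mat_borel n (p n)) (X n)" for n
    using indep_rv_compose_right[OF \<beta>X\<epsilon> measurable_fst M] by simp
  have scalar_norm: "\<beta> n \<omega> \<bullet> \<beta> n \<omega> = r\<^sup>2 * real n" if "\<omega> \<in> space M" for n \<omega>
  proof -
    have "\<beta> n \<omega> \<bullet> \<beta> n \<omega> = (vnorm (\<beta> n \<omega>))\<^sup>2" by (simp add: vnorm_def scalar_prod_def sum_nonneg)
    then show ?thesis by (simp add: norm[OF that] power_mult_distrib)
  qed
  \<comment> \<open>Countable, so the exceptional null sets for all these penalties together form a null set.\<close>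
  define \<Lambda> where "\<Lambda> = {l \<in> \<rat>. 0 < l} \<union> ell ` {1..L}"
  have ell_pos: "0 < ell i" if "i \<in> {1..L}" for i
  proof -
    have "ell 1 \<le> ell i" using strict_mono_on_leD[OF grid(3), of 1 i] that by auto
    then show ?thesis using grid(2) by linarith
  qed
  have \<Lambda>_pos: "0 < l" if "l \<in> \<Lambda>" for l using that ell_pos by (auto simp: \<Lambda>_def)
  have \<Lambda>_countable: "countable \<Lambda>"
  proof -
    have "countable {l \<in> \<rat>. 0 < (l::real)}" by (rule countable_subset[OF _ countable_rat]) auto
    then show ?thesis by (simp add: \<Lambda>_def)
  qed
  have "AE \<omega> in M. \<forall>l\<in>\<Lambda>. \<forall>k. (\<lambda>n. signal_dev n (p n) r (X n \<omega>) (\<beta> n \<omega>) k l) \<longlonglongrightarrow> 0"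
    unfolding AE_ball_countable[OF \<Lambda>_countable] AE_all_countable
    by (intro ballI allI AE_signal_concentration[OF M p ratio inv svd \<beta>X scalar_norm \<Lambda>_pos])
  moreover have "AE \<omega> in M. \<forall>l\<in>\<Lambda>. \<forall>k. (\<lambda>n. noise_dev n \<sigma> (X n \<omega>) (\<epsilon> n \<omega>) k l) \<longlonglongrightarrow> 0"
    unfolding AE_ball_countable[OF \<Lambda>_countable] AE_all_countable
    by (intro ballI allI AE_noise_concentration[OF M noise \<epsilon> svd X\<epsilon> \<Lambda>_pos])
  moreover have "AE \<omega> in M. \<forall>l\<in>\<Lambda>. (\<lambda>n. cross_form (X n \<omega>) l (\<beta> n \<omega>) (\<epsilon> n \<omega>) / real n) \<longlonglongrightarrow> 0"
    unfolding AE_ball_countable[OF \<Lambda>_countable]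
    by (intro ballI AE_cross_concentration[OF M noise svd X\<epsilon> \<beta>X\<epsilon> scalar_norm \<Lambda>_pos])
  ultimately show ?thesis
    using bounded nondegenerate AE_space
  proof eventually_elim
    case (elim \<omega>)
    note w = \<open>\<omega> \<in> space M\<close>
    obtain v0 where v0: "0 < v0" "ereal v0 < liminf (\<lambda>n. ereal (spectral_var (D n \<omega>)))"
      using ereal_dense2[OF elim(5)] by auto
    have nondeg: "\<forall>\<^sub>F n in sequentially. v0 \<le> spectral_var (D n \<omega>)"
      using less_LiminfD[OF v0(2)] by eventually_elim simp
    \<comment> \<open>The maximum with 1 keeps the bound positive and valid beyond the rank.\<close>
    have bd: "\<forall>\<^sub>F n in sequentially. \<forall>i. diag_entry (D n \<omega>) i \<le> max C 1"
      using Limsup_lessD[OF elim(4)]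
    proof eventually_elim
      case (elim n)
      note c = is_svd_carrier(4)[OF svd[OF w, of n]]
      show ?case
      proof
        fix i
        show "diag_entry (D n \<omega>) i \<le> max C 1"
        proof (cases "i < min n (p n)")
          case True
          then have "D n \<omega> $$ (i, i) \<le> Max ((\<lambda>i. D n \<omega> $$ (i, i)) ` {..<min n (p n)})" by (intro Max_ge) auto
          also have "\<dots> < C" using elim by simp
          finally show ?thesis using True c by (simp add: diag_entry_def)
        next
          case False
          then have "diag_entry (D n \<omega>) i = 0" using c by (auto simp: diag_entry_def)
          then show ?thesis by simp
        qed
      qed
    qed
    \<comment> \<open>At \<open>n = 0\<close> the normalization is not assumed, so only positive \<open>n\<close> are considered.\<close>
    have risk: "oos_risk M (m n) (Xt n) (ridge (X n \<omega>) (y n \<omega>) l) (\<beta> n \<omega>)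
      = ((ridge (X n \<omega>) (y n \<omega>) l - \<beta> n \<omega>) \<bullet> (ridge (X n \<omega>) (y n \<omega>) l - \<beta> n \<omega>)) / real n"
      if n: "0 < n" and l: "0 < l" for n l
    proof (rule oos_risk_eq[OF M test(1) test(2) n m p test(3)[OF n]])
      have "y n \<omega> \<in> carrier_vec n"
        unfolding y[OF w]
        by (rule add_carrier_vec[OF mult_mat_vec_carrier[OF is_svd_carrier(1)[OF svd[OF w]]
                carrier_of_measurable_vec[OF \<beta> w]] carrier_of_measurable_vec[OF \<epsilon> w]])
      then show "ridge (X n \<omega>) (y n \<omega>) l \<in> carrier_vec (p n)" by (rule ridge_svd(2)[OF svd[OF w] l])
      show "\<beta> n \<omega> \<in> carrier_vec (p n)" by (rule carrier_of_measurable_vec[OF \<beta> w])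
    qed
    interpret ridge_path p "\<lambda>n. X n \<omega>" "\<lambda>n. Q n \<omega>" "\<lambda>n. D n \<omega>" "\<lambda>n. W n \<omega>" "\<lambda>n. \<beta> n \<omega>" "\<lambda>n. \<epsilon> n \<omega>"
      "\<lambda>n. y n \<omega>" \<gamma> "max C 1" r \<sigma> v0 \<Lambda>
    proof (rule ridge_path.intro)
      show "\<beta> n \<omega> \<in> carrier_vec (p n)" for n by (rule carrier_of_measurable_vec[OF \<beta> w])
      show "\<epsilon> n \<omega> \<in> carrier_vec n" for n by (rule carrier_of_measurable_vec[OF \<epsilon> w])
      show "l \<in> \<Lambda>" if "l \<in> \<rat>" "0 < l" for l using that by (simp add: \<Lambda>_def)
    qed (use p ratio svd[OF w] scalar_norm[OF w] y[OF w] bd v0 nondeg \<Lambda>_pos elim(1-3) in auto)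
    have ell: "ell i \<in> \<Lambda>" if "i \<in> {1..L}" for i using that by (simp add: \<Lambda>_def)
    have ell12: "ell 1 < ell 2" using strict_mono_onD[OF grid(3), of 1 2] grid(1) by simp
    have limit: "uniform_limit {lam1..lam2} (\<lambda>n l. roti_gcv L ell (X n \<omega>) (y n \<omega>) (D n \<omega>) l
      - ((ridge (X n \<omega>) (y n \<omega>) l - \<beta> n \<omega>) \<bullet> (ridge (X n \<omega>) (y n \<omega>) l - \<beta> n \<omega>)) / real n) (\<lambda>_. 0) sequentially"
      by (rule uniform_gcv_risk[OF grid(1) _ ell12 lam]) (rule ell)
    let ?err = "\<lambda>n l. \<bar>roti_gcv L ell (X n \<omega>) (y n \<omega>) (D n \<omega>) l
        - oos_risk M (m n) (Xt n) (ridge (X n \<omega>) (y n \<omega>) l) (\<beta> n \<omega>)\<bar>"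
    have small: "\<forall>\<^sub>F n in sequentially. (SUP l\<in>{lam1..lam2}. ereal (?err n l)) \<le> ereal e" if e: "0 < e" for e
      using uniform_limitD[OF limit e] eventually_gt_at_top[of 0]
    proof eventually_elim
      case (elim n)
      show ?case
      proof (rule SUP_least)
        fix l assume l: "l \<in> {lam1..lam2}"
        then have "0 < l" using lam by auto
        from risk[OF elim(2) this] show "ereal (?err n l) \<le> ereal e"
          using bspec[OF elim(1) l] by (simp add: dist_real_def)
      qed
    qed
    have nonneg: "0 \<le> (SUP l\<in>{lam1..lam2}. ereal (?err n l))" for n
      by (rule SUP_upper2[of lam1]) (use lam in auto)
    show ?case
    proof (rule order_tendstoI)
      fix a :: ereal assume "a < 0"
      then show "\<forall>\<^sub>F n in sequentially. a < (SUP l\<in>{lam1..lam2}. ereal (?err n l))"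
        using nonneg by (intro always_eventually allI) (rule less_le_trans)
    next
      fix a :: ereal assume "0 < a"
      then obtain e where e: "0 < ereal e" "ereal e < a" using ereal_dense2 by blast
      then show "\<forall>\<^sub>F n in sequentially. (SUP l\<in>{lam1..lam2}. ereal (?err n l)) < a"
        using small[of e] by (auto elim!: eventually_mono)
    qed
  qed
qed

end
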